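(* Let $O_1,\dots,O_n$ be i.i.d. copies of $O=(A,X,M,Y)$, and let $\psi_0(a,a')$, $\alpha,\lambda,\gamma,\eta$, $K_h$, $m(O;\alpha,\lambda,\gamma,\psi(a,a'))$, and the cross-fitted estimator $\hat\psi^{MR}(a,a')$ with fold-specific nuisance estimators $\hat\alpha=\hat\alpha_\ell$, $\hat\lambda=\hat\lambda_\ell$, $\hat\gamma=\hat\gamma_\ell$ ($\ell=1,\dots,L$) be as defined in the context. Assume the following. (1) Identification. - Consistency: for all $a\in\mathcal A$, $m\in\mathcal M$: $Y^{(a,m)}=Y$ if $A=a$ and $M=m$; and $M^{(a)}=M$ if $A=a$. - Sequential exchangeability: for all $a,a'\in\mathcal A$, $m\in\mathcal M$: $Y^{(a,m)}\perp\{A,M\}\mid X$; $M^{(a)}\perp A\mid X$; $Y^{(a,m)}\perp M^{(a')}\mid X$. - Positivity: for all $a\in\mathcal A,m\in\mathcal M,x\in\mathcal X$: $f_{M|A,X}(m|a,x)>0$ and $f_{A|X}(a|x)>0$. (2) Kernel and bandwidth. $\int k(u)\,du=1$; $\int u\,k(u)\,du=0$; $0<\int u^6k(u)\,du<\infty$; $\int k^2(u)\,du<\infty$; $0<\int u^2k^2(u)\,du<\infty$. The bandwidth $h$ is a function of $n$ with $h\to0$, $nh^{d_A}\to\infty$ and $nh^{d_A+4}\to C_h$ for a constant $C_h$, as $n\to\infty$. (3) Regularity. - For all $Y,M,X$, the functions $f(a\mid Y,M,X)$, $f(a\mid M,X)$, $f(a\mid X)$, $\gamma(X,M,a)$, as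 functions of $a$, are three times continuously differentiable with respect to each dimension of $a$, and these functions and their first, second and third derivatives with respect to $a$ are bounded in each dimension. - $\alpha,\lambda,\gamma$ and $\hat\alpha,\hat\lambda,\hat\gamma$ are bounded, and $\alpha,\lambda,\hat\alpha,\hat\lambda$ are bounded away from zero. - $\mathrm{var}(Y\mid A=a,M=m,X=x)$ and its first and second derivatives with respect to each dimension of $a$ are bounded for any $a\in\mathcal A,m\in\mathcal M,x\in\mathcal X$. (4) $\mathbb E\big[|Y-\gamma(X,M,a)|^3\mid A=a',M=m,X=x\big]$ is bounded for any $(a,a',m,x)\in\mathcal A\times\mathcal A\times\mathcal M\times\mathcal X$, and $\int_{-\infty}^{\infty}k(u)^{c_1}k(u+\tilde c)^{c_2}\,du<\infty$ and $\int_{-\infty}^{\infty}u^2k(u)^{c_1}k(u+\tilde c)^{c_2}\,du<\infty$ for $\tilde c\in\mathbb R$ and $c_1,c_2\in\{0,1,2,3\}$ with $c_1+c_2\in\{2,3\}$. Suppose that all three nuisance function estimators $\hat\alpha,\hat\lambda,\hat\gamma$ converge in probability to some functions (not necessarily $\alpha,\lambda,\gamma$), and that at least two of the following three conditions hold, each for every $a\in\mathcal A$ as $n\to\infty$: (i) $\int(\hat\lambda(a,x)-\lambda(a,x))^2f_X(x)\,dx\xrightarrow{P}0$; (ii) $\int(\hat\alpha(a,m,x)-\alpha(a,m,x))^2f_{M,X}(m,x)\,dm\,dx\xrightarrow{P}0$; (iii) $\int(\hat\gamma(x,m,a)-\gamma(x,m,a))^2f_{M,X}(m,x)\,dm\,dx\xrightarrow{P}0$.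 Then $\hat\psi^{MR}(a,a')$ is a consistent estimator of $\psi_0(a,a')$, i.e. $\hat\psi^{MR}(a,a')\xrightarrow{P}\psi_0(a,a')$ as $n\to\infty$.
   Context: $A\in\mathcal A$ is a continuous treatment of dimension $d_A$ ($\mathcal A\subseteq\mathbb R^{d_A}$), $M\in\mathcal M$ a mediator, $X\in\mathcal X$ pre-treatment covariates, $Y\in\mathcal Y$ a (real) outcome; $a,a'\in\mathcal A$. $Y^{(a,m)}$ is the potential outcome when the treatment is set to $a$ and the mediator to $m$; $M^{(a)}$ is the potential mediator when the treatment is set to $a$. The target is $\psi_0(a,a')=\mathbb E[Y^{(a,M^{(a')})}]$. $U\perp V\mid W$ denotes conditional independence. The symbols $f_X$, $f_{M,X}$, $f_{A|X}$, $f_{M|A,X}$, $f(a\mid X)$, $f(a\mid M,X)$, $f(a\mid Y,M,X)$ denote the corresponding (conditional) densities; the last three are densities of $A$ evaluated at $a$. Nuisance functions: $\lambda(a,X)=1/f_{A|X}(a\mid X)$, $\alpha(a,M,X)=f_{M|A,X}(M\mid a,X)$, $\gamma(X,M,a)=\mathbb E[Y\mid A=a,M,X]$, and $\eta(a,a',X)=\int_{\mathcal M}\gamma(X,m,a)\,\alpha(a',m,X)\,dm$. $k(\cdot)$ is a univariate kernel function, $h>0$ a bandwidth, and $K_h(a)=h^{-d_A}\prod_{j=1}^{d_A}k(a_j/h)$. The moment function is $$m(O;\alpha,\lambda,\gamma,\psi(a,a'))=K_h(A-a)\lambda(a,X)\frac{\alpha(a',M,X)}{\alpha(a,M,X)}\{Y-\gamma(X,M,a)\}+K_h(A-a')\lambda(a',X)\{\gamma(X,M,a)-\eta(a,a',X)\}+\eta(a,a',X)-\psi(a,a'),$$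 where, when estimators $\hat\alpha,\hat\lambda,\hat\gamma$ are plugged in, $\eta$ is replaced by $\hat\eta(a,a',X)=\int_{\mathcal M}\hat\gamma(X,m,a)\hat\alpha(a',m,X)\,dm$. Cross-fitting: the indices $\{1,\dots,n\}$ are partitioned into a fixed number $L$ of folds $I_1,\dots,I_L$ of roughly equal size. For each $\ell$, $\hat\alpha_\ell,\hat\lambda_\ell,\hat\gamma_\ell$ are estimators of $\alpha,\lambda,\gamma$ computed only from the data outside fold $\ell$. $\hat\psi_\ell(a,a')$ is the solution of $\frac1{|I_\ell|}\sum_{i\in I_\ell}m(O_i;\hat\alpha_\ell,\hat\lambda_\ell,\hat\gamma_\ell,\hat\psi_\ell(a,a'))=0$, and $\hat\psi^{MR}(a,a')=\frac1L\sum_{\ell=1}^L\hat\psi_\ell(a,a')$. Assumptions on $\hat\alpha,\hat\lambda,\hat\gamma$ are understood to hold for $\hat\alpha_\ell,\hat\lambda_\ell,\hat\gamma_\ell$ for every $\ell$.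
   Formalization: a, a' are taken in the interior of 𝒜 (false at boundary points), derivatives in a at interior points; conditional independence holds at every conditioning value via fixed proper conditional laws (a.s. reading is false), with f_{M|A,X}(·|a,x) the law of M given A=a, X=x for every (a,x). *)

theory Defs
  imports "HOL-Probability.Probability"
begin

text \<open>
  \<open>\<kappa> w\<close> is the conditional probability given \<open>W = w\<close>.  Properness (the last conjunct) is demanded at
  every value \<open>w\<close>, because the potential-outcome assumptions condition on fixed values of continuous
  variables, that is, on null events.
\<close>

definition regular_cond_prob ::
  "'w measure \<Rightarrow> 'b measure \<Rightarrow> ('w \<Rightarrow> 'b) \<Rightarrow> ('b \<Rightarrow> 'w measure) \<Rightarrow> bool" where
  "regular_cond_prob P N W \<kappa> \<longleftrightarrow>
     W \<in> measurable P N \<and>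
     \<kappa> \<in> measurable N (prob_algebra P) \<and>
     (\<forall>B\<in>sets P. \<forall>C\<in>sets N.
        emeasure P (B \<inter> (W -` C \<inter> space P)) = (\<integral>\<^sup>+w\<in>C. emeasure (\<kappa> w) B \<partial>distr P N W)) \<and>
     (\<forall>w\<in>space N. AE \<omega> in \<kappa> w. W \<omega> = w)"

text \<open>
  Conditional independence of \<open>U\<close> and \<open>V\<close> given \<open>W\<close> in Dawid's form: the conditional law of \<open>U\<close> given
  \<open>V = v, W = w\<close> is the conditional law of \<open>U\<close> given \<open>W = w\<close>.  Here \<open>\<kappa>VW\<close> and \<open>\<kappa>W\<close> are the
  conditional probabilities given \<open>(V, W)\<close> and given \<open>W\<close>, and \<open>U\<close>, \<open>V\<close>, \<open>W\<close> take values in the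
  spaces of \<open>NU\<close>, \<open>NV\<close>, \<open>NW\<close>.  Equality at every \<open>(v, w)\<close>, rather than at almost every one, is what
  gives the condition content when \<open>U\<close> is one member of an uncountable family of potential variables.
\<close>

definition cond_indep_values ::
  "'u measure \<Rightarrow> ('w \<Rightarrow> 'u) \<Rightarrow> 'v measure \<Rightarrow> ('v \<times> 'c \<Rightarrow> 'w measure) \<Rightarrow>
   'c measure \<Rightarrow> ('c \<Rightarrow> 'w measure) \<Rightarrow> bool" where
  "cond_indep_values NU U NV \<kappa>VW NW \<kappa>W \<longleftrightarrow>
     (\<forall>v\<in>space NV. \<forall>w\<in>space NW. distr (\<kappa>VW (v, w)) NU U = distr (\<kappa>W w) NU U)"

definition cond_density ::
  "'w measure \<Rightarrow> 'b measure \<Rightarrow> ('w \<Rightarrow> 'b) \<Rightarrow> 'c measure \<Rightarrow> ('w \<Rightarrow> 'c) \<Rightarrow> ('b \<Rightarrow> 'c \<Rightarrow> real) \<Rightarrow> bool" where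
  "cond_density P \<mu> U N W f \<longleftrightarrow>
     (\<forall>u\<in>space \<mu>. \<forall>w\<in>space N. 0 \<le> f u w) \<and>
     (\<lambda>(u, w). f u w) \<in> borel_measurable (\<mu> \<Otimes>\<^sub>M N) \<and>
     distr P (\<mu> \<Otimes>\<^sub>M N) (\<lambda>\<omega>. (U \<omega>, W \<omega>)) =
       density (\<mu> \<Otimes>\<^sub>M distr P N W) (\<lambda>(u, w). ennreal (f u w))"

definition conv_in_prob :: "'s measure \<Rightarrow> (nat \<Rightarrow> 's \<Rightarrow> real) \<Rightarrow> real \<Rightarrow> bool" where
  "conv_in_prob S Z z \<longleftrightarrow>
     (\<forall>\<epsilon>>0. (\<lambda>n. measure S {s \<in> space S. \<epsilon> < \<bar>Z n s - z\<bar>}) \<longlonglongrightarrow> 0)"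

text \<open>
  Differentiability ``with respect to each dimension'': only the pure partial derivatives
  \<open>\<partial>\<^sub>j\<^sup>q F\<close> are involved, no mixed ones.  Derivatives are considered at interior points only.
\<close>

definition partial_deriv :: "'d::finite \<Rightarrow> (real^'d \<Rightarrow> real) \<Rightarrow> real^'d \<Rightarrow> real" where
  "partial_deriv j F a = deriv (\<lambda>t. F (a + t *\<^sub>R axis j 1)) 0"

definition coord_differentiable :: "nat \<Rightarrow> (real^'d::finite) set \<Rightarrow> (real^'d \<Rightarrow> real) \<Rightarrow> bool" where
  "coord_differentiable r S F \<longleftrightarrow>
     (\<forall>j. \<forall>q<r. \<forall>a\<in>S.
        (\<lambda>t::real. (partial_deriv j ^^ q) F (a + t *\<^sub>R axis j 1)) differentiable (at 0))"

definition coord_C :: "nat \<Rightarrow> (real^'d::finite) set \<Rightarrow> (real^'d \<Rightarrow> real) \<Rightarrow> bool" where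
  "coord_C r S F \<longleftrightarrow>
     coord_differentiable r S F \<and>
     (\<forall>j. \<forall>q\<le>r. continuous_on S ((partial_deriv j ^^ q) F))"

definition coord_derivs_le ::
  "real \<Rightarrow> nat \<Rightarrow> (real^'d::finite) set \<Rightarrow> (real^'d \<Rightarrow> real) \<Rightarrow> bool" where
  "coord_derivs_le B r S F \<longleftrightarrow>
     (\<forall>a\<in>S. \<bar>F a\<bar> \<le> B) \<and>
     (\<forall>j. \<forall>q\<in>{1..r}. \<forall>a\<in>interior S. \<bar>(partial_deriv j ^^ q) F a\<bar> \<le> B)"

abbreviation leb_on :: "(real^'d::finite) set \<Rightarrow> (real^'d) measure" where
  "leb_on \<A> \<equiv> restrict_space lborel \<A>"

definition obs_space ::
  "(real^'d::finite) set \<Rightarrow> 'x measure \<Rightarrow> 'm measure \<Rightarrow> real set \<Rightarrow>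
   ((real^'d) \<times> 'x \<times> 'm \<times> real) measure" where
  "obs_space \<A> \<nu>X \<nu>M \<Y> = leb_on \<A> \<Otimes>\<^sub>M (\<nu>X \<Otimes>\<^sub>M (\<nu>M \<Otimes>\<^sub>M restrict_space borel \<Y>))"

definition prod_kernel :: "(real \<Rightarrow> real) \<Rightarrow> real \<Rightarrow> real^'d::finite \<Rightarrow> real" where
  "prod_kernel k h u = (\<Prod>j\<in>UNIV. k (u $ j / h)) / h ^ CARD('d)"

definition eta_of ::
  "'m measure \<Rightarrow> ('a \<Rightarrow> 'm \<Rightarrow> 'x \<Rightarrow> real) \<Rightarrow> ('x \<Rightarrow> 'm \<Rightarrow> 'a \<Rightarrow> real) \<Rightarrow> 'a \<Rightarrow> 'a \<Rightarrow> 'x \<Rightarrow> real" where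
  "eta_of \<nu>M \<alpha> \<gamma> a a' x = (\<integral>m. \<gamma> x m a * \<alpha> a' m x \<partial>\<nu>M)"

fun moment ::
  "'m measure \<Rightarrow> (real \<Rightarrow> real) \<Rightarrow> real \<Rightarrow> real^'d::finite \<Rightarrow> real^'d \<Rightarrow>
   ((real^'d) \<times> 'x \<times> 'm \<times> real) \<Rightarrow>
   (real^'d \<Rightarrow> 'm \<Rightarrow> 'x \<Rightarrow> real) \<Rightarrow> (real^'d \<Rightarrow> 'x \<Rightarrow> real) \<Rightarrow> ('x \<Rightarrow> 'm \<Rightarrow> real^'d \<Rightarrow> real) \<Rightarrow>
   real \<Rightarrow> real" where
  "moment \<nu>M k h a a' (A, X, M, Y) \<alpha> lambda \<gamma> \<psi> =
     prod_kernel k h (A - a) * lambda a X * (\<alpha> a' M X / \<alpha> a M X) * (Y - \<gamma> X M a)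
     + prod_kernel k h (A - a') * lambda a' X * (\<gamma> X M a - eta_of \<nu>M \<alpha> \<gamma> a a' X)
     + eta_of \<nu>M \<alpha> \<gamma> a a' X - \<psi>"

definition outside_fold :: "(nat \<Rightarrow> nat \<Rightarrow> nat set) \<Rightarrow> nat \<Rightarrow> nat \<Rightarrow> nat set" where
  "outside_fold I n l = {1..n} - I n l"

definition training_data ::
  "(nat \<Rightarrow> nat \<Rightarrow> nat set) \<Rightarrow> (nat \<Rightarrow> 's \<Rightarrow> 'o) \<Rightarrow> nat \<Rightarrow> nat \<Rightarrow> 's \<Rightarrow> (nat \<Rightarrow> 'o)" where
  "training_data I Ob n l s = (\<lambda>i\<in>outside_fold I n l. Ob i s)"

end

theory Submission
  imports Defs
begin

text \<open>
  Conditionally on the data outside a fold, the fold average of the moment function is an average of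
  i.i.d.\ terms with second moment \<open>O(1 + h\<^sup>-\<^sup>d)\<close>, so it differs from its conditional mean by
  \<open>O\<^sub>P((n h\<^sup>d)\<^sup>-\<^sup>1\<^sup>/\<^sup>2)\<close>.  As \<open>h \<rightarrow> 0\<close> the kernel localizes the treatment, uniformly over bounded plug-in
  nuisances, and by the identification formula the limit of the conditional mean minus \<open>\<psi>\<^sub>0\<close> is the integral of
  \[ \Bigl(\frac{\hat\lambda}{\lambda}\frac{\alpha}{\hat\alpha}\hat\alpha' - \alpha'\Bigr)(\gamma - \hat\gamma)
     + \Bigl(\frac{\hat\lambda'}{\lambda'} - 1\Bigr)\hat\gamma(\alpha' - \hat\alpha') \]
  against \<open>f\<^sub>X(x) dm dx\<close>, where primes denote evaluation at \<open>a'\<close>.  Each summand is bounded by the error of any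
  one of its factors, so the integral vanishes as soon as two of the three nuisances are consistent.
\<close>

section \<open>Convergence in probability and cross-fitting\<close>

lemma conv_in_prob_squeeze:
  assumes "\<And>\<epsilon>. 0 < \<epsilon> \<Longrightarrow> \<exists>v. v \<longlonglongrightarrow> 0 \<and>
      (\<forall>\<^sub>F n in sequentially. measure S {s \<in> space S. \<epsilon> < \<bar>Z n s - z\<bar>} \<le> v n)"
  shows "conv_in_prob S Z z"
  unfolding conv_in_prob_def
proof (intro allI impI)
  fix \<epsilon> :: real assume "\<epsilon> > 0"
  from assms[OF this] obtain v where v: "v \<longlonglongrightarrow> 0"
    "\<forall>\<^sub>F n in sequentially. measure S {s \<in> space S. \<epsilon> < \<bar>Z n s - z\<bar>} \<le> v n"
    by blast
  show "(\<lambda>n. measure S {s \<in> space S. \<epsilon> < \<bar>Z n s - z\<bar>}) \<longlonglongrightarrow> 0"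
    by (rule tendsto_sandwich[OF _ v(2) tendsto_const v(1)]) simp
qed

lemma conv_in_probD:
  "conv_in_prob S U 0 \<Longrightarrow> 0 < \<epsilon> \<Longrightarrow> (\<lambda>n. measure S {s \<in> space S. \<epsilon> < \<bar>U n s\<bar>}) \<longlonglongrightarrow> 0"
  by (simp add: conv_in_prob_def)

lemma conv_in_prob_dominated:
  assumes S: "prob_space S" and U: "conv_in_prob S U 0"
    and U_meas: "\<And>n. U n \<in> borel_measurable S"
    and le: "eventually (\<lambda>n. \<forall>s\<in>space S. \<bar>Z n s - z\<bar> \<le> U n s) sequentially"
  shows "conv_in_prob S Z z"
proof (rule conv_in_prob_squeeze, intro exI conjI)
  interpret prob_space S by (rule S)
  fix \<epsilon> :: real assume "\<epsilon> > 0"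
  then show "(\<lambda>n. prob {s \<in> space S. \<epsilon> < \<bar>U n s\<bar>}) \<longlonglongrightarrow> 0" by (rule conv_in_probD[OF U])
  show "\<forall>\<^sub>F n in sequentially. prob {s \<in> space S. \<epsilon> < \<bar>Z n s - z\<bar>} \<le> prob {s \<in> space S. \<epsilon> < \<bar>U n s\<bar>}"
    using le
  proof eventually_elim
    case (elim n)
    then show ?case
      using U_meas[of n] by (intro finite_measure_mono) force+
  qed
qed

lemma conv_in_prob_add:
  assumes S: "prob_space S" and U: "conv_in_prob S U 0" and V: "conv_in_prob S V 0"
    and [measurable]: "\<And>n. U n \<in> borel_measurable S" "\<And>n. V n \<in> borel_measurable S"
  shows "conv_in_prob S (\<lambda>n s. U n s + V n s) 0"
proof (rule conv_in_prob_squeeze, intro exI conjI)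
  interpret prob_space S by (rule S)
  fix \<epsilon> :: real assume e: "\<epsilon> > 0"
  let ?u = "\<lambda>n. {s \<in> space S. \<epsilon> / 2 < \<bar>U n s\<bar>}" and ?v = "\<lambda>n. {s \<in> space S. \<epsilon> / 2 < \<bar>V n s\<bar>}"
  show "(\<lambda>n. prob (?u n) + prob (?v n)) \<longlonglongrightarrow> 0"
    using e by (intro tendsto_add_zero conv_in_probD U V) auto
  have "prob {s \<in> space S. \<epsilon> < \<bar>U n s + V n s - 0\<bar>} \<le> prob (?u n \<union> ?v n)" for n
    by (intro finite_measure_mono) auto
  moreover have "prob (?u n \<union> ?v n) \<le> prob (?u n) + prob (?v n)" for n
    by (intro measure_Un_le) auto
  ultimately show "\<forall>\<^sub>F n in sequentially. prob {s \<in> space S. \<epsilon> < \<bar>U n s + V n s - 0\<bar>} \<le> prob (?u n) + prob (?v n)"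
    by (intro always_eventually allI) (rule order_trans)
qed

lemma conv_in_prob_cmult:
  assumes U: "conv_in_prob S U 0"
  shows "conv_in_prob S (\<lambda>n s. c * U n s) 0"
proof (cases "c = 0")
  case False
  have "(\<epsilon> < \<bar>c * u - 0\<bar>) = (\<epsilon> / \<bar>c\<bar> < \<bar>u - 0\<bar>)" for \<epsilon> u :: real
    using False by (simp add: abs_mult field_simps)
  then show ?thesis
    using U False by (simp add: conv_in_prob_def)
qed (simp add: conv_in_prob_def)

lemma conv_in_prob_sum:
  assumes S: "prob_space S"
    and U: "\<And>l. l \<in> F \<Longrightarrow> conv_in_prob S (U l) 0"
    and U_meas: "\<And>l n. l \<in> F \<Longrightarrow> U l n \<in> borel_measurable S"
  shows "conv_in_prob S (\<lambda>n s. \<Sum>l\<in>F. U l n s) 0"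
  using U U_meas
proof (induction F rule: infinite_finite_induct)
  case (insert l F)
  then show ?case
    by (simp, intro conv_in_prob_add S) auto
qed (auto simp: conv_in_prob_def)

lemma conv_in_prob_abs: "conv_in_prob S U 0 \<Longrightarrow> conv_in_prob S (\<lambda>n s. \<bar>U n s\<bar>) 0"
  by (simp add: conv_in_prob_def)

lemma conv_in_prob_const: "v \<longlonglongrightarrow> 0 \<Longrightarrow> conv_in_prob S (\<lambda>n s. v n) 0"
proof (rule conv_in_prob_squeeze, intro exI conjI)
  fix \<epsilon> :: real assume "v \<longlonglongrightarrow> 0" "\<epsilon> > 0"
  then have "\<forall>\<^sub>F n in sequentially. \<bar>v n\<bar> < \<epsilon>"
    using tendstoD[of v 0 sequentially \<epsilon>] by (simp add: dist_real_def)
  then show "\<forall>\<^sub>F n in sequentially. measure S {s \<in> space S. \<epsilon> < \<bar>v n - 0\<bar>} \<le> 0"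
    by eventually_elim auto
qed simp

lemma conv_in_prob_second_moment:
  assumes S: "prob_space S"
    and [measurable]: "\<And>n. Z n \<in> borel_measurable S"
    and le: "eventually (\<lambda>n. (\<integral>\<^sup>+s. ennreal ((Z n s)\<^sup>2) \<partial>S) \<le> ennreal (v n)) sequentially"
    and lim: "v \<longlonglongrightarrow> 0"
  shows "conv_in_prob S Z 0"
proof (rule conv_in_prob_squeeze, intro exI conjI)
  interpret prob_space S by (rule S)
  fix \<epsilon> :: real assume e: "\<epsilon> > 0"
  show "(\<lambda>n. \<bar>v n\<bar> / \<epsilon>\<^sup>2) \<longlonglongrightarrow> 0"
    using lim by (intro tendsto_divide_zero tendsto_rabs_zero)
  show "\<forall>\<^sub>F n in sequentially. prob {s \<in> space S. \<epsilon> < \<bar>Z n s - 0\<bar>} \<le> \<bar>v n\<bar> / \<epsilon>\<^sup>2"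
    using le
  proof eventually_elim
    case (elim n)
    let ?E = "{s \<in> space S. \<epsilon> < \<bar>Z n s - 0\<bar>}"
    have "ennreal (\<epsilon>\<^sup>2) * emeasure S ?E = (\<integral>\<^sup>+s. ennreal (\<epsilon>\<^sup>2) * indicator ?E s \<partial>S)"
      by (subst nn_integral_cmult_indicator) auto
    also have "\<dots> \<le> (\<integral>\<^sup>+s. ennreal ((Z n s)\<^sup>2) \<partial>S)"
    proof (intro nn_integral_mono)
      fix s
      have "\<epsilon>\<^sup>2 \<le> (Z n s)\<^sup>2" if "\<epsilon> < \<bar>Z n s\<bar>"
        using that e by (metis abs_le_square_iff abs_of_pos less_imp_le)
      then show "ennreal (\<epsilon>\<^sup>2) * indicator ?E s \<le> ennreal ((Z n s)\<^sup>2)"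
        by (auto split: split_indicator intro: ennreal_leI)
    qed
    also note elim
    also have "ennreal (v n) \<le> ennreal \<bar>v n\<bar>"
      by (intro ennreal_leI) simp
    finally have "\<epsilon>\<^sup>2 * prob ?E \<le> \<bar>v n\<bar>"
      by (simp add: emeasure_eq_measure ennreal_mult[symmetric])
    then show ?case
      using e by (simp add: field_simps)
  qed
qed

lemma conv_in_prob_absorb:
  assumes S: "prob_space S" and R: "conv_in_prob S R 0"
    and [measurable]: "\<And>n. R n \<in> borel_measurable S"
    and le: "\<And>n s \<delta>. s \<in> space S \<Longrightarrow> \<delta> > 0 \<Longrightarrow> \<bar>Z n s\<bar> \<le> C * \<delta> + C / \<delta> * R n s"
    and C: "C > 0"
  shows "conv_in_prob S Z 0"
proof (rule conv_in_prob_squeeze, intro exI conjI)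
  interpret prob_space S by (rule S)
  fix \<epsilon> :: real assume e: "\<epsilon> > 0"
  define \<delta> where "\<delta> = \<epsilon> / (2 * C)"
  have d: "\<delta> > 0" "C * \<delta> = \<epsilon> / 2" using e C by (auto simp: \<delta>_def)
  let ?E = "\<lambda>n. {s \<in> space S. \<epsilon> / 2 < \<bar>C / \<delta> * R n s\<bar>}"
  show "(\<lambda>n. prob (?E n)) \<longlonglongrightarrow> 0"
    using e by (intro conv_in_probD conv_in_prob_cmult R) simp
  have "{s \<in> space S. \<epsilon> < \<bar>Z n s - 0\<bar>} \<subseteq> ?E n" for n
  proof
    fix s assume s: "s \<in> {s \<in> space S. \<epsilon> < \<bar>Z n s - 0\<bar>}"
    then have "\<epsilon> < \<bar>Z n s\<bar>" "s \<in> space S" by auto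
    with le[of s \<delta> n] d have "\<epsilon> / 2 < C / \<delta> * R n s"
      by linarith
    then show "s \<in> ?E n"
      using s by (auto intro: less_le_trans[OF _ abs_ge_self] simp del: times_divide_eq_left)
  qed
  then show "\<forall>\<^sub>F n in sequentially. prob {s \<in> space S. \<epsilon> < \<bar>Z n s - 0\<bar>} \<le> prob (?E n)"
    by (intro always_eventually allI finite_measure_mono) auto
qed

lemma second_moment_iid_sum:
  fixes f :: "'o \<Rightarrow> real" and V :: real
  assumes S: "prob_space S" and ind: "prob_space.indep_vars S (\<lambda>_. N) Ob J" and J: "finite J"
    and law: "\<And>i. i \<in> J \<Longrightarrow> distr S N (Ob i) = R"
    and f[measurable]: "f \<in> borel_measurable N"
    and V: "(\<integral>\<^sup>+z. ennreal ((f z)\<^sup>2) \<partial>R) \<le> ennreal V" "0 \<le> V"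
  shows "(\<integral>\<^sup>+s. ennreal ((\<Sum>i\<in>J. f (Ob i s) - (\<integral>z. f z \<partial>R))\<^sup>2) \<partial>S) \<le> ennreal (card J * V)"
proof (cases "J = {}")
  case False
  interpret prob_space S by (rule S)
  have Ob[measurable]: "Ob i \<in> measurable S N" if "i \<in> J" for i
    using ind that by (simp add: indep_vars_def2)
  obtain j where j: "j \<in> J" using False by blast
  have sets_R[measurable_cong]: "sets R = sets N" using law[OF j] by (metis sets_distr)
  interpret R: prob_space R
    using law[OF j] prob_space_distr[OF Ob[OF j]] by simp
  have f2: "integrable R (\<lambda>z. (f z)\<^sup>2)"
    using V by (intro integrableI_bounded) (auto simp: less_top[symmetric] top_unique)
  have f1: "integrable R f"
    by (rule R.square_integrable_imp_integrable) (use f2 in auto)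
  define c where "c = (\<integral>z. f z \<partial>R)"
  define Z where "Z i s = f (Ob i s) - c" for i s
  have iZ: "integrable S (\<lambda>s. g (Ob i s))" "(\<integral>s. g (Ob i s) \<partial>S) = (\<integral>z. g z \<partial>R)"
    if "i \<in> J" "integrable R g" for i and g :: "'o \<Rightarrow> real"
  proof -
    have "g \<in> borel_measurable N" using that(2) by (simp add: measurable_cong_sets[OF sets_R refl, symmetric])
    then show "integrable S (\<lambda>s. g (Ob i s))" "(\<integral>s. g (Ob i s) \<partial>S) = (\<integral>z. g z \<partial>R)"
      using integrable_distr_eq[OF Ob[OF that(1)], of g] integral_distr[OF Ob[OF that(1)], of g]
        law[OF that(1)] that(2) by auto
  qed
  have Z1: "integrable S (Z i)" "expectation (Z i) = 0" if "i \<in> J" for i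
    unfolding Z_def using iZ[OF that f1] by (auto simp: c_def prob_space)
  have sq: "(f z - c)\<^sup>2 = (f z)\<^sup>2 - 2 * c * f z + c\<^sup>2" for z
    by (simp add: power2_eq_square algebra_simps)
  have Z2: "integrable S (\<lambda>s. (Z i s)\<^sup>2)" "expectation (\<lambda>s. (Z i s)\<^sup>2) \<le> V" if "i \<in> J" for i
  proof -
    have I: "integrable R (\<lambda>z. (f z - c)\<^sup>2)" using f1 f2 by (auto simp: sq)
    show "integrable S (\<lambda>s. (Z i s)\<^sup>2)" using iZ(1)[OF that I] by (simp add: Z_def)
    have "expectation (\<lambda>s. (Z i s)\<^sup>2) = (\<integral>z. (f z - c)\<^sup>2 \<partial>R)"
      using iZ(2)[OF that I] by (simp add: Z_def)
    also have "\<dots> = (\<integral>z. (f z)\<^sup>2 \<partial>R) - c\<^sup>2"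
      using f1 f2 by (simp add: sq R.prob_space c_def[symmetric]) (simp add: power2_eq_square)
    also have "\<dots> \<le> (\<integral>z. (f z)\<^sup>2 \<partial>R)" by simp
    also have "\<dots> \<le> V"
      using V f2 by (simp add: nn_integral_eq_integral)
    finally show "expectation (\<lambda>s. (Z i s)\<^sup>2) \<le> V" .
  qed
  have cross: "integrable S (\<lambda>s. Z i s * Z j s) \<and> expectation (\<lambda>s. Z i s * Z j s) = 0"
    if "i \<in> J" "j \<in> J" "i \<noteq> j" for i j
  proof -
    have "indep_var (Pi\<^sub>M {i} (\<lambda>_. N)) (\<lambda>s. \<lambda>i\<in>{i}. Ob i s) (Pi\<^sub>M {j} (\<lambda>_. N)) (\<lambda>s. \<lambda>i\<in>{j}. Ob i s)"
      using that by (intro indep_var_restrict[OF ind]) auto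
    then have "indep_var borel ((\<lambda>e. f (e i) - c) \<circ> (\<lambda>s. \<lambda>i\<in>{i}. Ob i s))
        borel ((\<lambda>e. f (e j) - c) \<circ> (\<lambda>s. \<lambda>i\<in>{j}. Ob i s))"
      by (rule indep_var_compose) measurable
    then have "indep_var borel (Z i) borel (Z j)"
      by (simp add: Z_def[abs_def] comp_def)
    from indep_var_integrable[OF this] indep_var_lebesgue_integral[OF this] show ?thesis
      using Z1 that by auto
  qed
  have int: "integrable S (\<lambda>s. Z i s * Z j s)" if "i \<in> J" "j \<in> J" for i j
    using cross[OF that] Z2(1)[of i] that by (cases "i = j") (auto simp: power2_eq_square)
  have "expectation (\<lambda>s. (\<Sum>i\<in>J. Z i s)\<^sup>2) = (\<Sum>i\<in>J. \<Sum>j\<in>J. expectation (\<lambda>s. Z i s * Z j s))"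
    using int by (simp add: power2_eq_square sum_product)
  also have "\<dots> = (\<Sum>i\<in>J. \<Sum>j\<in>J. if i = j then expectation (\<lambda>s. (Z i s)\<^sup>2) else 0)"
    using cross by (intro sum.cong refl) (auto simp: power2_eq_square)
  also have "\<dots> = (\<Sum>i\<in>J. expectation (\<lambda>s. (Z i s)\<^sup>2))"
    using J by simp
  also have "\<dots> \<le> (\<Sum>i\<in>J. V)"
    using Z2 by (intro sum_mono) auto
  finally have "expectation (\<lambda>s. (\<Sum>i\<in>J. Z i s)\<^sup>2) \<le> card J * V" by simp
  moreover have "integrable S (\<lambda>s. (\<Sum>i\<in>J. Z i s)\<^sup>2)"
    using int by (simp add: power2_eq_square sum_product)
  ultimately show ?thesis
    by (simp add: nn_integral_eq_integral Z_def c_def ennreal_leI del: of_nat_mult)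
qed simp

text \<open>
  Data outside the fold are independent of the fold, so the previous bound applies for each fixed
  value of the training data.
\<close>

lemma second_moment_cross_fit:
  fixes g :: "(nat \<Rightarrow> 'o) \<Rightarrow> 'o \<Rightarrow> real" and Ob :: "nat \<Rightarrow> 's \<Rightarrow> 'o"
  assumes S: "prob_space S" and ind: "prob_space.indep_vars S (\<lambda>_. N) Ob T"
    and law: "\<And>i. i \<in> T \<Longrightarrow> distr S N (Ob i) = R" and R: "prob_space R" "sets R = sets N"
    and J: "finite J" "J \<noteq> {}" "J \<subseteq> T" "K \<subseteq> T" "J \<inter> K = {}"
    and g[measurable]: "(\<lambda>(D, z). g D z) \<in> borel_measurable (Pi\<^sub>M K (\<lambda>_. N) \<Otimes>\<^sub>M N)"
    and V: "\<And>D. D \<in> space (Pi\<^sub>M K (\<lambda>_. N)) \<Longrightarrow> (\<integral>\<^sup>+z. ennreal ((g D z)\<^sup>2) \<partial>R) \<le> ennreal V" "0 \<le> V"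
  defines "tr \<equiv> \<lambda>s. \<lambda>i\<in>K. Ob i s"
  shows "(\<integral>\<^sup>+s. ennreal (((\<Sum>i\<in>J. g (tr s) (Ob i s)) / card J - (\<integral>z. g (tr s) z \<partial>R))\<^sup>2) \<partial>S)
      \<le> ennreal (V / card J)"
proof -
  interpret prob_space S by (rule S)
  interpret R: prob_space R by (rule R)
  note R(2)[measurable_cong]
  define ev where "ev s = (\<lambda>i\<in>J. Ob i s)" for s
  let ?K = "Pi\<^sub>M K (\<lambda>_. N)" and ?J = "Pi\<^sub>M J (\<lambda>_. N)"
  have Ob[measurable]: "Ob i \<in> measurable S N" if "i \<in> T" for i
    using ind that by (simp add: indep_vars_def2)
  have tr[measurable]: "tr \<in> measurable S ?K" and ev[measurable]: "ev \<in> measurable S ?J"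
    unfolding tr_def ev_def using J by (auto intro!: measurable_restrict Ob)
  have "indep_var ?K tr ?J ev"
    unfolding tr_def ev_def using indep_var_restrict[OF ind, of K J] J by auto
  then have prod: "distr S (?K \<Otimes>\<^sub>M ?J) (\<lambda>s. (tr s, ev s)) = distr S ?K tr \<Otimes>\<^sub>M distr S ?J ev"
    by (simp add: indep_var_distribution_eq)
  interpret tr: prob_space "distr S ?K tr" by (rule prob_space_distr) simp
  interpret ev: prob_space "distr S ?J ev" by (rule prob_space_distr) simp
  define m where "m D = (\<integral>z. g D z \<partial>R)" for D
  have m[measurable]: "m \<in> borel_measurable ?K" unfolding m_def by measurable
  define r where "r = real (card J)"
  have r: "r > 0" using J by (auto simp: r_def card_gt_0_iff)
  define H where "H = (\<lambda>(D, e). ennreal (((\<Sum>i\<in>J. g D (e i)) / r - m D)\<^sup>2))"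
  have H[measurable]: "H \<in> borel_measurable (?K \<Otimes>\<^sub>M ?J)"
  proof -
    have "(\<lambda>x. g (fst x) (snd x i)) \<in> borel_measurable (?K \<Otimes>\<^sub>M ?J)" if "i \<in> J" for i
      using that by measurable
    then show ?thesis unfolding H_def by measurable
  qed
  have ind_J: "indep_vars (\<lambda>_. N) Ob J" using ind J(3) by (rule indep_vars_subset)
  have "(\<integral>\<^sup>+s. ennreal (((\<Sum>i\<in>J. g (tr s) (Ob i s)) / r - m (tr s))\<^sup>2) \<partial>S)
      = (\<integral>\<^sup>+s. H (tr s, ev s) \<partial>S)"
    unfolding H_def by (intro nn_integral_cong) (simp add: ev_def)
  also have "\<dots> = (\<integral>\<^sup>+x. H x \<partial>distr S (?K \<Otimes>\<^sub>M ?J) (\<lambda>s. (tr s, ev s)))"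
    by (subst nn_integral_distr) auto
  also have "\<dots> = (\<integral>\<^sup>+D. \<integral>\<^sup>+e. H (D, e) \<partial>distr S ?J ev \<partial>distr S ?K tr)"
    unfolding prod by (subst ev.nn_integral_fst[symmetric]) auto
  also have "\<dots> \<le> (\<integral>\<^sup>+D. ennreal (V / r) \<partial>distr S ?K tr)"
  proof (intro nn_integral_mono)
    fix D assume "D \<in> space (distr S ?K tr)"
    then have D: "D \<in> space ?K" by simp
    have [measurable]: "g D \<in> borel_measurable N"
      using measurable_compose[OF measurable_Pair1'[OF D] g] by simp
    have [measurable]: "(\<lambda>e. H (D, e)) \<in> borel_measurable ?J"
      using measurable_compose[OF measurable_Pair1'[OF D] H] by simp
    have "(\<integral>\<^sup>+e. H (D, e) \<partial>distr S ?J ev) = (\<integral>\<^sup>+s. H (D, ev s) \<partial>S)"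
      by (subst nn_integral_distr) auto
    also have "\<dots> = (\<integral>\<^sup>+s. ennreal (1 / r\<^sup>2) * ennreal ((\<Sum>i\<in>J. g D (Ob i s) - m D)\<^sup>2) \<partial>S)"
    proof (intro nn_integral_cong)
      fix s
      have "(\<Sum>i\<in>J. g D (Ob i s)) / r - m D = (\<Sum>i\<in>J. g D (Ob i s) - m D) / r"
        using r by (simp add: sum_subtractf r_def[symmetric] field_simps)
      then show "H (D, ev s) = ennreal (1 / r\<^sup>2) * ennreal ((\<Sum>i\<in>J. g D (Ob i s) - m D)\<^sup>2)"
        by (simp add: H_def ev_def power_divide ennreal_mult[symmetric])
    qed
    also have "\<dots> = ennreal (1 / r\<^sup>2) * (\<integral>\<^sup>+s. ennreal ((\<Sum>i\<in>J. g D (Ob i s) - m D)\<^sup>2) \<partial>S)"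
    proof (rule nn_integral_cmult)
      have "(\<lambda>s. g D (Ob i s)) \<in> borel_measurable S" if "i \<in> J" for i
        using that J(3) by (intro measurable_compose[OF Ob[of i]]) auto
      then show "(\<lambda>s. ennreal ((\<Sum>i\<in>J. g D (Ob i s) - m D)\<^sup>2)) \<in> borel_measurable S" by measurable
    qed
    also have "\<dots> \<le> ennreal (1 / r\<^sup>2) * ennreal (r * V)"
      unfolding m_def r_def using law J V(1)[OF D] V(2)
      by (intro mult_left_mono second_moment_iid_sum[OF S ind_J, where R=R]) auto
    also have "\<dots> = ennreal (V / r)"
      using r V by (simp add: ennreal_mult[symmetric] power2_eq_square)
    finally show "(\<integral>\<^sup>+e. H (D, e) \<partial>distr S ?J ev) \<le> ennreal (V / r)" .
  qed
  also have "\<dots> = ennreal (V / r)" using tr.emeasure_space_1 by simp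
  finally show ?thesis unfolding r_def m_def .
qed

section \<open>Kernel smoothing\<close>

lemma integral_lborel_prod:
  fixes g :: "real \<Rightarrow> real"
  assumes g: "integrable lborel g"
  shows "integrable lborel (\<lambda>u::real^'d::finite. \<Prod>j\<in>UNIV. g (u $ j))"
    and "(\<integral>u. (\<Prod>j\<in>UNIV. g ((u::real^'d) $ j)) \<partial>lborel) = (\<integral>u. g u \<partial>lborel) ^ CARD('d)"
proof -
  interpret product_sigma_finite "\<lambda>b::real^'d. lborel :: real measure" ..
  have g'[measurable]: "g \<in> borel_measurable borel"
    using borel_measurable_integrable[OF g] by simp
  have Basis: "(Basis :: (real^'d) set) = (\<lambda>j. axis j 1) ` UNIV"
    by (auto simp: Basis_vec_def)
  have inj: "inj (\<lambda>j::'d. axis j (1::real))"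
    by (auto simp: inj_on_def axis_eq_axis)
  have prod: "(\<Prod>j\<in>UNIV. g (u $ j)) = (\<Prod>b\<in>Basis. g (u \<bullet> b))" for u :: "real^'d"
    by (simp add: Basis prod.reindex[OF inj] cart_eq_inner_axis)
  have card: "card (Basis :: (real^'d) set) = CARD('d)"
    by (simp add: Basis card_image[OF inj])
  have coord: "(\<Prod>b\<in>Basis. g ((\<Sum>b\<in>Basis. f b *\<^sub>R b) \<bullet> b)) = (\<Prod>b\<in>Basis. g (f b))" for f :: "real^'d \<Rightarrow> real"
    by (intro prod.cong refl) simp
  have P: "integrable (Pi\<^sub>M Basis (\<lambda>b::real^'d. lborel)) (\<lambda>f. \<Prod>b\<in>Basis. g (f b))"
    "(\<integral>f. (\<Prod>b\<in>Basis. g (f b)) \<partial>Pi\<^sub>M Basis (\<lambda>b::real^'d. lborel)) = (\<integral>u. g u \<partial>lborel) ^ CARD('d)"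
    using product_integrable_prod[of Basis "\<lambda>_. g"] product_integral_prod[of Basis "\<lambda>_. g"] g
    by (auto simp: card)
  show "integrable lborel (\<lambda>u::real^'d. \<Prod>j\<in>UNIV. g (u $ j))"
    unfolding prod by (subst lborel_eq, subst integrable_distr_eq) (use P in \<open>auto simp: coord\<close>)
  show "(\<integral>u. (\<Prod>j\<in>UNIV. g ((u::real^'d) $ j)) \<partial>lborel) = (\<integral>u. g u \<partial>lborel) ^ CARD('d)"
    unfolding prod by (subst lborel_eq, subst integral_distr) (use P in \<open>auto simp: coord\<close>)
qed

lemma measurable_prod_kernel[measurable (raw)]:
  assumes [measurable]: "k \<in> borel_measurable borel" "f \<in> borel_measurable N"
  shows "(\<lambda>x. prod_kernel k h (f x :: real^'d::finite)) \<in> borel_measurable N"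
proof -
  have "(\<lambda>x. f x $ j) \<in> borel_measurable N" for j
    by (rule measurable_compose[OF assms(2)]) simp
  then show ?thesis unfolding prod_kernel_def by measurable
qed

lemma prod_kernel_change_of_variables:
  fixes k :: "real \<Rightarrow> real" and f :: "real^'d::finite \<Rightarrow> real"
  assumes k[measurable]: "k \<in> borel_measurable borel" and f[measurable]: "f \<in> borel_measurable borel" and h: "0 < h"
  shows "integrable lborel (\<lambda>t. prod_kernel k h (t - a) * f t)
      \<longleftrightarrow> integrable lborel (\<lambda>u. (\<Prod>j\<in>UNIV. k (u $ j)) * f (a + h *\<^sub>R u))"
    and "(\<integral>t. prod_kernel k h (t - a) * f t \<partial>lborel)
      = (\<integral>u. (\<Prod>j\<in>UNIV. k (u $ j)) * f (a + h *\<^sub>R u) \<partial>lborel)"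
proof -
  have aff: "(lborel :: (real^'d) measure) = density (distr lborel borel (\<lambda>x. a + h *\<^sub>R x)) (\<lambda>_. ennreal (h ^ CARD('d)))"
    using lborel_affine[of h a] h by simp
  have eq: "h ^ CARD('d) * (prod_kernel k h ((a + h *\<^sub>R u) - a) * f (a + h *\<^sub>R u))
      = (\<Prod>j\<in>UNIV. k (u $ j)) * f (a + h *\<^sub>R u)" for u :: "real^'d"
    using h by (simp add: prod_kernel_def)
  show "integrable lborel (\<lambda>t. prod_kernel k h (t - a) * f t)
      \<longleftrightarrow> integrable lborel (\<lambda>u. (\<Prod>j\<in>UNIV. k (u $ j)) * f (a + h *\<^sub>R u))"
    unfolding eq[symmetric] using h
    by (subst aff, subst integrable_real_density) (auto simp: integrable_distr_eq)
  show "(\<integral>t. prod_kernel k h (t - a) * f t \<partial>lborel)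
      = (\<integral>u. (\<Prod>j\<in>UNIV. k (u $ j)) * f (a + h *\<^sub>R u) \<partial>lborel)"
    unfolding eq[symmetric] using h
    by (subst aff, subst integral_real_density) (auto simp: integral_distr)
qed

lemma integrable_prod_kernel:
  fixes k :: "real \<Rightarrow> real" and a :: "real^'d::finite"
  assumes "integrable lborel k" "0 < h"
  shows "integrable lborel (\<lambda>t. prod_kernel k h (t - a))"
    and "(\<integral>t. prod_kernel k h (t - a) \<partial>lborel) = (\<integral>u. k u \<partial>lborel) ^ CARD('d)"
  using prod_kernel_change_of_variables[of k "\<lambda>_. 1" h a] integral_lborel_prod[OF assms(1), where 'd='d]
    borel_measurable_integrable[OF assms(1)] assms(2) by auto

lemma prod_kernel_abs: "0 < h \<Longrightarrow> \<bar>prod_kernel k h u\<bar> = prod_kernel (\<lambda>v. \<bar>k v\<bar>) h u"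
  by (simp add: prod_kernel_def abs_prod)

lemma prod_kernel_square:
  fixes u :: "real^'d::finite"
  shows "0 < h \<Longrightarrow> (prod_kernel k h u)\<^sup>2 = prod_kernel (\<lambda>v. (k v)\<^sup>2) h u / h ^ CARD('d)"
  by (simp add: prod_kernel_def prod_power_distrib power_divide power2_eq_square[of "h ^ CARD('d)"])

lemma integrable_prod_kernel_mult:
  fixes k :: "real \<Rightarrow> real" and a :: "real^'d::finite"
  assumes k: "integrable lborel k" and h: "0 < h"
    and f: "f \<in> borel_measurable borel" and f_le: "\<And>t. \<bar>f t\<bar> \<le> C"
  shows "integrable lborel (\<lambda>t. prod_kernel k h (t - a) * f t)"
    and "\<bar>\<integral>t. prod_kernel k h (t - a) * f t \<partial>lborel\<bar> \<le> (\<integral>u. \<bar>k u\<bar> \<partial>lborel) ^ CARD('d) * C"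
proof -
  have [measurable]: "k \<in> borel_measurable borel" using borel_measurable_integrable[OF k] by simp
  note f[measurable]
  have i: "integrable lborel (\<lambda>t. \<bar>prod_kernel k h (t - a)\<bar> * C)"
    using k h by (simp add: prod_kernel_abs integrable_prod_kernel)
  show I: "integrable lborel (\<lambda>t. prod_kernel k h (t - a) * f t)"
    by (rule Bochner_Integration.integrable_bound[OF i])
      (auto simp: abs_mult intro!: mult_left_mono always_eventually order_trans[OF f_le])
  have "\<bar>\<integral>t. prod_kernel k h (t - a) * f t \<partial>lborel\<bar> \<le> (\<integral>t. \<bar>prod_kernel k h (t - a) * f t\<bar> \<partial>lborel)"
    by (rule integral_abs_bound)
  also have "\<dots> \<le> (\<integral>t. \<bar>prod_kernel k h (t - a)\<bar> * C \<partial>lborel)"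
    using integrable_abs[OF I] i f_le by (intro integral_mono) (auto simp only: abs_mult intro!: mult_left_mono)
  also have "\<dots> = (\<integral>u. \<bar>k u\<bar> \<partial>lborel) ^ CARD('d) * C"
    using integrable_prod_kernel(2)[of "\<lambda>v. \<bar>k v\<bar>" h a] k h by (simp add: prod_kernel_abs)
  finally show "\<bar>\<integral>t. prod_kernel k h (t - a) * f t \<partial>lborel\<bar> \<le> (\<integral>u. \<bar>k u\<bar> \<partial>lborel) ^ CARD('d) * C" .
qed

lemma prod_kernel_approximate_identity:
  fixes k :: "real \<Rightarrow> real" and a :: "real^'d::finite"
  assumes k: "integrable lborel k" "(\<integral>u. k u \<partial>lborel) = 1"
    and h: "\<And>n. 0 < h n" "h \<longlonglongrightarrow> 0"
    and f: "f \<in> borel_measurable borel" and f_le: "\<And>t. \<bar>f t\<bar> \<le> C" and cont: "isCont f a"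
  shows "(\<lambda>n. \<integral>t. prod_kernel k (h n) (t - a) * f t \<partial>lborel) \<longlonglongrightarrow> f a"
proof -
  have [measurable]: "k \<in> borel_measurable borel" using borel_measurable_integrable[OF k(1)] by simp
  note f[measurable]
  have [measurable]: "(\<lambda>u. \<Prod>j\<in>UNIV. k (u $ j)) \<in> borel_measurable (borel :: (real^'d) measure)"
    using borel_measurable_integrable[OF integral_lborel_prod(1)[OF k(1)]] by simp
  have "(\<lambda>n. \<integral>u. (\<Prod>j\<in>UNIV. k (u $ j)) * f (a + h n *\<^sub>R u) \<partial>lborel)
      \<longlonglongrightarrow> (\<integral>u. (\<Prod>j\<in>UNIV. k ((u::real^'d) $ j)) * f a \<partial>lborel)"
  proof (rule integral_dominated_convergence)
    show "integrable lborel (\<lambda>u::real^'d. \<bar>\<Prod>j\<in>UNIV. k (u $ j)\<bar> * C)"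
      by (intro integrable_mult_left integrable_abs integral_lborel_prod k)
    have "(\<lambda>n. f (a + h n *\<^sub>R u)) \<longlonglongrightarrow> f a" for u
    proof (rule isCont_tendsto_compose[OF cont])
      show "(\<lambda>n. a + h n *\<^sub>R u) \<longlonglongrightarrow> a"
        using tendsto_add[OF tendsto_const tendsto_scaleR[OF h(2) tendsto_const]] by fastforce
    qed
    then show "AE u in lborel. (\<lambda>n. (\<Prod>j\<in>UNIV. k (u $ j)) * f (a + h n *\<^sub>R u)) \<longlonglongrightarrow> (\<Prod>j\<in>UNIV. k (u $ j)) * f a"
      by (intro always_eventually allI tendsto_mult tendsto_const)
    show "AE u in lborel. norm ((\<Prod>j\<in>UNIV. k (u $ j)) * f (a + h n *\<^sub>R u)) \<le> \<bar>\<Prod>j\<in>UNIV. k (u $ j)\<bar> * C" for n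
      by (auto simp: abs_mult f_le intro!: mult_left_mono)
  qed measurable
  also have "(\<integral>u. (\<Prod>j\<in>UNIV. k ((u::real^'d) $ j)) * f a \<partial>lborel) = f a"
    using integral_lborel_prod(2)[OF k(1), where 'd='d] k(2) by simp
  finally show ?thesis
    using prod_kernel_change_of_variables(2)[of k f "h n" a for n] h(1) by simp
qed

section \<open>Regular conditional probabilities\<close>

lemma regular_cond_probD:
  assumes "regular_cond_prob P N W \<kappa>"
  shows "W \<in> measurable P N" "\<kappa> \<in> measurable N (subprob_algebra P)"
    "\<And>w. w \<in> space N \<Longrightarrow> prob_space (\<kappa> w)" "\<And>w. w \<in> space N \<Longrightarrow> sets (\<kappa> w) = sets P"
    "\<And>w. w \<in> space N \<Longrightarrow> AE \<omega> in \<kappa> w. W \<omega> = w"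
proof -
  have W: "W \<in> measurable P N" and \<kappa>: "\<kappa> \<in> measurable N (prob_algebra P)"
    using assms by (auto simp: regular_cond_prob_def)
  show "W \<in> measurable P N" "\<kappa> \<in> measurable N (subprob_algebra P)"
    using W \<kappa> by (auto intro: measurable_prob_algebraD)
  show "prob_space (\<kappa> w)" "sets (\<kappa> w) = sets P" if "w \<in> space N" for w
    using measurable_space[OF \<kappa> that] by (auto simp: space_prob_algebra)
  show "AE \<omega> in \<kappa> w. W \<omega> = w" if "w \<in> space N" for w
    using assms that by (auto simp: regular_cond_prob_def)
qed

lemma nn_integral_regular_cond_prob:
  assumes P: "prob_space P" and rcp: "regular_cond_prob P N W \<kappa>" and F: "F \<in> borel_measurable P"
  shows "(\<integral>\<^sup>+\<omega>. F \<omega> \<partial>P) = (\<integral>\<^sup>+w. (\<integral>\<^sup>+\<omega>. F \<omega> \<partial>\<kappa> w) \<partial>distr P N W)"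
proof -
  interpret prob_space P by (rule P)
  note [measurable] = regular_cond_probD(1,2)[OF rcp]
  interpret W: prob_space "distr P N W" by (rule prob_space_distr) simp
  have "distr P N W \<bind> \<kappa> = P"
  proof (rule measure_eqI)
    show sets: "sets (distr P N W \<bind> \<kappa>) = sets P"
      using W.not_empty by (intro sets_bind) (auto simp: regular_cond_probD(4)[OF rcp])
    fix B assume "B \<in> sets (distr P N W \<bind> \<kappa>)"
    then have B: "B \<in> sets P" using sets by simp
    then have "emeasure (distr P N W \<bind> \<kappa>) B = (\<integral>\<^sup>+w. emeasure (\<kappa> w) B \<partial>distr P N W)"
      using W.not_empty by (intro emeasure_bind[where N=P]) auto
    also have "\<dots> = (\<integral>\<^sup>+w\<in>space N. emeasure (\<kappa> w) B \<partial>distr P N W)"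
      by (intro nn_integral_cong) auto
    also have "\<dots> = emeasure P (B \<inter> (W -` space N \<inter> space P))"
      using rcp B sets.top[of N] unfolding regular_cond_prob_def by fastforce
    also have "B \<inter> (W -` space N \<inter> space P) = B"
      using sets.sets_into_space[OF B] measurable_space[OF regular_cond_probD(1)[OF rcp]] by auto
    finally show "emeasure (distr P N W \<bind> \<kappa>) B = emeasure P B" .
  qed
  then show ?thesis
    using nn_integral_bind[OF F, of \<kappa> "distr P N W"] by simp
qed

lemma integral_regular_cond_prob:
  fixes F :: "'w \<Rightarrow> real"
  assumes P: "prob_space P" and rcp: "regular_cond_prob P N W \<kappa>" and F: "integrable P F"
  shows "(\<integral>\<omega>. F \<omega> \<partial>P) = (\<integral>w. (\<integral>\<omega>. F \<omega> \<partial>\<kappa> w) \<partial>distr P N W)"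
proof -
  note [measurable] = regular_cond_probD(1,2)[OF rcp]
  have [measurable]: "F \<in> borel_measurable P" using F by auto
  let ?D = "distr P N W"
  define p where "p G w = (\<integral>\<^sup>+\<omega>. ennreal (G \<omega>) \<partial>\<kappa> w)" for G :: "'w \<Rightarrow> real" and w
  have p_meas[measurable]: "p G \<in> borel_measurable N" if [measurable]: "G \<in> borel_measurable P" for G
    unfolding p_def by measurable
  have fin: "(\<integral>\<^sup>+w. p G w \<partial>?D) < \<infinity>" "(\<integral>\<^sup>+w. p G w \<partial>?D) = (\<integral>\<^sup>+\<omega>. ennreal (G \<omega>) \<partial>P)"
    if "integrable P G" for G
    using nn_integral_regular_cond_prob[OF P rcp, of "\<lambda>\<omega>. ennreal (G \<omega>)"] that
      real_integrable_def[of P G] unfolding p_def by (auto simp: less_top)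
  have E: "integrable ?D (\<lambda>w. enn2real (p G w))"
    "(\<integral>w. enn2real (p G w) \<partial>?D) = enn2real (\<integral>\<^sup>+\<omega>. ennreal (G \<omega>) \<partial>P)" "AE w in ?D. p G w < \<infinity>"
    if G: "integrable P G" for G
  proof -
    have [measurable]: "G \<in> borel_measurable P" using G by auto
    show AE: "AE w in ?D. p G w < \<infinity>"
      using nn_integral_noteq_infinite[of "p G" ?D] fin[OF G] by (auto simp: less_top)
    have eq: "(\<integral>\<^sup>+w. ennreal (enn2real (p G w)) \<partial>?D) = (\<integral>\<^sup>+w. p G w \<partial>?D)"
      using AE by (intro nn_integral_cong_AE) auto
    show "integrable ?D (\<lambda>w. enn2real (p G w))"
      using eq fin[OF G] by (intro integrableI_nonneg) auto
    show "(\<integral>w. enn2real (p G w) \<partial>?D) = enn2real (\<integral>\<^sup>+\<omega>. ennreal (G \<omega>) \<partial>P)"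
      using eq fin[OF G] by (subst integral_eq_nn_integral) auto
  qed
  have F': "integrable P (\<lambda>\<omega>. - F \<omega>)" using F by simp
  have "(\<integral>\<omega>. F \<omega> \<partial>P) = (\<integral>w. enn2real (p F w) \<partial>?D) - (\<integral>w. enn2real (p (\<lambda>\<omega>. - F \<omega>) w) \<partial>?D)"
    using E(2)[OF F] E(2)[OF F'] F by (simp add: real_lebesgue_integral_def)
  also have "\<dots> = (\<integral>w. enn2real (p F w) - enn2real (p (\<lambda>\<omega>. - F \<omega>) w) \<partial>?D)"
    using E(1)[OF F] E(1)[OF F'] by simp
  also have "\<dots> = (\<integral>w. (\<integral>\<omega>. F \<omega> \<partial>\<kappa> w) \<partial>?D)"
  proof (rule integral_cong_AE)
    show "AE w in ?D. enn2real (p F w) - enn2real (p (\<lambda>\<omega>. - F \<omega>) w) = (\<integral>\<omega>. F \<omega> \<partial>\<kappa> w)"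
      using E(3)[OF F] E(3)[OF F'] AE_space
    proof eventually_elim
      case (elim w)
      then have w: "w \<in> space N" by simp
      have [measurable]: "F \<in> borel_measurable (\<kappa> w)"
        by (subst measurable_cong_sets[OF regular_cond_probD(4)[OF rcp w] refl]) measurable
      have "integrable (\<kappa> w) F"
        using elim by (simp add: real_integrable_def p_def less_top)
      then show ?case by (simp add: real_lebesgue_integral_def p_def)
    qed
  qed measurable
  finally show ?thesis .
qed

lemma integral_regular_cond_prob_mult:
  fixes F :: "'w \<Rightarrow> real"
  assumes P: "prob_space P" and rcp: "regular_cond_prob P N W \<kappa>"
    and F: "F \<in> borel_measurable P" and G: "G \<in> borel_measurable N"
    and int: "integrable P (\<lambda>\<omega>. G (W \<omega>) * F \<omega>)"
  shows "(\<integral>\<omega>. G (W \<omega>) * F \<omega> \<partial>P) = (\<integral>\<omega>. G (W \<omega>) * (\<integral>\<omega>'. F \<omega>' \<partial>\<kappa> (W \<omega>)) \<partial>P)"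
proof -
  note [measurable] = regular_cond_probD(1,2)[OF rcp] F G
  have "(\<integral>\<omega>. G (W \<omega>) * F \<omega> \<partial>P) = (\<integral>w. (\<integral>\<omega>. G (W \<omega>) * F \<omega> \<partial>\<kappa> w) \<partial>distr P N W)"
    by (rule integral_regular_cond_prob[OF P rcp int])
  also have "\<dots> = (\<integral>w. G w * (\<integral>\<omega>. F \<omega> \<partial>\<kappa> w) \<partial>distr P N W)"
  proof (intro Bochner_Integration.integral_cong refl)
    fix w assume "w \<in> space (distr P N W)"
    then have w: "w \<in> space N" by simp
    note sets = measurable_cong_sets[OF regular_cond_probD(4)[OF rcp w] refl]
    have "(\<integral>\<omega>. G (W \<omega>) * F \<omega> \<partial>\<kappa> w) = (\<integral>\<omega>. G w * F \<omega> \<partial>\<kappa> w)"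
      using regular_cond_probD(5)[OF rcp w] by (intro integral_cong_AE) (auto simp: sets)
    then show "(\<integral>\<omega>. G (W \<omega>) * F \<omega> \<partial>\<kappa> w) = G w * (\<integral>\<omega>. F \<omega> \<partial>\<kappa> w)"
      by simp
  qed
  also have "\<dots> = (\<integral>\<omega>. G (W \<omega>) * (\<integral>\<omega>'. F \<omega>' \<partial>\<kappa> (W \<omega>)) \<partial>P)"
    by (subst integral_distr) auto
  finally show ?thesis .
qed

lemma nn_integral_regular_cond_prob_mult:
  assumes P: "prob_space P" and rcp: "regular_cond_prob P N W \<kappa>"
    and F: "F \<in> borel_measurable P" and G: "G \<in> borel_measurable N"
  shows "(\<integral>\<^sup>+\<omega>. G (W \<omega>) * F \<omega> \<partial>P) = (\<integral>\<^sup>+\<omega>. G (W \<omega>) * (\<integral>\<^sup>+\<omega>'. F \<omega>' \<partial>\<kappa> (W \<omega>)) \<partial>P)"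
proof -
  note [measurable] = regular_cond_probD(1,2)[OF rcp] F G
  have "(\<integral>\<^sup>+\<omega>. G (W \<omega>) * F \<omega> \<partial>P) = (\<integral>\<^sup>+w. (\<integral>\<^sup>+\<omega>. G (W \<omega>) * F \<omega> \<partial>\<kappa> w) \<partial>distr P N W)"
    by (rule nn_integral_regular_cond_prob[OF P rcp]) measurable
  also have "\<dots> = (\<integral>\<^sup>+w. G w * (\<integral>\<^sup>+\<omega>. F \<omega> \<partial>\<kappa> w) \<partial>distr P N W)"
  proof (intro nn_integral_cong)
    fix w assume "w \<in> space (distr P N W)"
    then have w: "w \<in> space N" by simp
    note sets = measurable_cong_sets[OF regular_cond_probD(4)[OF rcp w] refl]
    have "(\<integral>\<^sup>+\<omega>. G (W \<omega>) * F \<omega> \<partial>\<kappa> w) = (\<integral>\<^sup>+\<omega>. G w * F \<omega> \<partial>\<kappa> w)"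
      using regular_cond_probD(5)[OF rcp w] by (intro nn_integral_cong_AE) auto
    then show "(\<integral>\<^sup>+\<omega>. G (W \<omega>) * F \<omega> \<partial>\<kappa> w) = G w * (\<integral>\<^sup>+\<omega>. F \<omega> \<partial>\<kappa> w)"
      by (simp add: nn_integral_cmult sets)
  qed
  also have "\<dots> = (\<integral>\<^sup>+\<omega>. G (W \<omega>) * (\<integral>\<^sup>+\<omega>'. F \<omega>' \<partial>\<kappa> (W \<omega>)) \<partial>P)"
    by (subst nn_integral_distr) auto
  finally show ?thesis .
qed

section \<open>The mediation model\<close>

locale mediation_model = prob_space P for P :: "'w measure" +
  fixes \<A> :: "(real^'d::finite) set" and \<nu>M :: "'m measure" and \<nu>X :: "'x measure" and \<Y> :: "real set"
    and A :: "'w \<Rightarrow> real^'d" and M :: "'w \<Rightarrow> 'm" and X :: "'w \<Rightarrow> 'x" and Y :: "'w \<Rightarrow> real"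
    and Ypot :: "real^'d \<Rightarrow> 'm \<Rightarrow> 'w \<Rightarrow> real" and Mpot :: "real^'d \<Rightarrow> 'w \<Rightarrow> 'm"
    and \<kappa>X :: "'x \<Rightarrow> 'w measure" and \<kappa>AX :: "(real^'d) \<times> 'x \<Rightarrow> 'w measure"
    and \<kappa>AMX :: "((real^'d) \<times> 'm) \<times> 'x \<Rightarrow> 'w measure"
    and \<kappa>pot :: "real^'d \<Rightarrow> 'm \<times> 'x \<Rightarrow> 'w measure"
    and fAMX :: "real^'d \<Rightarrow> 'm \<Rightarrow> 'x \<Rightarrow> real" and fX :: "'x \<Rightarrow> real"
    and fMX :: "'m \<Rightarrow> 'x \<Rightarrow> real" and fAX :: "real^'d \<Rightarrow> 'x \<Rightarrow> real"
    and \<alpha> :: "real^'d \<Rightarrow> 'm \<Rightarrow> 'x \<Rightarrow> real" and lambda :: "real^'d \<Rightarrow> 'x \<Rightarrow> real"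
    and \<gamma> :: "'x \<Rightarrow> 'm \<Rightarrow> real^'d \<Rightarrow> real"
    and a a' :: "real^'d" and C :: real
  assumes spaces: "\<A> \<in> sets borel" "\<Y> \<in> sets borel" "sigma_finite_measure \<nu>M" "sigma_finite_measure \<nu>X"
    and observed: "A \<in> measurable P (leb_on \<A>)" "M \<in> measurable P \<nu>M" "X \<in> measurable P \<nu>X"
      "Y \<in> measurable P (restrict_space borel \<Y>)"
    and potential:
      "\<And>t. t \<in> \<A> \<Longrightarrow> Mpot t \<in> measurable P \<nu>M"
      "\<And>t m. t \<in> \<A> \<Longrightarrow> m \<in> space \<nu>M \<Longrightarrow> Ypot t m \<in> measurable P (restrict_space borel \<Y>)"
      "\<And>t t'. t \<in> \<A> \<Longrightarrow> t' \<in> \<A> \<Longrightarrow>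
         (\<lambda>\<omega>. Ypot t (Mpot t' \<omega>) \<omega>) \<in> measurable P (restrict_space borel \<Y>)"
    and target: "a \<in> interior \<A>" "a' \<in> interior \<A>"
    and kernels: "regular_cond_prob P \<nu>X X \<kappa>X"
      "regular_cond_prob P (leb_on \<A> \<Otimes>\<^sub>M \<nu>X) (\<lambda>\<omega>. (A \<omega>, X \<omega>)) \<kappa>AX"
      "regular_cond_prob P ((leb_on \<A> \<Otimes>\<^sub>M \<nu>M) \<Otimes>\<^sub>M \<nu>X) (\<lambda>\<omega>. ((A \<omega>, M \<omega>), X \<omega>)) \<kappa>AMX"
      "\<And>t. t \<in> \<A> \<Longrightarrow> regular_cond_prob P (\<nu>M \<Otimes>\<^sub>M \<nu>X) (\<lambda>\<omega>. (Mpot t \<omega>, X \<omega>)) (\<kappa>pot t)"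
    and joint_density: "\<And>t m x. t \<in> \<A> \<Longrightarrow> m \<in> space \<nu>M \<Longrightarrow> x \<in> space \<nu>X \<Longrightarrow> 0 \<le> fAMX t m x"
      "distributed P (leb_on \<A> \<Otimes>\<^sub>M (\<nu>M \<Otimes>\<^sub>M \<nu>X)) (\<lambda>\<omega>. (A \<omega>, M \<omega>, X \<omega>))
         (\<lambda>(t, m, x). ennreal (fAMX t m x))"
    and marginals: "\<And>x. fX x = (\<integral>(t, m). fAMX t m x \<partial>(leb_on \<A> \<Otimes>\<^sub>M \<nu>M))"
      "\<And>m x. fMX m x = (\<integral>t. fAMX t m x \<partial>leb_on \<A>)"
      "\<And>t x. fAX t x = (\<integral>m. fAMX t m x \<partial>\<nu>M)"
    and nuisance: "\<And>t x. lambda t x = 1 / (fAX t x / fX x)"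
      "\<And>t m x. \<alpha> t m x = fAMX t m x / fAX t x"
      "\<And>x m t. \<gamma> x m t = (\<integral>\<omega>. Y \<omega> \<partial>\<kappa>AMX ((t, m), x))"
    and mediator_law: "\<And>t x. t \<in> \<A> \<Longrightarrow> x \<in> space \<nu>X \<Longrightarrow>
         distributed (\<kappa>AX (t, x)) \<nu>M M (\<lambda>m. ennreal (\<alpha> t m x))"
    and consistency:
      "\<And>t m \<omega>. t \<in> \<A> \<Longrightarrow> m \<in> space \<nu>M \<Longrightarrow> \<omega> \<in> space P \<Longrightarrow> A \<omega> = t \<Longrightarrow> M \<omega> = m \<Longrightarrow> Ypot t m \<omega> = Y \<omega>"
      "\<And>t \<omega>. t \<in> \<A> \<Longrightarrow> \<omega> \<in> space P \<Longrightarrow> A \<omega> = t \<Longrightarrow> Mpot t \<omega> = M \<omega>"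
    and exchangeability:
      "\<And>t m. t \<in> \<A> \<Longrightarrow> m \<in> space \<nu>M \<Longrightarrow>
         cond_indep_values (restrict_space borel \<Y>) (Ypot t m) (leb_on \<A> \<Otimes>\<^sub>M \<nu>M) \<kappa>AMX \<nu>X \<kappa>X"
      "\<And>t. t \<in> \<A> \<Longrightarrow> cond_indep_values \<nu>M (Mpot t) (leb_on \<A>) \<kappa>AX \<nu>X \<kappa>X"
      "\<And>t t' m. t \<in> \<A> \<Longrightarrow> t' \<in> \<A> \<Longrightarrow> m \<in> space \<nu>M \<Longrightarrow>
         cond_indep_values (restrict_space borel \<Y>) (Ypot t m) \<nu>M (\<kappa>pot t') \<nu>X \<kappa>X"
    and positivity: "\<And>t m x. t \<in> \<A> \<Longrightarrow> m \<in> space \<nu>M \<Longrightarrow> x \<in> space \<nu>X \<Longrightarrow>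
         0 < \<alpha> t m x \<and> 0 < fAX t x / fX x"
    and continuous:
      "\<And>m x. m \<in> space \<nu>M \<Longrightarrow> x \<in> space \<nu>X \<Longrightarrow> continuous_on (interior \<A>) (\<lambda>t. fAMX t m x / fMX m x)"
      "\<And>m x. m \<in> space \<nu>M \<Longrightarrow> x \<in> space \<nu>X \<Longrightarrow> continuous_on (interior \<A>) (\<lambda>t. \<gamma> x m t)"
    and bounds: "1 \<le> C" "\<And>t m x. t \<in> \<A> \<Longrightarrow> m \<in> space \<nu>M \<Longrightarrow> x \<in> space \<nu>X \<Longrightarrow>
         \<bar>\<alpha> t m x\<bar> \<le> C \<and> \<bar>lambda t x\<bar> \<le> C \<and> \<bar>\<gamma> x m t\<bar> \<le> C \<and> 1 / C \<le> \<bar>\<alpha> t m x\<bar> \<and> 1 / C \<le> \<bar>lambda t x\<bar>"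
    and third_moment: "\<And>t m x. t \<in> \<A> \<Longrightarrow> m \<in> space \<nu>M \<Longrightarrow> x \<in> space \<nu>X \<Longrightarrow>
         (\<integral>\<^sup>+\<omega>. ennreal (\<bar>Y \<omega> - \<gamma> x m t\<bar> ^ 3) \<partial>\<kappa>AMX ((t, m), x)) \<le> ennreal C"
begin

sublocale M: sigma_finite_measure \<nu>M by (rule spaces)
sublocale X: sigma_finite_measure \<nu>X by (rule spaces)
sublocale T: sigma_finite_measure "leb_on \<A>"
  by (rule sigma_finite_measure_restrict_space) (use spaces in \<open>auto intro: sigma_finite_lborel\<close>)
sublocale MX: pair_sigma_finite \<nu>M \<nu>X ..
sublocale TM: pair_sigma_finite "leb_on \<A>" \<nu>M ..
sublocale TMX: pair_sigma_finite "leb_on \<A>" "\<nu>M \<Otimes>\<^sub>M \<nu>X" ..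

abbreviation "T \<equiv> leb_on \<A>"
abbreviation "Z \<equiv> \<nu>M \<Otimes>\<^sub>M \<nu>X"

lemma space_leb_on[simp]: "space T = \<A>"
  by (simp add: space_restrict_space)

lemma target_in[simp]: "a \<in> \<A>" "a' \<in> \<A>"
  using target interior_subset by auto

lemma observed_measurable[measurable]:
  "A \<in> measurable P T" "M \<in> measurable P \<nu>M" "X \<in> measurable P \<nu>X" "Y \<in> borel_measurable P"
  using observed by (auto intro: measurable_restrict_space3 simp: measurable_restrict_space2_iff)

lemma observed_in[simp]: "\<omega> \<in> space P \<Longrightarrow> A \<omega> \<in> \<A>" "\<omega> \<in> space P \<Longrightarrow> M \<omega> \<in> space \<nu>M"
  "\<omega> \<in> space P \<Longrightarrow> X \<omega> \<in> space \<nu>X"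
  using observed_measurable(1-3)[THEN measurable_space] by auto

lemma measurable_fAMX[measurable (raw)]:
  assumes [measurable]: "f \<in> measurable N T" "g \<in> measurable N \<nu>M" "k \<in> measurable N \<nu>X"
  shows "(\<lambda>y. fAMX (f y) (g y) (k y)) \<in> borel_measurable N"
proof -
  have [measurable]: "(\<lambda>(t, m, x). ennreal (fAMX t m x)) \<in> borel_measurable (T \<Otimes>\<^sub>M Z)"
    using joint_density(2) by (simp add: distributed_def)
  have "(\<lambda>y. enn2real ((\<lambda>(t, m, x). ennreal (fAMX t m x)) (f y, g y, k y))) \<in> borel_measurable N"
    by measurable
  then show ?thesis
    using assms[THEN measurable_space]
    by (subst measurable_cong[where g="\<lambda>y. enn2real ((\<lambda>(t, m, x). ennreal (fAMX t m x)) (f y, g y, k y))"])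
      (auto simp: joint_density(1))
qed

lemma measurable_fX[measurable]: "fX \<in> borel_measurable \<nu>X"
  unfolding marginals(1)[abs_def] split_beta
  by (rule sigma_finite_measure.borel_measurable_lebesgue_integral) (unfold_locales, measurable)

lemma measurable_fMX[measurable (raw)]:
  assumes [measurable]: "g \<in> measurable N \<nu>M" "k \<in> measurable N \<nu>X"
  shows "(\<lambda>y. fMX (g y) (k y)) \<in> borel_measurable N"
  unfolding marginals(2) by measurable

lemma measurable_fAX[measurable (raw)]:
  assumes [measurable]: "f \<in> measurable N T" "k \<in> measurable N \<nu>X"
  shows "(\<lambda>y. fAX (f y) (k y)) \<in> borel_measurable N"
  unfolding marginals(3) by measurable

lemma measurable_lambda[measurable (raw)]:
  assumes [measurable]: "f \<in> measurable N T" "k \<in> measurable N \<nu>X"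
  shows "(\<lambda>y. lambda (f y) (k y)) \<in> borel_measurable N"
  unfolding nuisance by measurable

lemma measurable_nuisance[measurable (raw)]:
  assumes [measurable]: "f \<in> measurable N T" "g \<in> measurable N \<nu>M" "k \<in> measurable N \<nu>X"
  shows "(\<lambda>y. \<alpha> (f y) (g y) (k y)) \<in> borel_measurable N" (is ?A)
    "(\<lambda>y. \<gamma> (k y) (g y) (f y)) \<in> borel_measurable N" (is ?G)
proof -
  note regular_cond_probD(2)[OF kernels(3), measurable]
  show ?A ?G
    unfolding nuisance by measurable
qed

lemma nuisance_pos:
  assumes "t \<in> \<A>" "m \<in> space \<nu>M" "x \<in> space \<nu>X"
  shows "0 < \<alpha> t m x" "0 < lambda t x" "\<alpha> t m x \<le> C" "1 / C \<le> \<alpha> t m x" "lambda t x \<le> C" "1 / C \<le> lambda t x"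
proof -
  show "0 < \<alpha> t m x" using positivity[OF assms] by simp
  show "0 < lambda t x" using positivity[OF assms] by (auto simp: nuisance(1) zero_less_divide_iff)
  then show "\<alpha> t m x \<le> C" "1 / C \<le> \<alpha> t m x" "lambda t x \<le> C" "1 / C \<le> lambda t x"
    using bounds(2)[OF assms] \<open>0 < \<alpha> t m x\<close> by auto
qed

lemma ex_mediator: "\<exists>m. m \<in> space \<nu>M"
  using observed_in(2) not_empty by blast

lemma fX_pos: "x \<in> space \<nu>X \<Longrightarrow> 0 < fX x"
proof -
  assume x: "x \<in> space \<nu>X"
  obtain m where m: "m \<in> space \<nu>M" using ex_mediator ..
  have "0 \<le> fAX a x"
    unfolding marginals(3) using x by (intro integral_nonneg_AE AE_I2 joint_density) auto
  moreover have "0 < fAX a x / fX x" using positivity[OF _ m x, of a] by simp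
  ultimately show "0 < fX x" by (auto simp: zero_less_divide_iff)
qed

definition "dens t m x = \<alpha> t m x / lambda t x"

lemma measurable_dens[measurable (raw)]:
  assumes [measurable]: "f \<in> measurable N T" "g \<in> measurable N \<nu>M" "k \<in> measurable N \<nu>X"
  shows "(\<lambda>y. dens (f y) (g y) (k y)) \<in> borel_measurable N"
  unfolding dens_def by measurable

lemma dens_eq:
  assumes "t \<in> \<A>" "m \<in> space \<nu>M" "x \<in> space \<nu>X"
  shows "fAMX t m x = dens t m x * fX x" "dens t m x = fAMX t m x / fX x"
proof -
  have "0 < fAX t x / fX x" using positivity[OF assms] by simp
  then have "fAX t x \<noteq> 0" "fX x \<noteq> 0" by auto
  then show "fAMX t m x = dens t m x * fX x" "dens t m x = fAMX t m x / fX x"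
    by (auto simp: dens_def nuisance)
qed

lemma dens_bounds:
  assumes "t \<in> \<A>" "m \<in> space \<nu>M" "x \<in> space \<nu>X"
  shows "0 < dens t m x" "dens t m x \<le> C\<^sup>2" "1 / C\<^sup>2 \<le> dens t m x"
proof -
  note b = nuisance_pos[OF assms] and C = bounds(1)
  show "0 < dens t m x" using b by (simp add: dens_def)
  have "\<alpha> t m x / lambda t x \<le> C / (1 / C)" using b C by (intro frac_le) auto
  then show "dens t m x \<le> C\<^sup>2" by (simp add: dens_def power2_eq_square)
  have "(1 / C) / C \<le> \<alpha> t m x / lambda t x" using b C by (intro frac_le) auto
  then show "1 / C\<^sup>2 \<le> dens t m x" by (simp add: dens_def power2_eq_square)
qed

lemma nn_integral_law_X:
  assumes [measurable]: "H \<in> borel_measurable \<nu>X"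
  shows "(\<integral>\<^sup>+\<omega>. H (X \<omega>) \<partial>P) = (\<integral>\<^sup>+x. ennreal (fX x) * H x \<partial>\<nu>X)"
proof -
  have "(\<integral>\<^sup>+\<omega>. H (X \<omega>) \<partial>P)
      = (\<integral>\<^sup>+z. (case z of (t, m, x) \<Rightarrow> ennreal (fAMX t m x)) * H (snd (snd z)) \<partial>(T \<Otimes>\<^sub>M Z))"
    by (subst distributed_nn_integral[OF joint_density(2)]) auto
  also have "\<dots> = (\<integral>\<^sup>+x. \<integral>\<^sup>+m. \<integral>\<^sup>+t. ennreal (fAMX t m x) * H x \<partial>T \<partial>\<nu>M \<partial>\<nu>X)"
    by (subst TMX.nn_integral_snd[symmetric], (measurable)[1], subst MX.nn_integral_snd[symmetric], (measurable)[1])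
      simp
  also have "\<dots> = (\<integral>\<^sup>+x. ennreal (fX x) * H x \<partial>\<nu>X)"
  proof (intro nn_integral_cong)
    fix x assume x[measurable]: "x \<in> space \<nu>X"
    let ?f = "\<lambda>(t, m). fAMX t m x"
    have "integrable (T \<Otimes>\<^sub>M \<nu>M) ?f"
      using fX_pos[OF x] not_integrable_integral_eq[of "T \<Otimes>\<^sub>M \<nu>M" ?f] by (force simp: marginals(1))
    then have "ennreal (fX x) = (\<integral>\<^sup>+z. ennreal (?f z) \<partial>(T \<Otimes>\<^sub>M \<nu>M))"
      unfolding marginals(1) using x
      by (intro nn_integral_eq_integral[symmetric] AE_I2) (auto simp: space_pair_measure joint_density)
    also have "\<dots> = (\<integral>\<^sup>+m. \<integral>\<^sup>+t. ennreal (fAMX t m x) \<partial>T \<partial>\<nu>M)"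
      by (subst TM.nn_integral_snd[symmetric]) auto
    finally have "ennreal (fX x) = (\<integral>\<^sup>+m. \<integral>\<^sup>+t. ennreal (fAMX t m x) \<partial>T \<partial>\<nu>M)" .
    moreover have "(\<lambda>m. \<integral>\<^sup>+t. ennreal (fAMX t m x) \<partial>T) \<in> borel_measurable \<nu>M" by measurable
    moreover have "(\<lambda>t. ennreal (fAMX t m x)) \<in> borel_measurable T" if "m \<in> space \<nu>M" for m
      using that by measurable
    ultimately show "(\<integral>\<^sup>+m. \<integral>\<^sup>+t. ennreal (fAMX t m x) * H x \<partial>T \<partial>\<nu>M) = ennreal (fX x) * H x"
      by (simp add: nn_integral_multc cong: nn_integral_cong)
  qed
  finally show ?thesis .
qed

lemma nn_integral_fX: "(\<integral>\<^sup>+x. ennreal (fX x) \<partial>\<nu>X) = 1"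
  using nn_integral_law_X[of "\<lambda>_. 1"] by (simp add: emeasure_space_1)

lemma distr_X: "distr P \<nu>X X = density \<nu>X (\<lambda>x. ennreal (fX x))"
proof (rule measure_eqI)
  fix B assume "B \<in> sets (distr P \<nu>X X)"
  then have [measurable]: "B \<in> sets \<nu>X" by simp
  have "emeasure (distr P \<nu>X X) B = (\<integral>\<^sup>+x. indicator B x \<partial>distr P \<nu>X X)"
    by simp
  also have "\<dots> = (\<integral>\<^sup>+\<omega>. indicator B (X \<omega>) \<partial>P)"
    by (rule nn_integral_distr) measurable
  finally show "emeasure (distr P \<nu>X X) B = emeasure (density \<nu>X (\<lambda>x. ennreal (fX x))) B"
    by (simp add: nn_integral_law_X emeasure_density)
qed simp

lemma nn_integral_\<alpha>:
  assumes "t \<in> \<A>" "x \<in> space \<nu>X"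
  shows "(\<integral>\<^sup>+m. ennreal (\<alpha> t m x) \<partial>\<nu>M) = 1"
proof -
  have sp: "(t, x) \<in> space (T \<Otimes>\<^sub>M \<nu>X)" using assms by (simp add: space_pair_measure)
  interpret \<kappa>: prob_space "\<kappa>AX (t, x)" by (rule regular_cond_probD(3)[OF kernels(2) sp])
  have "(\<integral>\<^sup>+m. ennreal (\<alpha> t m x) * 1 \<partial>\<nu>M) = (\<integral>\<^sup>+\<omega>. 1 \<partial>\<kappa>AX (t, x))"
    by (rule distributed_nn_integral[OF mediator_law[OF assms]]) simp
  then show ?thesis by (simp add: \<kappa>.emeasure_space_1)
qed

lemma ex_covariate: "\<exists>x. x \<in> space \<nu>X"
  using observed_in(3) not_empty by blast

lemma emeasure_mediator: "emeasure \<nu>M (space \<nu>M) \<le> ennreal C" "0 < emeasure \<nu>M (space \<nu>M)"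
proof -
  obtain x where x: "x \<in> space \<nu>X" using ex_covariate ..
  note a = nn_integral_\<alpha>[OF target_in(1) x]
  have C: "0 < C" using bounds(1) by simp
  have "ennreal (1 / C) * emeasure \<nu>M (space \<nu>M) = (\<integral>\<^sup>+m. ennreal (1 / C) \<partial>\<nu>M)" by simp
  also have "\<dots> \<le> (\<integral>\<^sup>+m. ennreal (\<alpha> a m x) \<partial>\<nu>M)"
    using x by (intro nn_integral_mono ennreal_leI nuisance_pos) auto
  finally have "ennreal C * (ennreal (1 / C) * emeasure \<nu>M (space \<nu>M)) \<le> ennreal C * 1"
    unfolding a by (rule mult_left_mono) simp
  then show "emeasure \<nu>M (space \<nu>M) \<le> ennreal C"
    using C by (simp add: mult.assoc[symmetric] ennreal_mult[symmetric])
  have "1 \<le> (\<integral>\<^sup>+m. ennreal C \<partial>\<nu>M)"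
    unfolding a[symmetric] using x by (intro nn_integral_mono ennreal_leI nuisance_pos) auto
  then show "0 < emeasure \<nu>M (space \<nu>M)"
    by (auto simp: zero_less_iff_neq_zero)
qed

sublocale M: finite_measure \<nu>M
  using emeasure_mediator(1) by (intro finite_measureI) (auto simp: top_unique)

text \<open>
  \<open>Q\<close> is \<open>f\<^sub>X(x) dm dx\<close>, so that \<open>dens t m x\<close> is the density of \<open>(A, M, X)\<close> relative to \<open>dt \<otimes> Q\<close>.
  Unlike the joint density, \<open>dens\<close> is bounded uniformly in \<open>m\<close> and \<open>x\<close>, and \<open>Q\<close> is finite because
  \<open>\<alpha>\<close> is bounded away from zero.
\<close>

definition "Q = density Z (\<lambda>z. ennreal (fX (snd z)))"

lemma sets_Q[measurable_cong, simp]: "sets Q = sets Z"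
  by (simp add: Q_def)

lemma space_Q[simp]: "space Q = space \<nu>M \<times> space \<nu>X"
  by (simp add: Q_def space_pair_measure)

lemma nn_integral_Q:
  assumes [measurable]: "f \<in> borel_measurable Z"
  shows "(\<integral>\<^sup>+z. f z \<partial>Q) = (\<integral>\<^sup>+x. ennreal (fX x) * (\<integral>\<^sup>+m. f (m, x) \<partial>\<nu>M) \<partial>\<nu>X)"
proof -
  have "(\<integral>\<^sup>+z. f z \<partial>Q) = (\<integral>\<^sup>+z. ennreal (fX (snd z)) * f z \<partial>Z)"
    unfolding Q_def by (subst nn_integral_density) auto
  also have "\<dots> = (\<integral>\<^sup>+x. \<integral>\<^sup>+m. ennreal (fX x) * f (m, x) \<partial>\<nu>M \<partial>\<nu>X)"
    by (subst MX.nn_integral_snd[symmetric]) auto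
  finally show ?thesis by (simp add: nn_integral_cmult cong: nn_integral_cong)
qed

lemma emeasure_Q: "emeasure Q (space Q) = emeasure \<nu>M (space \<nu>M)"
proof -
  have "emeasure Q (space Q) = (\<integral>\<^sup>+z. 1 \<partial>Q)" by simp
  also have "\<dots> = (\<integral>\<^sup>+x. ennreal (fX x) * emeasure \<nu>M (space \<nu>M) \<partial>\<nu>X)"
    by (subst nn_integral_Q) auto
  also have "\<dots> = emeasure \<nu>M (space \<nu>M)"
    by (simp add: nn_integral_multc nn_integral_fX)
  finally show ?thesis .
qed

sublocale Q: finite_measure Q
  using emeasure_mediator(1) by (intro finite_measureI) (auto simp: emeasure_Q top_unique simp del: space_Q)

sublocale TQ: pair_sigma_finite T Q ..

lemma distr_AMX:
  "distr P (T \<Otimes>\<^sub>M Z) (\<lambda>\<omega>. (A \<omega>, M \<omega>, X \<omega>))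
    = density (T \<Otimes>\<^sub>M Q) (\<lambda>(t, m, x). ennreal (dens t m x))"
proof -
  have 1: "T \<Otimes>\<^sub>M Q = density (T \<Otimes>\<^sub>M Z) (\<lambda>(t, z). 1 * ennreal (fX (snd z)))"
    unfolding Q_def
    by (subst pair_measure_density[symmetric])
      (auto simp: density_1 Q_def[symmetric] intro: Q.sigma_finite_measure_axioms MX.sigma_finite_measure_axioms)
  have "distr P (T \<Otimes>\<^sub>M Z) (\<lambda>\<omega>. (A \<omega>, M \<omega>, X \<omega>))
      = density (T \<Otimes>\<^sub>M Z) (\<lambda>(t, m, x). ennreal (fAMX t m x))"
    using joint_density(2) by (simp add: distributed_def)
  also have "\<dots> = density (T \<Otimes>\<^sub>M Z)
      (\<lambda>z. (case z of (t, z) \<Rightarrow> 1 * ennreal (fX (snd z))) * (case z of (t, m, x) \<Rightarrow> ennreal (dens t m x)))"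
  proof (intro density_cong AE_I2)
    fix z assume z: "z \<in> space (T \<Otimes>\<^sub>M Z)"
    obtain t m x where [simp]: "z = (t, m, x)" by (cases z)
    have "t \<in> \<A>" "m \<in> space \<nu>M" "x \<in> space \<nu>X" using z by (auto simp: space_pair_measure)
    then show "(case z of (t, m, x) \<Rightarrow> ennreal (fAMX t m x)) =
        (case z of (t, z) \<Rightarrow> 1 * ennreal (fX (snd z))) * (case z of (t, m, x) \<Rightarrow> ennreal (dens t m x))"
      using fX_pos[of x] dens_bounds(1)[of t m x] by (simp add: dens_eq(1) ennreal_mult[symmetric] mult.commute)
  qed measurable
  also have "\<dots> = density (T \<Otimes>\<^sub>M Q) (\<lambda>(t, m, x). ennreal (dens t m x))"
    unfolding 1 by (subst density_density_eq) measurable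
  finally show ?thesis .
qed

lemma nn_integral_law_AMX:
  assumes [measurable]: "f \<in> borel_measurable (T \<Otimes>\<^sub>M Z)"
  shows "(\<integral>\<^sup>+\<omega>. f (A \<omega>, M \<omega>, X \<omega>) \<partial>P)
    = (\<integral>\<^sup>+z. \<integral>\<^sup>+t. ennreal (dens t (fst z) (snd z)) * f (t, z) \<partial>T \<partial>Q)" (is "?L = ?R")
proof -
  have "?L = (\<integral>\<^sup>+z. f z \<partial>distr P (T \<Otimes>\<^sub>M Z) (\<lambda>\<omega>. (A \<omega>, M \<omega>, X \<omega>)))"
    by (rule nn_integral_distr[symmetric]) measurable
  also have "\<dots> = (\<integral>\<^sup>+z. (case z of (t, m, x) \<Rightarrow> ennreal (dens t m x)) * f z \<partial>(T \<Otimes>\<^sub>M Q))"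
    unfolding distr_AMX by (subst nn_integral_density) measurable
  also have "\<dots> = ?R"
    by (subst TQ.nn_integral_snd[symmetric]) (auto simp: split_beta)
  finally show ?thesis .
qed

lemma integral_law_AMX:
  fixes f :: "_ \<Rightarrow> real"
  assumes [measurable]: "f \<in> borel_measurable (T \<Otimes>\<^sub>M Z)"
    and int: "integrable P (\<lambda>\<omega>. f (A \<omega>, M \<omega>, X \<omega>))"
  shows "(\<integral>\<omega>. f (A \<omega>, M \<omega>, X \<omega>) \<partial>P)
    = (\<integral>z. \<integral>t. dens t (fst z) (snd z) * f (t, z) \<partial>T \<partial>Q)" (is "?L = ?R")
proof -
  let ?N = "T \<Otimes>\<^sub>M Z" and ?d = "\<lambda>z. dens (fst z) (fst (snd z)) (snd (snd z))"
  have d: "(\<lambda>(t, m, x). ennreal (dens t m x)) = (\<lambda>z. ennreal (?d z))"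
    by (rule ext) (simp only: case_prod_beta)
  have pos: "AE z in T \<Otimes>\<^sub>M Q. 0 \<le> ?d z"
    by (intro AE_I2 less_imp_le[OF dens_bounds(1)]) (simp_all add: space_pair_measure mem_Times_iff)
  have "integrable (distr P ?N (\<lambda>\<omega>. (A \<omega>, M \<omega>, X \<omega>))) f"
    using int by (subst integrable_distr_eq) simp_all
  then have i: "integrable (T \<Otimes>\<^sub>M Q) (\<lambda>z. ?d z * f z)"
    unfolding distr_AMX d using pos by (subst (asm) integrable_real_density) simp_all
  have "?L = (\<integral>z. f z \<partial>distr P ?N (\<lambda>\<omega>. (A \<omega>, M \<omega>, X \<omega>)))"
    by (rule integral_distr[symmetric]) measurable
  also have "\<dots> = (\<integral>z. ?d z * f z \<partial>(T \<Otimes>\<^sub>M Q))"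
    unfolding distr_AMX d using pos by (subst integral_real_density) simp_all
  also have "\<dots> = ?R"
    using TQ.integral_snd[of "\<lambda>t z. ?d (t, z) * f (t, z)"] i by (simp add: split_beta')
  finally show ?thesis .
qed

end

section \<open>Identification\<close>

context mediation_model begin

lemma measurable_kernel_cong:
  assumes "w \<in> space N" "regular_cond_prob P N W \<kappa>"
  shows "measurable (\<kappa> w) L = measurable P L"
  by (rule measurable_cong_sets[OF regular_cond_probD(4)[OF assms(2,1)] refl])

lemma distr_potential_outcome:
  assumes m: "m \<in> space \<nu>M" and x: "x \<in> space \<nu>X"
  defines "N \<equiv> restrict_space borel \<Y>"
  shows "distr (\<kappa>pot a' (m, x)) N (\<lambda>\<omega>. Ypot a (Mpot a' \<omega>) \<omega>) = distr (\<kappa>AMX ((a, m), x)) N Y"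
proof -
  have w: "(m, x) \<in> space Z" "((a, m), x) \<in> space ((T \<Otimes>\<^sub>M \<nu>M) \<Otimes>\<^sub>M \<nu>X)"
    using m x by (auto simp: space_pair_measure)
  note pot = kernels(4)[OF target_in(2)] and obs = kernels(3)
  have "distr (\<kappa>pot a' (m, x)) N (\<lambda>\<omega>. Ypot a (Mpot a' \<omega>) \<omega>) = distr (\<kappa>pot a' (m, x)) N (Ypot a m)"
    unfolding N_def
  proof (rule distr_cong_AE)
    show "AE \<omega> in \<kappa>pot a' (m, x). Ypot a (Mpot a' \<omega>) \<omega> = Ypot a m \<omega>"
      using regular_cond_probD(5)[OF pot w(1)] by eventually_elim auto
  qed (use potential m in \<open>auto simp: measurable_kernel_cong[OF w(1) pot]\<close>)
  also have "\<dots> = distr (\<kappa>X x) N (Ypot a m)"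
    using exchangeability(3)[of a a' m] m x unfolding cond_indep_values_def N_def by auto
  also have "\<dots> = distr (\<kappa>AMX ((a, m), x)) N (Ypot a m)"
    using exchangeability(1)[of a m] m x unfolding cond_indep_values_def N_def by (auto simp: space_pair_measure)
  also have "\<dots> = distr (\<kappa>AMX ((a, m), x)) N Y"
    unfolding N_def
  proof (rule distr_cong_AE)
    show "AE \<omega> in \<kappa>AMX ((a, m), x). Ypot a m \<omega> = Y \<omega>"
      using regular_cond_probD(5)[OF obs w(2)] AE_space
    proof eventually_elim
      case (elim \<omega>)
      then have "\<omega> \<in> space P"
        using sets_eq_imp_space_eq[OF regular_cond_probD(4)[OF obs w(2)]] by simp
      then show ?case using elim m by (intro consistency(1)) auto
    qed
  qed (use potential observed m in \<open>auto simp: measurable_kernel_cong[OF w(2) obs]\<close>)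
  finally show ?thesis .
qed

lemma distr_potential_mediator:
  assumes x: "x \<in> space \<nu>X"
  shows "distr (\<kappa>X x) \<nu>M (Mpot a') = density \<nu>M (\<lambda>m. ennreal (\<alpha> a' m x))"
proof -
  have w: "(a', x) \<in> space (T \<Otimes>\<^sub>M \<nu>X)"
    using x by (auto simp: space_pair_measure)
  have "distr (\<kappa>X x) \<nu>M (Mpot a') = distr (\<kappa>AX (a', x)) \<nu>M (Mpot a')"
    using exchangeability(2)[of a'] x unfolding cond_indep_values_def by auto
  also have "\<dots> = distr (\<kappa>AX (a', x)) \<nu>M M"
  proof (rule distr_cong_AE)
    show "AE \<omega> in \<kappa>AX (a', x). Mpot a' \<omega> = M \<omega>"
      using regular_cond_probD(5)[OF kernels(2) w] AE_space
    proof eventually_elim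
      case (elim \<omega>)
      then have "\<omega> \<in> space P"
        using sets_eq_imp_space_eq[OF regular_cond_probD(4)[OF kernels(2) w]] by simp
      then show ?case using elim by (intro consistency(2)) auto
    qed
  qed (use potential observed in \<open>auto simp: measurable_kernel_cong[OF w kernels(2)]\<close>)
  also have "\<dots> = density \<nu>M (\<lambda>m. ennreal (\<alpha> a' m x))"
    using mediator_law[OF target_in(2) x] by (simp add: distributed_def)
  finally show ?thesis .
qed

lemma distr_potential_mediator_covariate:
  "distr P Z (\<lambda>\<omega>. (Mpot a' \<omega>, X \<omega>)) = density Q (\<lambda>z. ennreal (\<alpha> a' (fst z) (snd z)))"
proof (rule measure_eqI)
  fix B assume "B \<in> sets (distr P Z (\<lambda>\<omega>. (Mpot a' \<omega>, X \<omega>)))"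
  then have B[measurable]: "B \<in> sets Z" by simp
  note potential(1)[OF target_in(2), measurable]
  note rcp = kernels(1)
  note [measurable] = regular_cond_probD(2)[OF rcp]
  have inner: "(\<integral>\<^sup>+\<omega>. indicator B (Mpot a' \<omega>, X \<omega>) \<partial>\<kappa>X x)
      = (\<integral>\<^sup>+m. ennreal (\<alpha> a' m x) * indicator B (m, x) \<partial>\<nu>M)" if x[measurable]: "x \<in> space \<nu>X" for x
  proof -
    note meas = measurable_kernel_cong[OF x rcp]
    have M: "Mpot a' \<in> measurable (\<kappa>X x) \<nu>M" unfolding meas by measurable
    have "(\<integral>\<^sup>+\<omega>. indicator B (Mpot a' \<omega>, X \<omega>) \<partial>\<kappa>X x) = (\<integral>\<^sup>+\<omega>. indicator B (Mpot a' \<omega>, x) \<partial>\<kappa>X x)"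
      using regular_cond_probD(5)[OF rcp x] by (intro nn_integral_cong_AE) auto
    also have "\<dots> = (\<integral>\<^sup>+m. indicator B (m, x) \<partial>distr (\<kappa>X x) \<nu>M (Mpot a'))"
      by (rule nn_integral_distr[OF M, symmetric]) measurable
    also have "\<dots> = (\<integral>\<^sup>+m. ennreal (\<alpha> a' m x) * indicator B (m, x) \<partial>\<nu>M)"
      unfolding distr_potential_mediator[OF x] by (rule nn_integral_density) measurable
    finally show ?thesis .
  qed
  have "emeasure (distr P Z (\<lambda>\<omega>. (Mpot a' \<omega>, X \<omega>))) B
      = (\<integral>\<^sup>+z. indicator B z \<partial>distr P Z (\<lambda>\<omega>. (Mpot a' \<omega>, X \<omega>)))"
    by simp
  also have "\<dots> = (\<integral>\<^sup>+\<omega>. indicator B (Mpot a' \<omega>, X \<omega>) \<partial>P)"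
    by (rule nn_integral_distr) measurable
  also have "\<dots> = (\<integral>\<^sup>+x. \<integral>\<^sup>+\<omega>. indicator B (Mpot a' \<omega>, X \<omega>) \<partial>\<kappa>X x \<partial>distr P \<nu>X X)"
    by (rule nn_integral_regular_cond_prob[OF prob_space_axioms rcp]) measurable
  also have "\<dots> = (\<integral>\<^sup>+x. (\<integral>\<^sup>+m. ennreal (\<alpha> a' m x) * indicator B (m, x) \<partial>\<nu>M) \<partial>distr P \<nu>X X)"
    by (intro nn_integral_cong) (simp add: inner)
  also have "\<dots> = (\<integral>\<^sup>+x. ennreal (fX x) * (\<integral>\<^sup>+m. ennreal (\<alpha> a' m x) * indicator B (m, x) \<partial>\<nu>M) \<partial>\<nu>X)"
    unfolding distr_X by (rule nn_integral_density) measurable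
  also have "\<dots> = (\<integral>\<^sup>+z. ennreal (\<alpha> a' (fst z) (snd z)) * indicator B z \<partial>Q)"
    by (subst nn_integral_Q) simp_all
  also have "\<dots> = emeasure (density Q (\<lambda>z. ennreal (\<alpha> a' (fst z) (snd z)))) B"
    by (subst emeasure_density) measurable
  finally show "emeasure (distr P Z (\<lambda>\<omega>. (Mpot a' \<omega>, X \<omega>))) B
      = emeasure (density Q (\<lambda>z. ennreal (\<alpha> a' (fst z) (snd z)))) B" .
qed simp

lemma conditional_second_moment:
  assumes "t \<in> \<A>" "m \<in> space \<nu>M" "x \<in> space \<nu>X"
  shows "(\<integral>\<^sup>+\<omega>. ennreal ((Y \<omega>)\<^sup>2) \<partial>\<kappa>AMX ((t, m), x)) \<le> ennreal (2 + 2 * C + 2 * C\<^sup>2)"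
proof -
  have w: "((t, m), x) \<in> space ((T \<Otimes>\<^sub>M \<nu>M) \<Otimes>\<^sub>M \<nu>X)"
    using assms by (auto simp: space_pair_measure)
  interpret \<kappa>: prob_space "\<kappa>AMX ((t, m), x)" by (rule regular_cond_probD(3)[OF kernels(3) w])
  have [measurable]: "Y \<in> borel_measurable (\<kappa>AMX ((t, m), x))"
    unfolding measurable_kernel_cong[OF w kernels(3)] by measurable
  let ?g = "\<gamma> x m t"
  have g: "\<bar>?g\<bar> \<le> C" using bounds(2)[OF assms] by simp
  have C: "1 \<le> C" by (rule bounds)
  have "y\<^sup>2 \<le> 2 + 2 * C\<^sup>2 + 2 * \<bar>y - ?g\<bar> ^ 3" for y
  proof -
    have "u\<^sup>2 \<le> 1 + u ^ 3" if "0 \<le> u" for u :: real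
    proof (cases "u \<le> 1")
      case True
      then have "u\<^sup>2 \<le> 1" using that by (simp add: power_le_one)
      moreover have "0 \<le> u ^ 3" using that by simp
      ultimately show ?thesis by linarith
    next
      case False
      then have "u\<^sup>2 \<le> u ^ 3" by (intro power_increasing) auto
      then show ?thesis by linarith
    qed
    from this[of "\<bar>y - ?g\<bar>"] have "(y - ?g)\<^sup>2 \<le> 1 + \<bar>y - ?g\<bar> ^ 3" by simp
    moreover have "?g\<^sup>2 \<le> C\<^sup>2" using g C by (metis abs_le_square_iff abs_of_nonneg order_trans zero_le_one)
    moreover have "y\<^sup>2 \<le> 2 * (y - ?g)\<^sup>2 + 2 * ?g\<^sup>2"
      using sum_squares_ge_zero[of "y - 2 * ?g" 0] by (simp add: power2_eq_square algebra_simps)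
    ultimately show ?thesis by linarith
  qed
  moreover have "ennreal (2 + 2 * C\<^sup>2) + ennreal 2 * ennreal (\<bar>y - ?g\<bar> ^ 3)
      = ennreal (2 + 2 * C\<^sup>2 + 2 * \<bar>y - ?g\<bar> ^ 3)" for y
    by (subst ennreal_mult[symmetric], simp, simp, subst ennreal_plus[symmetric]) auto
  ultimately have "(\<integral>\<^sup>+\<omega>. ennreal ((Y \<omega>)\<^sup>2) \<partial>\<kappa>AMX ((t, m), x))
      \<le> (\<integral>\<^sup>+\<omega>. ennreal (2 + 2 * C\<^sup>2) + ennreal 2 * ennreal (\<bar>Y \<omega> - ?g\<bar> ^ 3) \<partial>\<kappa>AMX ((t, m), x))"
    by (intro nn_integral_mono) (simp only: ennreal_leI)
  also have "\<dots> = ennreal (2 + 2 * C\<^sup>2) + ennreal 2 * (\<integral>\<^sup>+\<omega>. ennreal (\<bar>Y \<omega> - ?g\<bar> ^ 3) \<partial>\<kappa>AMX ((t, m), x))"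
    by (subst nn_integral_add) (auto simp: nn_integral_cmult \<kappa>.emeasure_space_1)
  also have "\<dots> \<le> ennreal (2 + 2 * C\<^sup>2) + ennreal 2 * ennreal C"
    by (intro add_left_mono mult_left_mono third_moment assms) simp
  also have "\<dots> = ennreal (2 + 2 * C + 2 * C\<^sup>2)"
    using C by (subst ennreal_mult[symmetric], simp, simp, subst ennreal_plus[symmetric])
      (auto simp: algebra_simps)
  finally show ?thesis .
qed

lemma identification:
  "(\<integral>\<omega>. Ypot a (Mpot a' \<omega>) \<omega> \<partial>P) = (\<integral>z. \<gamma> (snd z) (fst z) a * \<alpha> a' (fst z) (snd z) \<partial>Q)"
proof -
  define F where "F \<omega> = Ypot a (Mpot a' \<omega>) \<omega>" for \<omega>
  let ?N = "restrict_space borel \<Y>" and ?W = "\<lambda>\<omega>. (Mpot a' \<omega>, X \<omega>)"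
  have F: "F \<in> measurable P ?N" unfolding F_def by (rule potential) auto
  have id[measurable]: "(\<lambda>y. y) \<in> borel_measurable ?N"
    by (rule measurable_restrict_space1) simp
  have [measurable]: "F \<in> borel_measurable P" using measurable_compose[OF F id] by simp
  note [measurable] = potential(1)[OF target_in(2)]
  note pot = kernels(4)[OF target_in(2)]
  have cond: "(\<integral>\<^sup>+\<omega>. G (F \<omega>) \<partial>\<kappa>pot a' (m, x)) = (\<integral>\<^sup>+\<omega>. G (Y \<omega>) \<partial>\<kappa>AMX ((a, m), x))"
    "(\<integral>\<omega>. F \<omega> \<partial>\<kappa>pot a' (m, x)) = \<gamma> x m a"
    if m: "m \<in> space \<nu>M" and x: "x \<in> space \<nu>X" and [measurable]: "G \<in> borel_measurable borel" for m x
      and G :: "real \<Rightarrow> ennreal"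
  proof -
    have w: "(m, x) \<in> space Z" "((a, m), x) \<in> space ((T \<Otimes>\<^sub>M \<nu>M) \<Otimes>\<^sub>M \<nu>X)"
      using m x by (auto simp: space_pair_measure)
    note eq = distr_potential_outcome[OF m x, folded F_def]
    have meas: "F \<in> measurable (\<kappa>pot a' (m, x)) ?N" "Y \<in> measurable (\<kappa>AMX ((a, m), x)) ?N"
      using F observed by (auto simp: measurable_kernel_cong[OF w(1) pot] measurable_kernel_cong[OF w(2) kernels(3)])
    have "G \<in> borel_measurable ?N" by (rule measurable_restrict_space1) measurable
    then show "(\<integral>\<^sup>+\<omega>. G (F \<omega>) \<partial>\<kappa>pot a' (m, x)) = (\<integral>\<^sup>+\<omega>. G (Y \<omega>) \<partial>\<kappa>AMX ((a, m), x))"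
      using nn_integral_distr[OF meas(1), of G] nn_integral_distr[OF meas(2), of G] eq by simp
    show "(\<integral>\<omega>. F \<omega> \<partial>\<kappa>pot a' (m, x)) = \<gamma> x m a"
      using integral_distr[OF meas(1) id] integral_distr[OF meas(2) id] eq by (simp add: nuisance)
  qed
  have "integrable P F"
  proof (rule integrableI_bounded)
    have "(\<integral>\<^sup>+\<omega>. ennreal (norm (F \<omega>)) \<partial>P) \<le> (\<integral>\<^sup>+\<omega>. 1 + ennreal ((F \<omega>)\<^sup>2) \<partial>P)"
    proof (intro nn_integral_mono)
      fix \<omega>
      have "2 * \<bar>F \<omega>\<bar> \<le> 1 + (F \<omega>)\<^sup>2"
        using zero_le_power2[of "\<bar>F \<omega>\<bar> - 1"] by (simp add: power2_diff)
      then have "\<bar>F \<omega>\<bar> \<le> 1 + (F \<omega>)\<^sup>2" by linarith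
      then show "ennreal (norm (F \<omega>)) \<le> 1 + ennreal ((F \<omega>)\<^sup>2)"
        by (simp add: ennreal_leI flip: ennreal_1 ennreal_plus)
    qed
    also have "\<dots> = 1 + (\<integral>\<^sup>+\<omega>. ennreal ((F \<omega>)\<^sup>2) \<partial>P)"
      by (subst nn_integral_add) (auto simp: emeasure_space_1)
    also have "(\<integral>\<^sup>+\<omega>. ennreal ((F \<omega>)\<^sup>2) \<partial>P)
        = (\<integral>\<^sup>+w. \<integral>\<^sup>+\<omega>. ennreal ((F \<omega>)\<^sup>2) \<partial>\<kappa>pot a' w \<partial>distr P Z ?W)"
      by (rule nn_integral_regular_cond_prob[OF prob_space_axioms pot]) measurable
    also have "\<dots> \<le> (\<integral>\<^sup>+w. ennreal (2 + 2 * C + 2 * C\<^sup>2) \<partial>distr P Z ?W)"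
    proof (intro nn_integral_mono)
      fix w assume "w \<in> space (distr P Z ?W)"
      then obtain m x where w: "w = (m, x)" "m \<in> space \<nu>M" "x \<in> space \<nu>X"
        by (auto simp: space_pair_measure)
      then show "(\<integral>\<^sup>+\<omega>. ennreal ((F \<omega>)\<^sup>2) \<partial>\<kappa>pot a' w) \<le> ennreal (2 + 2 * C + 2 * C\<^sup>2)"
        using cond(1)[OF w(2,3), of "\<lambda>y. ennreal (y\<^sup>2)"] conditional_second_moment[OF target_in(1) w(2,3)] by simp
    qed
    also have "\<dots> = ennreal (2 + 2 * C + 2 * C\<^sup>2)"
      using prob_space.emeasure_space_1[OF prob_space_distr[of ?W Z]] by simp
    finally show "(\<integral>\<^sup>+\<omega>. ennreal (norm (F \<omega>)) \<partial>P) < \<infinity>"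
      by (auto simp: less_top[symmetric] top_unique add_left_mono)
  qed measurable
  then have "(\<integral>\<omega>. F \<omega> \<partial>P) = (\<integral>w. \<integral>\<omega>. F \<omega> \<partial>\<kappa>pot a' w \<partial>distr P Z ?W)"
    by (rule integral_regular_cond_prob[OF prob_space_axioms pot])
  also have "\<dots> = (\<integral>z. \<gamma> (snd z) (fst z) a \<partial>distr P Z ?W)"
    using cond(2)[of _ _ "\<lambda>_. 0"] by (intro Bochner_Integration.integral_cong refl) (auto simp: space_pair_measure)
  also have "\<dots> = (\<integral>z. \<alpha> a' (fst z) (snd z) * \<gamma> (snd z) (fst z) a \<partial>Q)"
  proof -
    have "AE z in Q. 0 \<le> \<alpha> a' (fst z) (snd z)"
      by (intro AE_I2 less_imp_le[OF nuisance_pos(1)]) auto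
    then show ?thesis
      unfolding distr_potential_mediator_covariate by (subst integral_real_density) simp_all
  qed
  finally show ?thesis by (simp add: F_def mult.commute)
qed

end

section \<open>Localization of the treatment\<close>

context mediation_model begin

lemma measurable_treatment[measurable]: "A \<in> borel_measurable P"
  using observed(1) by (simp add: measurable_restrict_space2_iff)

lemma measurable_prod_kernel_treatment[measurable (raw)]:
  assumes "k \<in> borel_measurable borel" "f \<in> measurable N T"
  shows "(\<lambda>y. prod_kernel k h (f y - s)) \<in> borel_measurable N"
proof -
  have "f \<in> borel_measurable N"
    using assms(2) by (simp add: measurable_restrict_space2_iff)
  then show ?thesis using assms(1) by measurable
qed

lemma measure_treatment:
  "0 < measure T \<A>" "emeasure T \<A> < \<infinity>"
proof -
  let ?l = "emeasure T \<A>" and ?q = "emeasure Q (space Q)"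
  have C: "0 < C" using bounds(1) by simp
  have one: "1 = (\<integral>\<^sup>+z. \<integral>\<^sup>+t. ennreal (dens t (fst z) (snd z)) \<partial>T \<partial>Q)"
    using nn_integral_law_AMX[of "\<lambda>_. 1"] by (simp add: emeasure_space_1)
  also have "\<dots> \<le> (\<integral>\<^sup>+z. \<integral>\<^sup>+t. ennreal (C\<^sup>2) \<partial>T \<partial>Q)"
    by (intro nn_integral_mono ennreal_leI dens_bounds) auto
  finally have upper: "1 \<le> ennreal (C\<^sup>2) * ?l * ?q"
    by simp
  have "(\<integral>\<^sup>+z. \<integral>\<^sup>+t. ennreal (1 / C\<^sup>2) \<partial>T \<partial>Q) \<le> 1"
    unfolding one by (intro nn_integral_mono ennreal_leI dens_bounds) auto
  then have "ennreal (1 / C\<^sup>2) * ?l * ?q \<le> 1" by simp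
  moreover have "0 < ?q" using emeasure_mediator(2) by (simp add: emeasure_Q del: space_Q)
  ultimately show fin: "?l < \<infinity>"
    using C by (auto simp: less_top[symmetric] ennreal_mult_top ennreal_top_mult top_unique split: if_splits)
  have "?l \<noteq> 0" using upper by auto
  then show "0 < measure T \<A>"
    using fin by (simp add: measure_def enn2real_positive_iff zero_less_iff_neq_zero)
qed

sublocale T: finite_measure T
  using measure_treatment(2) by (intro finite_measureI) auto

lemma marginal_density_bounds:
  assumes m: "m \<in> space \<nu>M" and x: "x \<in> space \<nu>X"
  shows "fX x * (measure T \<A> / C\<^sup>2) \<le> fMX m x" "fMX m x \<le> fX x * (measure T \<A> * C\<^sup>2)"
proof -
  have [measurable]: "m \<in> space \<nu>M" "x \<in> space \<nu>X" by fact+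
  have eq: "fMX m x = fX x * (\<integral>t. dens t m x \<partial>T)"
    unfolding marginals(2) using m x
    by (subst integral_mult_right_zero[symmetric], intro Bochner_Integration.integral_cong refl) (simp add: dens_eq(1) mult.commute)
  have i: "integrable T (\<lambda>t. dens t m x)"
    using m x by (intro T.integrable_const_bound[where B="C\<^sup>2"] AE_I2)
      (auto simp: dens_bounds less_imp_le[OF dens_bounds(1)])
  have "(\<integral>t. 1 / C\<^sup>2 \<partial>T) \<le> (\<integral>t. dens t m x \<partial>T)"
    "(\<integral>t. dens t m x \<partial>T) \<le> (\<integral>t. C\<^sup>2 \<partial>T)"
    using m x by (intro integral_mono i; simp add: dens_bounds)+
  then show "fX x * (measure T \<A> / C\<^sup>2) \<le> fMX m x" "fMX m x \<le> fX x * (measure T \<A> * C\<^sup>2)"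
    unfolding eq using fX_pos[OF x] by (intro mult_left_mono; simp)+
qed

lemma continuous_dens:
  assumes m: "m \<in> space \<nu>M" and x: "x \<in> space \<nu>X"
  shows "continuous_on (interior \<A>) (\<lambda>t. dens t m x)"
proof -
  have "0 < fX x * (measure T \<A> / C\<^sup>2)"
    using fX_pos[OF x] measure_treatment(1) bounds(1) by simp
  then have "0 < fMX m x" using marginal_density_bounds(1)[OF m x] by linarith
  then have "dens t m x = fAMX t m x / fMX m x * (fMX m x / fX x)" if "t \<in> interior \<A>" for t
    using that interior_subset[of \<A>] dens_eq(2)[of t m x] m x by auto
  then show ?thesis
    using continuous_on_mult_right[OF continuous(1)[OF m x], of "fMX m x / fX x"]
    by (simp cong: continuous_on_cong)
qed

lemma kernel_smoothing:
  fixes u :: "real^'d \<Rightarrow> 'm \<Rightarrow> 'x \<Rightarrow> real" and h :: "nat \<Rightarrow> real"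
  assumes k: "integrable lborel k" "(\<integral>v. k v \<partial>lborel) = 1" and h: "\<And>n. 0 < h n" "h \<longlonglongrightarrow> 0"
    and s: "s \<in> interior \<A>"
    and u[measurable]: "(\<lambda>z. u (fst z) (fst (snd z)) (snd (snd z))) \<in> borel_measurable (T \<Otimes>\<^sub>M Z)"
    and u_le: "\<And>t m x. t \<in> \<A> \<Longrightarrow> m \<in> space \<nu>M \<Longrightarrow> x \<in> space \<nu>X \<Longrightarrow> \<bar>u t m x\<bar> \<le> B"
    and u_cont: "\<And>m x. m \<in> space \<nu>M \<Longrightarrow> x \<in> space \<nu>X \<Longrightarrow> continuous_on (interior \<A>) (\<lambda>t. u t m x)"
  defines "R \<equiv> \<lambda>n z. \<integral>t. prod_kernel k (h n) (t - s) * u t (fst z) (snd z) \<partial>T"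
  shows "R n \<in> borel_measurable Z" "integrable Q (R n)"
    "(\<lambda>n. \<integral>z. \<bar>R n z - u s (fst z) (snd z)\<bar> \<partial>Q) \<longlonglongrightarrow> 0"
proof -
  have k_meas[measurable]: "k \<in> borel_measurable borel"
    using borel_measurable_integrable[OF k(1)] by simp
  have [measurable]: "(\<lambda>z. u (snd z) (fst (fst z)) (snd (fst z))) \<in> borel_measurable (Z \<Otimes>\<^sub>M T)"
    using measurable_compose[OF _ u, of "\<lambda>z. (snd z, fst z)"] by simp
  show R_meas[measurable]: "R n \<in> borel_measurable Z" for n
    unfolding R_def by measurable
  have sA: "s \<in> \<A>" using s interior_subset by auto
  then have [measurable]: "(\<lambda>z. u s (fst z) (snd z)) \<in> borel_measurable Z"
    using measurable_compose[OF measurable_Pair1' u, of s] by simp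
  define K where "K = (\<integral>v. \<bar>k v\<bar> \<partial>lborel) ^ CARD('d) * \<bar>B\<bar>"
  define f where "f z t = indicator \<A> t *\<^sub>R u t (fst z) (snd z)" for z t
  have f: "f z \<in> borel_measurable borel" "\<bar>f z t\<bar> \<le> \<bar>B\<bar>" "isCont (f z) s" "f z s = u s (fst z) (snd z)"
    "R n z = (\<integral>t. prod_kernel k (h n) (t - s) * f z t \<partial>lborel)"
    if z: "z \<in> space Z" for z t n
  proof -
    have mx: "fst z \<in> space \<nu>M" "snd z \<in> space \<nu>X" using z by (auto simp: space_pair_measure)
    have "(\<lambda>t. u t (fst z) (snd z)) \<in> borel_measurable T"
      using measurable_compose[OF measurable_Pair2'[OF z] u] by simp
    then show "f z \<in> borel_measurable borel"
      using spaces(1) by (simp add: borel_measurable_restrict_space_iff f_def[abs_def])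
    show "\<bar>f z t\<bar> \<le> \<bar>B\<bar>"
      using u_le[OF _ mx, of t] by (auto simp: f_def split: split_indicator)
    have "isCont (\<lambda>t. u t (fst z) (snd z)) s"
      using u_cont[OF mx] s by (simp add: continuous_on_eq_continuous_at)
    moreover have "\<forall>\<^sub>F t in nhds s. f z t = u t (fst z) (snd z)"
      using eventually_nhds_in_open[OF open_interior s] interior_subset[of \<A>]
      by (auto simp: f_def elim!: eventually_mono)
    ultimately show "isCont (f z) s" by (simp add: isCont_cong)
    show "f z s = u s (fst z) (snd z)" using sA by (simp add: f_def)
    show "R n z = (\<integral>t. prod_kernel k (h n) (t - s) * f z t \<partial>lborel)"
      unfolding R_def using spaces(1)
      by (subst integral_restrict_space) (auto simp: f_def ac_simps)
  qed
  have R_le: "\<bar>R n z\<bar> \<le> K" if "z \<in> space Z" for n z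
    unfolding f(5)[OF that] K_def using f(1,2)[OF that] by (intro integrable_prod_kernel_mult k h)
  show R_int: "integrable Q (R n)" for n
    by (intro Q.integrable_const_bound[where B=K] AE_I2) (auto simp: R_le space_pair_measure)
  have "(\<lambda>n. \<integral>z. \<bar>R n z - u s (fst z) (snd z)\<bar> \<partial>Q) \<longlonglongrightarrow> (\<integral>z. 0 \<partial>Q)"
  proof (rule integral_dominated_convergence[where w="\<lambda>_. K + \<bar>B\<bar>"])
    show "AE z in Q. (\<lambda>n. \<bar>R n z - u s (fst z) (snd z)\<bar>) \<longlonglongrightarrow> 0"
    proof (intro AE_I2)
      fix z assume "z \<in> space Q"
      then have z: "z \<in> space Z" by (auto simp: space_pair_measure)
      have "(\<lambda>n. R n z) \<longlonglongrightarrow> u s (fst z) (snd z)"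
        unfolding f(5)[OF z] f(4)[OF z, symmetric]
        by (rule prod_kernel_approximate_identity[OF k h f(1,2,3)[OF z]])
      then show "(\<lambda>n. \<bar>R n z - u s (fst z) (snd z)\<bar>) \<longlonglongrightarrow> 0"
        by (intro tendsto_rabs_zero LIM_zero)
    qed
    show "AE z in Q. norm \<bar>R n z - u s (fst z) (snd z)\<bar> \<le> K + \<bar>B\<bar>" for n
    proof (intro AE_I2)
      fix z assume "z \<in> space Q"
      then have z: "z \<in> space Z" by (auto simp: space_pair_measure)
      have "\<bar>u s (fst z) (snd z)\<bar> \<le> \<bar>B\<bar>" using f(2,4)[OF z] by metis
      then show "norm \<bar>R n z - u s (fst z) (snd z)\<bar> \<le> K + \<bar>B\<bar>"
        using R_le[OF z, of n] by simp
    qed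
  qed simp_all
  then show "(\<lambda>n. \<integral>z. \<bar>R n z - u s (fst z) (snd z)\<bar> \<partial>Q) \<longlonglongrightarrow> 0"
    by simp
qed

lemma kernel_second_moment:
  assumes k: "integrable lborel k" "integrable lborel (\<lambda>u. (k u)\<^sup>2)" and h: "0 < h"
  defines "K \<equiv> C ^ 3 * (\<integral>u. (k u)\<^sup>2 \<partial>lborel) ^ CARD('d)"
  shows "(\<integral>\<^sup>+\<omega>. ennreal ((prod_kernel k h (A \<omega> - s))\<^sup>2) \<partial>P) \<le> ennreal (K / h ^ CARD('d))"
    "(\<integral>\<^sup>+\<omega>. ennreal ((prod_kernel k h (A \<omega> - s))\<^sup>2 * (Y \<omega>)\<^sup>2) \<partial>P)
      \<le> ennreal ((2 + 2 * C + 2 * C\<^sup>2) * K / h ^ CARD('d))"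
proof -
  let ?k = "\<lambda>t. (prod_kernel k h (t - s))\<^sup>2" and ?W = "2 + 2 * C + 2 * C\<^sup>2"
  have [measurable]: "k \<in> borel_measurable borel" using borel_measurable_integrable[OF k(1)] by simp
  have C: "1 \<le> C" by (rule bounds)
  let ?I = "(\<integral>u. (k u)\<^sup>2 \<partial>lborel) ^ CARD('d) / h ^ CARD('d)"
  have I: "0 \<le> ?I" using h by simp
  have sq: "(\<integral>\<^sup>+t. ennreal (?k t) \<partial>T) \<le> ennreal ?I"
  proof -
    have "(\<integral>\<^sup>+t. ennreal (?k t) \<partial>T)
        \<le> (\<integral>\<^sup>+t. ennreal (?k t) \<partial>lborel)"
      using spaces(1) by (subst nn_integral_restrict_space)
        (auto intro!: nn_integral_mono split: split_indicator)
    also have "integrable lborel (\<lambda>t. ?k t)"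
      using integrable_prod_kernel(1)[OF k(2) h, of s] by (simp add: prod_kernel_square h)
    then have "(\<integral>\<^sup>+t. ennreal (?k t) \<partial>lborel)
        = ennreal (\<integral>t. ?k t \<partial>lborel)"
      by (intro nn_integral_eq_integral) auto
    also have "\<dots> = ennreal ?I"
      using integrable_prod_kernel(2)[OF k(2) h, of s] by (simp add: prod_kernel_square h)
    finally show ?thesis .
  qed
  have "(\<integral>\<^sup>+\<omega>. ennreal (?k (A \<omega>)) \<partial>P)
      = (\<integral>\<^sup>+z. \<integral>\<^sup>+t. ennreal (dens t (fst z) (snd z)) * ennreal (?k t) \<partial>T \<partial>Q)"
    using nn_integral_law_AMX[of "\<lambda>z. ennreal (?k (fst z))"] by simp
  also have "\<dots> \<le> (\<integral>\<^sup>+z. \<integral>\<^sup>+t. ennreal (C\<^sup>2) * ennreal (?k t) \<partial>T \<partial>Q)"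
    by (intro nn_integral_mono mult_right_mono ennreal_leI dens_bounds) auto
  also have "\<dots> = ennreal (C\<^sup>2) * (\<integral>\<^sup>+t. ennreal (?k t) \<partial>T) * emeasure \<nu>M (space \<nu>M)"
    by (simp add: nn_integral_cmult emeasure_Q[simplified])
  also have "\<dots> \<le> ennreal (C\<^sup>2) * ennreal ?I * ennreal C"
    by (intro mult_mono sq emeasure_mediator) auto
  also have "\<dots> = ennreal (K / h ^ CARD('d))"
    using C I h by (simp add: ennreal_mult[symmetric] K_def power2_eq_square power3_eq_cube ac_simps)
  finally show 1: "(\<integral>\<^sup>+\<omega>. ennreal (?k (A \<omega>)) \<partial>P) \<le> ennreal (K / h ^ CARD('d))" .
  have "(\<integral>\<^sup>+\<omega>. ennreal (?k (A \<omega>) * (Y \<omega>)\<^sup>2) \<partial>P)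
      = (\<integral>\<^sup>+\<omega>. ennreal (?k (A \<omega>)) * (\<integral>\<^sup>+\<omega>'. ennreal ((Y \<omega>')\<^sup>2) \<partial>\<kappa>AMX ((A \<omega>, M \<omega>), X \<omega>)) \<partial>P)"
    using nn_integral_regular_cond_prob_mult[OF prob_space_axioms kernels(3),
        of "\<lambda>\<omega>. ennreal ((Y \<omega>)\<^sup>2)" "\<lambda>w. ennreal (?k (fst (fst w)))"]
    by (simp add: ennreal_mult)
  also have "\<dots> \<le> (\<integral>\<^sup>+\<omega>. ennreal (?k (A \<omega>)) * ennreal ?W \<partial>P)"
    by (intro nn_integral_mono mult_left_mono conditional_second_moment) auto
  also have "\<dots> = (\<integral>\<^sup>+\<omega>. ennreal (?k (A \<omega>)) \<partial>P) * ennreal ?W"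
    by (rule nn_integral_multc) measurable
  also have "\<dots> \<le> ennreal (K / h ^ CARD('d)) * ennreal ?W"
    by (intro mult_right_mono 1) simp
  also have "\<dots> = ennreal (?W * K / h ^ CARD('d))"
  proof -
    have "0 \<le> K / h ^ CARD('d)" "0 \<le> ?W" using C h by (auto simp: K_def)
    then show ?thesis by (subst ennreal_mult[symmetric]) (auto simp: ac_simps)
  qed
  finally show "(\<integral>\<^sup>+\<omega>. ennreal (?k (A \<omega>) * (Y \<omega>)\<^sup>2) \<partial>P)
      \<le> ennreal (?W * K / h ^ CARD('d))" .
qed

lemma integrable_outcome_square: "integrable P (\<lambda>\<omega>. (Y \<omega>)\<^sup>2)"
proof (rule integrableI_bounded)
  have "(\<integral>\<^sup>+\<omega>. ennreal (norm ((Y \<omega>)\<^sup>2)) \<partial>P) = (\<integral>\<^sup>+\<omega>. 1 * ennreal ((Y \<omega>)\<^sup>2) \<partial>P)"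
    by simp
  also have "\<dots> = (\<integral>\<^sup>+\<omega>. 1 * (\<integral>\<^sup>+\<omega>'. ennreal ((Y \<omega>')\<^sup>2) \<partial>\<kappa>AMX ((A \<omega>, M \<omega>), X \<omega>)) \<partial>P)"
    by (rule nn_integral_regular_cond_prob_mult[OF prob_space_axioms kernels(3), where G="\<lambda>_. 1"]) measurable
  also have "\<dots> \<le> (\<integral>\<^sup>+\<omega>. 1 * ennreal (2 + 2 * C + 2 * C\<^sup>2) \<partial>P)"
    by (intro nn_integral_mono mult_left_mono conditional_second_moment) auto
  finally show "(\<integral>\<^sup>+\<omega>. ennreal (norm ((Y \<omega>)\<^sup>2)) \<partial>P) < \<infinity>"
    by (auto simp: emeasure_space_1 less_top[symmetric] top_unique)
qed measurable

end

section \<open>The limiting bias\<close>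

lemma abs_le_add_square_div:
  fixes \<delta> u :: real
  assumes "0 < \<delta>"
  shows "\<bar>u\<bar> \<le> \<delta> + u\<^sup>2 / \<delta>"
proof -
  have "2 * (\<delta> * \<bar>u\<bar>) \<le> \<delta>\<^sup>2 + u\<^sup>2"
    using zero_le_power2[of "\<delta> - \<bar>u\<bar>"] by (simp add: power2_diff)
  moreover have "0 \<le> \<delta> * \<bar>u\<bar>" using assms by simp
  ultimately have "\<delta> * \<bar>u\<bar> \<le> \<delta>\<^sup>2 + u\<^sup>2" by linarith
  then show ?thesis using assms by (simp add: field_simps power2_eq_square)
qed

lemma integrable_mult_bounded:
  fixes f g :: "'a \<Rightarrow> real"
  assumes f: "integrable N f" and [measurable]: "g \<in> borel_measurable N"
    and le: "\<And>x. x \<in> space N \<Longrightarrow> \<bar>g x\<bar> \<le> B"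
  shows "integrable N (\<lambda>x. f x * g x)"
proof (rule Bochner_Integration.integrable_bound)
  show "integrable N (\<lambda>x. f x * B)" using f by simp
  show "AE x in N. norm (f x * g x) \<le> norm (f x * B)"
    by (intro AE_I2, unfold real_norm_def abs_mult)
      (intro mult_left_mono order_trans[OF le abs_ge_self] abs_ge_zero)
qed (use f in measurable)

text \<open>
  On the left, the integrand of the limiting mean of the moment function minus that of the target.
  Grouping it as on the right exhibits products of two nuisance errors.
\<close>

lemma drift_decomposition:
  fixes l l' lh lh' al al' ah ah' g gh :: real
  assumes "l \<noteq> 0" "l' \<noteq> 0" "ah \<noteq> 0"
  shows "al / l * g * (lh * (ah' / ah)) - al / l * (lh * (ah' / ah) * gh) + al' / l' * (lh' * gh)
      - lh' / l' * (gh * ah') + gh * ah' - g * al'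
    = ((lh / l) * (al / ah) * ah' - al') * (g - gh) + (lh' / l' - 1) * gh * (al' - ah')"
  using assms by (simp add: field_simps)

lemma drift_bounds:
  fixes C l l' lh lh' al al' ah ah' g gh :: real
  assumes C: "1 \<le> C" and l: "1 / C \<le> l" "1 / C \<le> l'" and lh: "\<bar>lh\<bar> \<le> C" "\<bar>lh'\<bar> \<le> C"
    and al: "\<bar>al\<bar> \<le> C" "\<bar>al'\<bar> \<le> C" and ah: "1 / C \<le> \<bar>ah\<bar>" "\<bar>ah'\<bar> \<le> C"
    and g: "\<bar>g\<bar> \<le> C" "\<bar>gh\<bar> \<le> C"
  defines "D \<equiv> ((lh / l) * (al / ah) * ah' - al') * (g - gh) + (lh' / l' - 1) * gh * (al' - ah')"
    and "eL \<equiv> \<bar>lh - l\<bar> + \<bar>lh' - l'\<bar>" and "eA \<equiv> \<bar>ah - al\<bar> + \<bar>ah' - al'\<bar>" and "eG \<equiv> \<bar>gh - g\<bar>"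
  shows "\<bar>D\<bar> \<le> 2 * C ^ 5 * (eL + eA)" "\<bar>D\<bar> \<le> 2 * C ^ 5 * (eL + eG)" "\<bar>D\<bar> \<le> 2 * C ^ 5 * (eA + eG)"
proof -
  have C0: "0 < C" using C by simp
  have pos: "0 < l" "0 < l'" "ah \<noteq> 0"
    using l ah(1) C0 by (auto intro: less_le_trans[of 0 "1 / C"])
  have div_le: "\<bar>u / v\<bar> \<le> B * C" if "\<bar>u\<bar> \<le> B" "1 / C \<le> \<bar>v\<bar>" for u v B
  proof -
    have "\<bar>u\<bar> / \<bar>v\<bar> \<le> B / (1 / C)" using that C0 by (intro frac_le) auto
    then show ?thesis by simp
  qed
  define p q p' where "p = lh / l" and "q = al / ah" and "p' = lh' / l'"
  have p: "\<bar>p\<bar> \<le> C\<^sup>2" "\<bar>p'\<bar> \<le> C\<^sup>2" and q: "\<bar>q\<bar> \<le> C\<^sup>2"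
    unfolding p_def p'_def q_def power2_eq_square using lh l al ah pos by (intro div_le; simp)+
  have "p - 1 = (lh - l) / l" "p' - 1 = (lh' - l') / l'" "q - 1 = (al - ah) / ah"
    using pos by (simp_all add: p_def p'_def q_def field_simps)
  then have p1: "\<bar>p - 1\<bar> \<le> \<bar>lh - l\<bar> * C" "\<bar>p' - 1\<bar> \<le> \<bar>lh' - l'\<bar> * C" and q1: "\<bar>q - 1\<bar> \<le> \<bar>ah - al\<bar> * C"
    using div_le[of "lh - l" "\<bar>lh - l\<bar>" l] div_le[of "lh' - l'" "\<bar>lh' - l'\<bar>" l']
      div_le[of "al - ah" "\<bar>ah - al\<bar>" ah] l ah pos by auto
  have pow: "1 \<le> C ^ n" "m \<le> n \<Longrightarrow> C ^ m \<le> C ^ n" for m n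
    using C by (auto simp: one_le_power power_increasing)
  define E where "E = p * q * ah' - al'"
  have "\<bar>E\<bar> \<le> \<bar>p * q * ah'\<bar> + \<bar>al'\<bar>" unfolding E_def by (rule abs_triangle_ineq4)
  also have "\<bar>p * q * ah'\<bar> \<le> C\<^sup>2 * C\<^sup>2 * C"
    unfolding abs_mult using p q ah C0 by (intro mult_mono) auto
  also have "C\<^sup>2 * C\<^sup>2 * C = C ^ 5" by algebra
  finally have E1: "\<bar>E\<bar> \<le> 2 * C ^ 5" using al pow(2)[of 1 5] by simp
  have "E = (p - 1) * q * ah' + (q - 1) * ah' + (ah' - al')"
    by (simp add: E_def algebra_simps)
  then have "\<bar>E\<bar> \<le> \<bar>(p - 1) * q * ah'\<bar> + \<bar>(q - 1) * ah'\<bar> + \<bar>ah' - al'\<bar>"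
    by linarith
  also have "\<bar>(p - 1) * q * ah'\<bar> \<le> (\<bar>lh - l\<bar> * C) * C\<^sup>2 * C"
    unfolding abs_mult using p1 q ah C0 by (intro mult_mono) auto
  also have "\<bar>(q - 1) * ah'\<bar> \<le> (\<bar>ah - al\<bar> * C) * C"
    unfolding abs_mult using q1 ah C0 by (intro mult_mono) auto
  also have "(\<bar>lh - l\<bar> * C) * C\<^sup>2 * C = C ^ 4 * \<bar>lh - l\<bar>" by algebra
  also have "(\<bar>ah - al\<bar> * C) * C = C ^ 2 * \<bar>ah - al\<bar>" by algebra
  also have "C ^ 2 * \<bar>ah - al\<bar> \<le> C ^ 4 * \<bar>ah - al\<bar>" by (intro mult_right_mono pow) auto
  also have "\<bar>ah' - al'\<bar> \<le> C ^ 4 * \<bar>ah' - al'\<bar>"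
    using mult_right_mono[OF pow(1)[of 4], of "\<bar>ah' - al'\<bar>"] by simp
  finally have E2: "\<bar>E\<bar> \<le> C ^ 4 * (\<bar>lh - l\<bar> + eA)"
    by (simp add: eA_def algebra_simps)
  have g2: "\<bar>g - gh\<bar> \<le> 2 * C" using g by linarith
  have T1: "\<bar>E * (g - gh)\<bar> \<le> 2 * C ^ 5 * eG"
    unfolding abs_mult eG_def using E1 C0 by (intro mult_mono) auto
  have "\<bar>E * (g - gh)\<bar> \<le> C ^ 4 * (\<bar>lh - l\<bar> + eA) * (2 * C)"
    unfolding abs_mult using E2 g2 C0 by (intro mult_mono) (auto simp: eA_def)
  also have "\<dots> = 2 * C ^ 5 * (\<bar>lh - l\<bar> + eA)" by algebra
  finally have T1': "\<bar>E * (g - gh)\<bar> \<le> 2 * C ^ 5 * (\<bar>lh - l\<bar> + eA)" .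
  define F where "F = (p' - 1) * gh * (al' - ah')"
  have a2: "\<bar>al' - ah'\<bar> \<le> 2 * C" using al ah by linarith
  have C35: "2 * C ^ 3 * e \<le> 2 * C ^ 5 * e" if "0 \<le> e" for e
    using that pow(2)[of 3 5] by (intro mult_right_mono) auto
  have "\<bar>F\<bar> \<le> (\<bar>lh' - l'\<bar> * C) * C * (2 * C)"
    unfolding F_def abs_mult using p1 g a2 C0 by (intro mult_mono) auto
  also have "\<dots> = 2 * C ^ 3 * \<bar>lh' - l'\<bar>" by algebra
  also have "\<dots> \<le> 2 * C ^ 5 * \<bar>lh' - l'\<bar>" by (rule C35) simp
  finally have F1: "\<bar>F\<bar> \<le> 2 * C ^ 5 * \<bar>lh' - l'\<bar>" .
  have "\<bar>p' - 1\<bar> \<le> 2 * C\<^sup>2" using p pow(1)[of 2] by linarith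
  then have "\<bar>F\<bar> \<le> 2 * C\<^sup>2 * C * \<bar>ah' - al'\<bar>"
    unfolding F_def abs_mult using g C0 by (intro mult_mono) auto
  also have "2 * C\<^sup>2 * C * \<bar>ah' - al'\<bar> = 2 * C ^ 3 * \<bar>ah' - al'\<bar>" by algebra
  also have "\<dots> \<le> 2 * C ^ 5 * \<bar>ah' - al'\<bar>" by (rule C35) simp
  finally have F2: "\<bar>F\<bar> \<le> 2 * C ^ 5 * \<bar>ah' - al'\<bar>" .
  have D: "\<bar>D\<bar> \<le> \<bar>E * (g - gh)\<bar> + \<bar>F\<bar>"
    unfolding D_def E_def F_def p_def q_def p'_def by (rule abs_triangle_ineq)
  have "\<bar>D\<bar> \<le> 2 * C ^ 5 * (\<bar>lh - l\<bar> + eA) + 2 * C ^ 5 * \<bar>lh' - l'\<bar>" using D T1' F1 by linarith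
  then show "\<bar>D\<bar> \<le> 2 * C ^ 5 * (eL + eA)" by (simp add: eL_def algebra_simps)
  have nn: "0 \<le> C ^ 5 * \<bar>lh - l\<bar>" "0 \<le> C ^ 5 * \<bar>ah - al\<bar>" using C0 by auto
  have "\<bar>D\<bar> \<le> 2 * C ^ 5 * eG + 2 * C ^ 5 * \<bar>lh' - l'\<bar>" using D T1 F1 by linarith
  then show "\<bar>D\<bar> \<le> 2 * C ^ 5 * (eL + eG)" using nn by (simp add: eL_def algebra_simps)
  have "\<bar>D\<bar> \<le> 2 * C ^ 5 * eG + 2 * C ^ 5 * \<bar>ah' - al'\<bar>" using D T1 F2 by linarith
  then show "\<bar>D\<bar> \<le> 2 * C ^ 5 * (eA + eG)" using nn by (simp add: eA_def algebra_simps)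
qed

context mediation_model
begin

definition "bddQ f \<longleftrightarrow> f \<in> borel_measurable Z \<and> (\<exists>B. \<forall>z\<in>space Q. \<bar>f z\<bar> \<le> (B::real))"

lemma bddQI:
  assumes "f \<in> borel_measurable Z" "\<And>m x. m \<in> space \<nu>M \<Longrightarrow> x \<in> space \<nu>X \<Longrightarrow> \<bar>f (m, x)\<bar> \<le> (B::real)"
  shows "bddQ f"
  using assms unfolding bddQ_def by auto

lemma bddQ_const: "bddQ (\<lambda>_. c)"
  by (rule bddQI[where B="\<bar>c\<bar>"]) auto

lemma bddQ_add: "bddQ f \<Longrightarrow> bddQ g \<Longrightarrow> bddQ (\<lambda>z. f z + g z)"
proof -
  assume "bddQ f" "bddQ g"
  then obtain B B' where "\<forall>z\<in>space Q. \<bar>f z\<bar> \<le> B" "\<forall>z\<in>space Q. \<bar>g z\<bar> \<le> B'"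
    and [measurable]: "f \<in> borel_measurable Z" "g \<in> borel_measurable Z"
    unfolding bddQ_def by auto
  then have "\<bar>f z + g z\<bar> \<le> B + B'" if "z \<in> space Q" for z
    using that abs_triangle_ineq[of "f z" "g z"] by fastforce
  then show ?thesis unfolding bddQ_def by auto
qed

lemma bddQ_mult: "bddQ f \<Longrightarrow> bddQ g \<Longrightarrow> bddQ (\<lambda>z. f z * g z)"
proof -
  assume "bddQ f" "bddQ g"
  then obtain B B' where "\<forall>z\<in>space Q. \<bar>f z\<bar> \<le> B" "\<forall>z\<in>space Q. \<bar>g z\<bar> \<le> B'"
    and [measurable]: "f \<in> borel_measurable Z" "g \<in> borel_measurable Z"
    unfolding bddQ_def by auto
  then have "\<bar>f z * g z\<bar> \<le> \<bar>B\<bar> * \<bar>B'\<bar>" if "z \<in> space Q" for z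
    unfolding abs_mult using that by (intro mult_mono) (auto intro: order_trans[OF _ abs_ge_self])
  then show ?thesis unfolding bddQ_def by auto
qed

lemma bddQ_diff: "bddQ f \<Longrightarrow> bddQ g \<Longrightarrow> bddQ (\<lambda>z. f z - g z)"
  using bddQ_add[of f "\<lambda>z. (- 1) * g z"] bddQ_mult[OF bddQ_const[of "- 1"], of g] by simp

lemma bddQ_abs: "bddQ f \<Longrightarrow> bddQ (\<lambda>z. \<bar>f z\<bar>)"
  unfolding bddQ_def by auto

lemma bddQ_square: "bddQ f \<Longrightarrow> bddQ (\<lambda>z. (f z)\<^sup>2)"
  unfolding power2_eq_square by (rule bddQ_mult)

lemmas bddQ_intros = bddQ_const bddQ_add bddQ_mult bddQ_diff bddQ_abs bddQ_square

lemma bddQ_integrable: "bddQ f \<Longrightarrow> integrable Q f"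
proof -
  assume "bddQ f"
  then obtain B where B: "\<forall>z\<in>space Q. \<bar>f z\<bar> \<le> B" and [measurable]: "f \<in> borel_measurable Z"
    unfolding bddQ_def by blast
  show ?thesis
    by (rule Q.integrable_const_bound[where B=B], rule AE_I2) (use B in \<open>simp_all only: real_norm_def\<close>, measurable)
qed

lemma bddQ_measurable: "bddQ f \<Longrightarrow> f \<in> borel_measurable Z"
  unfolding bddQ_def by simp

lemma bddQ_model:
  assumes t[simp]: "t \<in> \<A>"
  shows "bddQ (\<lambda>z. \<alpha> t (fst z) (snd z))" "bddQ (\<lambda>z. lambda t (snd z))" "bddQ (\<lambda>z. inverse (lambda t (snd z)))"
    "bddQ (\<lambda>z. \<gamma> (snd z) (fst z) t)" "bddQ (\<lambda>z. dens t (fst z) (snd z))"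
proof -
  have [measurable]: "t \<in> space T" by simp
  have inv: "inverse (lambda t x) \<le> C" if "m \<in> space \<nu>M" "x \<in> space \<nu>X" for m x
    using nuisance_pos(2,6)[OF t that] bounds(1) by (simp add: field_simps)
  show "bddQ (\<lambda>z. \<alpha> t (fst z) (snd z))" "bddQ (\<lambda>z. lambda t (snd z))" "bddQ (\<lambda>z. \<gamma> (snd z) (fst z) t)"
    using bounds(2)[OF t] by (auto intro!: bddQI[where B=C])
  show 1: "bddQ (\<lambda>z. inverse (lambda t (snd z)))"
    using inv nuisance_pos(2)[OF t] by (intro bddQI[where B=C]) (auto intro: less_imp_le simp: abs_of_pos)
  show "bddQ (\<lambda>z. dens t (fst z) (snd z))"
    using bddQ_mult[OF \<open>bddQ (\<lambda>z. \<alpha> t (fst z) (snd z))\<close> 1] by (simp add: dens_def divide_inverse)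
qed

lemma integral_Q:
  assumes f: "bddQ f"
  shows "integrable Z (\<lambda>z. fX (snd z) * f z)"
    "(\<integral>z. f z \<partial>Q) = (\<integral>z. fX (snd z) * f z \<partial>Z)"
    "(\<integral>z. f z \<partial>Q) = (\<integral>x. fX x * (\<integral>m. f (m, x) \<partial>\<nu>M) \<partial>\<nu>X)"
proof -
  note bddQ_measurable[OF f, measurable]
  have pos: "AE z in Z. 0 \<le> fX (snd z)"
    by (intro AE_I2 less_imp_le[OF fX_pos]) (auto simp: space_pair_measure)
  show i: "integrable Z (\<lambda>z. fX (snd z) * f z)"
    using bddQ_integrable[OF f] pos unfolding Q_def by (subst (asm) integrable_real_density) simp_all
  show eq: "(\<integral>z. f z \<partial>Q) = (\<integral>z. fX (snd z) * f z \<partial>Z)"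
    using pos unfolding Q_def by (subst integral_real_density) simp_all
  show "(\<integral>z. f z \<partial>Q) = (\<integral>x. fX x * (\<integral>m. f (m, x) \<partial>\<nu>M) \<partial>\<nu>X)"
    unfolding eq using MX.integral_snd[of "\<lambda>m x. fX x * f (m, x)"] i by (simp add: split_beta')
qed

lemma integral_law_X:
  assumes [measurable]: "H \<in> borel_measurable \<nu>X"
  shows "(\<integral>\<omega>. H (X \<omega>) \<partial>P) = (\<integral>x. fX x * H x \<partial>\<nu>X)"
proof -
  have "(\<integral>\<omega>. H (X \<omega>) \<partial>P) = (\<integral>x. H x \<partial>distr P \<nu>X X)"
    by (rule integral_distr[symmetric]) measurable
  also have "AE x in \<nu>X. 0 \<le> fX x" by (intro AE_I2 less_imp_le[OF fX_pos])
  then have "(\<integral>x. H x \<partial>distr P \<nu>X X) = (\<integral>x. fX x * H x \<partial>\<nu>X)"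
    unfolding distr_X by (subst integral_real_density) simp_all
  finally show ?thesis .
qed

lemma integral_\<alpha>:
  assumes "t \<in> \<A>" "x \<in> space \<nu>X"
  shows "(\<integral>m. \<alpha> t m x \<partial>\<nu>M) = 1"
proof -
  have "(\<integral>m. \<alpha> t m x \<partial>\<nu>M) = enn2real (\<integral>\<^sup>+m. ennreal (\<alpha> t m x) \<partial>\<nu>M)"
    using assms by (intro integral_eq_nn_integral AE_I2 less_imp_le[OF nuisance_pos(1)]) auto
  then show ?thesis by (simp add: nn_integral_\<alpha>[OF assms])
qed

lemma integral_Q_marginalize:
  assumes f: "bddQ f" and c: "bddQ (\<lambda>z. c (snd z))" and F: "bddQ (\<lambda>z. F (snd z))"
    and F_def: "\<And>x. x \<in> space \<nu>X \<Longrightarrow> F x = (\<integral>m. f (m, x) \<partial>\<nu>M)" and t: "t \<in> \<A>"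
  shows "(\<integral>z. c (snd z) * (\<alpha> t (fst z) (snd z) * F (snd z)) \<partial>Q) = (\<integral>z. c (snd z) * f z \<partial>Q)"
    "(\<integral>x. fX x * F x \<partial>\<nu>X) = (\<integral>z. f z \<partial>Q)"
proof -
  show "(\<integral>x. fX x * F x \<partial>\<nu>X) = (\<integral>z. f z \<partial>Q)"
    by (subst integral_Q(3)[OF f]) (intro Bochner_Integration.integral_cong refl, simp add: F_def)
  have "(\<integral>z. c (snd z) * (\<alpha> t (fst z) (snd z) * F (snd z)) \<partial>Q)
      = (\<integral>x. fX x * (\<integral>m. c x * (\<alpha> t m x * F x) \<partial>\<nu>M) \<partial>\<nu>X)"
    by (subst integral_Q(3)) (auto intro!: bddQ_intros bddQ_model f c F t)
  also have "\<dots> = (\<integral>x. fX x * (\<integral>m. c x * f (m, x) \<partial>\<nu>M) \<partial>\<nu>X)"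
    using t by (intro Bochner_Integration.integral_cong refl) (simp add: integral_\<alpha> F_def)
  also have "\<dots> = (\<integral>z. c (snd z) * f z \<partial>Q)"
    by (subst integral_Q(3)) (auto intro!: bddQ_intros f c)
  finally show "(\<integral>z. c (snd z) * (\<alpha> t (fst z) (snd z) * F (snd z)) \<partial>Q) = (\<integral>z. c (snd z) * f z \<partial>Q)" .
qed

context
  fixes k :: "real \<Rightarrow> real" and h :: "nat \<Rightarrow> real"
  assumes kernel: "integrable lborel k" "(\<integral>u. k u \<partial>lborel) = 1" "integrable lborel (\<lambda>u. (k u)\<^sup>2)"
    and bandwidth: "\<And>n. 0 < h n" "h \<longlonglongrightarrow> 0"
begin

lemma measurable_kernel[measurable]: "k \<in> borel_measurable borel"
  using borel_measurable_integrable[OF kernel(1)] by simp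

definition "smooth_err s u n =
  (\<integral>z. \<bar>(\<integral>t. prod_kernel k (h n) (t - s) * (dens t (fst z) (snd z) * u t (fst z) (snd z)) \<partial>T)
    - dens s (fst z) (snd z) * u s (fst z) (snd z)\<bar> \<partial>Q)"

lemma smoothed_expectation:
  assumes s: "s \<in> interior \<A>"
    and u[measurable]: "(\<lambda>z. u (fst z) (fst (snd z)) (snd (snd z))) \<in> borel_measurable (T \<Otimes>\<^sub>M Z)"
    and u_le: "\<And>t m x. t \<in> \<A> \<Longrightarrow> m \<in> space \<nu>M \<Longrightarrow> x \<in> space \<nu>X \<Longrightarrow> \<bar>u t m x\<bar> \<le> C"
    and u_cont: "\<And>m x. m \<in> space \<nu>M \<Longrightarrow> x \<in> space \<nu>X \<Longrightarrow> continuous_on (interior \<A>) (\<lambda>t. u t m x)"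
  shows "smooth_err s u \<longlonglongrightarrow> 0"
    and "b \<in> borel_measurable Z \<Longrightarrow> (\<And>z. z \<in> space Q \<Longrightarrow> \<bar>b z\<bar> \<le> B) \<Longrightarrow>
      integrable P (\<lambda>\<omega>. prod_kernel k (h n) (A \<omega> - s) * u (A \<omega>) (M \<omega>) (X \<omega>) * b (M \<omega>, X \<omega>)) \<Longrightarrow>
      \<bar>(\<integral>\<omega>. prod_kernel k (h n) (A \<omega> - s) * u (A \<omega>) (M \<omega>) (X \<omega>) * b (M \<omega>, X \<omega>) \<partial>P)
        - (\<integral>z. dens s (fst z) (snd z) * u s (fst z) (snd z) * b z \<partial>Q)\<bar> \<le> B * smooth_err s u n"
proof -
  define v where "v t m x = dens t m x * u t m x" for t m x
  define R where "R n z = (\<integral>t. prod_kernel k (h n) (t - s) * v t (fst z) (snd z) \<partial>T)" for n z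
  have sA: "s \<in> \<A>" using s interior_subset by auto
  have v_le: "\<bar>v t m x\<bar> \<le> C\<^sup>2 * C" if "t \<in> \<A>" "m \<in> space \<nu>M" "x \<in> space \<nu>X" for t m x
    unfolding v_def abs_mult using dens_bounds(1,2)[OF that] u_le[OF that] by (intro mult_mono) auto
  have v_meas: "(\<lambda>z. v (fst z) (fst (snd z)) (snd (snd z))) \<in> borel_measurable (T \<Otimes>\<^sub>M Z)"
    unfolding v_def by measurable
  have v_cont: "continuous_on (interior \<A>) (\<lambda>t. v t m x)" if "m \<in> space \<nu>M" "x \<in> space \<nu>X" for m x
    unfolding v_def using that by (intro continuous_on_mult continuous_dens u_cont)
  note sm = kernel_smoothing[OF kernel(1,2) bandwidth s v_meas v_le v_cont, folded R_def]
  have err: "smooth_err s u n = (\<integral>z. \<bar>R n z - v s (fst z) (snd z)\<bar> \<partial>Q)" for n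
    by (simp add: smooth_err_def R_def v_def)
  show "smooth_err s u \<longlonglongrightarrow> 0"
    unfolding err[abs_def] using sm(3) by simp
  assume b[measurable]: "b \<in> borel_measurable Z" and b_le: "\<And>z. z \<in> space Q \<Longrightarrow> \<bar>b z\<bar> \<le> B"
    and int: "integrable P (\<lambda>\<omega>. prod_kernel k (h n) (A \<omega> - s) * u (A \<omega>) (M \<omega>) (X \<omega>) * b (M \<omega>, X \<omega>))"
  let ?E = "\<integral>\<omega>. prod_kernel k (h n) (A \<omega> - s) * u (A \<omega>) (M \<omega>) (X \<omega>) * b (M \<omega>, X \<omega>) \<partial>P"
    and ?F = "\<integral>z. dens s (fst z) (snd z) * u s (fst z) (snd z) * b z \<partial>Q"
  have R: "integrable Q (R n)" using sm(2) by simp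
  have vs: "bddQ (\<lambda>z. v s (fst z) (snd z))"
    using measurable_compose[OF measurable_Pair1'[of s] v_meas] sA v_le by (intro bddQI) auto
  have bQ: "bddQ b" using b b_le by (auto simp: bddQ_def)
  have bR: "integrable Q (\<lambda>z. b z * g z)" if g: "integrable Q g" for g
    by (subst mult.commute, rule integrable_mult_bounded[OF g _ b_le]) measurable
  have "?E = (\<integral>z. \<integral>t. dens t (fst z) (snd z) * (prod_kernel k (h n) (t - s) * u t (fst z) (snd z) * b z) \<partial>T \<partial>Q)"
    using integral_law_AMX[of "\<lambda>z. prod_kernel k (h n) (fst z - s) * u (fst z) (fst (snd z)) (snd (snd z)) * b (snd z)"] int
    by simp
  also have "\<dots> = (\<integral>z. b z * R n z \<partial>Q)"
  proof (intro Bochner_Integration.integral_cong refl)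
    fix z
    have "(\<integral>t. dens t (fst z) (snd z) * (prod_kernel k (h n) (t - s) * u t (fst z) (snd z) * b z) \<partial>T)
      = (\<integral>t. b z * (prod_kernel k (h n) (t - s) * v t (fst z) (snd z)) \<partial>T)"
      by (simp add: v_def ac_simps)
    then show "(\<integral>t. dens t (fst z) (snd z) * (prod_kernel k (h n) (t - s) * u t (fst z) (snd z) * b z) \<partial>T) = b z * R n z"
      by (simp add: R_def)
  qed
  finally have "?E - ?F = (\<integral>z. b z * R n z \<partial>Q) - (\<integral>z. b z * v s (fst z) (snd z) \<partial>Q)"
    by (simp add: v_def ac_simps)
  also have "\<dots> = (\<integral>z. b z * (R n z - v s (fst z) (snd z)) \<partial>Q)"
    using bR[OF R] bR[OF bddQ_integrable[OF vs]] by (simp add: right_diff_distrib)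
  also have "\<bar>\<dots>\<bar> \<le> (\<integral>z. \<bar>b z * (R n z - v s (fst z) (snd z))\<bar> \<partial>Q)"
    by (rule integral_abs_bound)
  also have "\<dots> \<le> (\<integral>z. B * \<bar>R n z - v s (fst z) (snd z)\<bar> \<partial>Q)"
    using R bddQ_integrable[OF vs] b_le
    by (intro integral_mono integrable_abs bR integrable_mult_right Bochner_Integration.integrable_diff)
      (auto simp: abs_mult intro!: mult_right_mono)
  finally show "\<bar>?E - ?F\<bar> \<le> B * smooth_err s u n"
    by (simp add: err)
qed

end

\<comment> \<open>outside its context this rule would apply to every real function\<close>
declare measurable_kernel[measurable del]

end

context mediation_model
begin

definition "admissible al la ga \<longleftrightarrow>
  (\<forall>t\<in>{a, a'}. (\<lambda>z. al t (fst z) (snd z)) \<in> borel_measurable Z \<and> la t \<in> borel_measurable \<nu>X) \<and>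
  (\<lambda>z. ga (snd z) (fst z) a) \<in> borel_measurable Z \<and>
  (\<forall>t\<in>{a, a'}. \<forall>m\<in>space \<nu>M. \<forall>x\<in>space \<nu>X.
    \<bar>al t m x\<bar> \<le> C \<and> \<bar>la t x\<bar> \<le> C \<and> \<bar>ga x m a\<bar> \<le> C \<and> 1 / C \<le> \<bar>al t m x\<bar>)"

definition "err_lambda la =
  (\<integral>x. (la a x - lambda a x)\<^sup>2 * fX x \<partial>\<nu>X) + (\<integral>x. (la a' x - lambda a' x)\<^sup>2 * fX x \<partial>\<nu>X)"

definition "err_alpha al =
  (\<integral>(m, x). (al a m x - \<alpha> a m x)\<^sup>2 * fMX m x \<partial>Z)
  + (\<integral>(m, x). (al a' m x - \<alpha> a' m x)\<^sup>2 * fMX m x \<partial>Z)"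

definition "err_gamma ga = (\<integral>(m, x). (ga x m a - \<gamma> x m a)\<^sup>2 * fMX m x \<partial>Z)"

lemma measure_Q: "measure Q (space Q) \<le> C"
  using emeasure_mediator(1) bounds(1) emeasure_Q by (simp add: measure_def enn2real_leI)

lemma integral_Q_le_fMX:
  assumes f: "bddQ f" and pos: "\<And>z. z \<in> space Q \<Longrightarrow> 0 \<le> f z"
  shows "(\<integral>z. f z \<partial>Q) \<le> C\<^sup>2 / measure T \<A> * (\<integral>(m, x). f (m, x) * fMX m x \<partial>Z)"
proof -
  let ?l = "measure T \<A>"
  note bddQ_measurable[OF f, measurable]
  have l: "0 < ?l" "0 < C\<^sup>2" using measure_treatment(1) bounds(1) by auto
  have le: "fX x * f (m, x) \<le> C\<^sup>2 / ?l * (f (m, x) * fMX m x)" "\<bar>f (m, x) * fMX m x\<bar> \<le> ?l * C\<^sup>2 * (fX x * f (m, x))"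
    if z: "m \<in> space \<nu>M" "x \<in> space \<nu>X" for m x
  proof -
    have f0: "0 \<le> f (m, x)" using pos z by simp
    have "fX x \<le> C\<^sup>2 / ?l * fMX m x"
      using marginal_density_bounds(1)[OF z] l by (simp add: field_simps)
    from mult_right_mono[OF this f0] show "fX x * f (m, x) \<le> C\<^sup>2 / ?l * (f (m, x) * fMX m x)"
      by (simp add: ac_simps)
    have "0 \<le> fX x * (?l / C\<^sup>2)" using fX_pos[OF z(2)] l by simp
    then have "0 \<le> fMX m x" using marginal_density_bounds(1)[OF z] by linarith
    with mult_right_mono[OF marginal_density_bounds(2)[OF z] f0] f0
    show "\<bar>f (m, x) * fMX m x\<bar> \<le> ?l * C\<^sup>2 * (fX x * f (m, x))"
      by (simp add: ac_simps)
  qed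
  have i: "integrable Z (\<lambda>z. f z * fMX (fst z) (snd z))"
  proof (rule Bochner_Integration.integrable_bound)
    show "integrable Z (\<lambda>z. ?l * C\<^sup>2 * (fX (snd z) * f z))"
      using integral_Q(1)[OF f] by simp
    show "AE z in Z. norm (f z * fMX (fst z) (snd z)) \<le> norm (?l * C\<^sup>2 * (fX (snd z) * f z))"
      using le(2) by (intro AE_I2) (force simp: space_pair_measure intro: order_trans[OF _ abs_ge_self])
  qed measurable
  have "(\<integral>z. f z \<partial>Q) \<le> (\<integral>z. C\<^sup>2 / ?l * (f z * fMX (fst z) (snd z)) \<partial>Z)"
    unfolding integral_Q(2)[OF f]
    using le(1) by (intro integral_mono integral_Q(1)[OF f] integrable_mult_right i) (auto simp: space_pair_measure)
  then show ?thesis by (simp add: split_beta')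
qed

lemma integral_Q_covariate:
  assumes f: "bddQ (\<lambda>z. f (snd z))" and [measurable]: "f \<in> borel_measurable \<nu>X" and pos: "\<And>x. x \<in> space \<nu>X \<Longrightarrow> 0 \<le> f x"
  shows "(\<integral>z. f (snd z) \<partial>Q) \<le> C * (\<integral>x. f x * fX x \<partial>\<nu>X)"
proof -
  have "(\<integral>z. f (snd z) \<partial>Q) = measure \<nu>M (space \<nu>M) * (\<integral>x. f x * fX x \<partial>\<nu>X)"
    by (subst integral_Q(3)[OF f], subst integral_mult_right_zero[symmetric])
      (intro Bochner_Integration.integral_cong refl, simp)
  also have "\<dots> \<le> C * (\<integral>x. f x * fX x \<partial>\<nu>X)"
    using emeasure_mediator(1) bounds(1)
    by (intro mult_right_mono integral_nonneg_AE AE_I2 mult_nonneg_nonneg pos less_imp_le[OF fX_pos])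
      (auto simp: measure_def enn2real_leI)
  finally show ?thesis .
qed

lemma fMX_nonneg: "m \<in> space \<nu>M \<Longrightarrow> x \<in> space \<nu>X \<Longrightarrow> 0 \<le> fMX m x"
  unfolding marginals(2) by (intro integral_nonneg_AE AE_I2 joint_density) auto

lemma err_nonneg: "0 \<le> err_lambda la" "0 \<le> err_alpha al" "0 \<le> err_gamma ga"
  unfolding err_lambda_def err_alpha_def err_gamma_def
  by (intro add_nonneg_nonneg integral_nonneg_AE AE_I2;
    auto simp: space_pair_measure fMX_nonneg less_imp_le[OF fX_pos])+

context
  fixes al :: "real^'d \<Rightarrow> 'm \<Rightarrow> 'x \<Rightarrow> real" and la :: "real^'d \<Rightarrow> 'x \<Rightarrow> real" and ga :: "'x \<Rightarrow> 'm \<Rightarrow> real^'d \<Rightarrow> real"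
  assumes adm: "admissible al la ga"
begin

lemma admissible_bounds:
  assumes "m \<in> space \<nu>M" "x \<in> space \<nu>X" "t = a \<or> t = a'"
  shows "\<bar>al t m x\<bar> \<le> C" "\<bar>la t x\<bar> \<le> C" "\<bar>ga x m a\<bar> \<le> C" "1 / C \<le> \<bar>al t m x\<bar>"
  using adm assms unfolding admissible_def by auto

lemma admissible_measurable[measurable]:
  "(\<lambda>z. al a (fst z) (snd z)) \<in> borel_measurable Z" "(\<lambda>z. al a' (fst z) (snd z)) \<in> borel_measurable Z"
  "la a \<in> borel_measurable \<nu>X" "la a' \<in> borel_measurable \<nu>X"
  "(\<lambda>z. ga (snd z) (fst z) a) \<in> borel_measurable Z"
  using adm unfolding admissible_def by auto

abbreviation "eta_hat \<equiv> eta_of \<nu>M al ga a a'"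

lemma measurable_eta_hat[measurable]: "eta_hat \<in> borel_measurable \<nu>X"
proof -
  have "(\<lambda>z. ga (fst z) (snd z) a) \<in> borel_measurable (\<nu>X \<Otimes>\<^sub>M \<nu>M)" "(\<lambda>z. al a' (snd z) (fst z)) \<in> borel_measurable (\<nu>X \<Otimes>\<^sub>M \<nu>M)"
    using measurable_compose[OF measurable_pair_swap' admissible_measurable(5)]
      measurable_compose[OF measurable_pair_swap' admissible_measurable(2)] by (auto simp: split_beta)
  then show ?thesis
    unfolding eta_of_def[abs_def] by (intro M.borel_measurable_lebesgue_integral) (simp add: split_beta')
qed

lemma eta_hat_le: "x \<in> space \<nu>X \<Longrightarrow> \<bar>eta_hat x\<bar> \<le> C ^ 3"
proof -
  assume x: "x \<in> space \<nu>X"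
  have C: "0 \<le> C" using bounds(1) by simp
  have le: "\<bar>ga x m a * al a' m x\<bar> \<le> C * C" if "m \<in> space \<nu>M" for m
    unfolding abs_mult using admissible_bounds[OF that x, of a'] C by (intro mult_mono) auto
  have "(\<lambda>m. ga x m a) \<in> borel_measurable \<nu>M" "(\<lambda>m. al a' m x) \<in> borel_measurable \<nu>M"
    using measurable_compose[OF measurable_Pair2'[OF x] admissible_measurable(5)]
      measurable_compose[OF measurable_Pair2'[OF x] admissible_measurable(2)] by auto
  then have i: "integrable \<nu>M (\<lambda>m. ga x m a * al a' m x)"
    using le by (intro M.integrable_const_bound[where B="C * C"] AE_I2) auto
  have "\<bar>eta_hat x\<bar> \<le> (\<integral>m. \<bar>ga x m a * al a' m x\<bar> \<partial>\<nu>M)"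
    unfolding eta_of_def by (rule integral_abs_bound)
  also have "\<dots> \<le> (\<integral>m. C * C \<partial>\<nu>M)"
    using i le by (intro integral_mono) auto
  also have "\<dots> = C * C * measure \<nu>M (space \<nu>M)" by simp
  also have "\<dots> \<le> C * C * C"
    using C measure_Q emeasure_Q by (intro mult_left_mono) (auto simp: measure_def simp del: space_Q)
  finally show ?thesis by (simp add: power3_eq_cube)
qed

lemma admissible_bddQ:
  "bddQ (\<lambda>z. al a (fst z) (snd z))" "bddQ (\<lambda>z. al a' (fst z) (snd z))" "bddQ (\<lambda>z. la a (snd z))" "bddQ (\<lambda>z. la a' (snd z))"
  "bddQ (\<lambda>z. ga (snd z) (fst z) a)" "bddQ (\<lambda>z. inverse (al a (fst z) (snd z)))" "bddQ (\<lambda>z. eta_hat (snd z))"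
proof -
  show "bddQ (\<lambda>z. al a (fst z) (snd z))" "bddQ (\<lambda>z. al a' (fst z) (snd z))" "bddQ (\<lambda>z. la a (snd z))" "bddQ (\<lambda>z. la a' (snd z))"
    "bddQ (\<lambda>z. ga (snd z) (fst z) a)"
    using admissible_bounds(1,2) admissible_bounds(3)[where t=a] by (auto intro!: bddQI[where B=C])
  have "inverse \<bar>al a m x\<bar> \<le> C" if "m \<in> space \<nu>M" "x \<in> space \<nu>X" for m x
    using le_imp_inverse_le[OF admissible_bounds(4)[OF that, of a]] bounds(1) by (simp add: inverse_eq_divide)
  then show "bddQ (\<lambda>z. inverse (al a (fst z) (snd z)))"
    by (auto intro!: bddQI[where B=C])
  show "bddQ (\<lambda>z. eta_hat (snd z))"
    using eta_hat_le by (auto intro!: bddQI[where B="C ^ 3"])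
qed

abbreviation "wgt z \<equiv> la a (snd z) * (al a' (fst z) (snd z) / al a (fst z) (snd z))"
abbreviation "drift z \<equiv>
  ((la a (snd z) / lambda a (snd z)) * (\<alpha> a (fst z) (snd z) / al a (fst z) (snd z)) * al a' (fst z) (snd z) - \<alpha> a' (fst z) (snd z))
    * (\<gamma> (snd z) (fst z) a - ga (snd z) (fst z) a)
  + (la a' (snd z) / lambda a' (snd z) - 1) * ga (snd z) (fst z) a * (\<alpha> a' (fst z) (snd z) - al a' (fst z) (snd z))"

lemmas bddQ_all = bddQ_intros admissible_bddQ bddQ_model[OF target_in(1)] bddQ_model[OF target_in(2)]

lemma bddQ_drift: "bddQ drift" and bddQ_wgt: "bddQ wgt"
  by (auto simp: divide_inverse intro!: bddQ_all)

lemma limit_mean: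
  "(\<integral>z. dens a (fst z) (snd z) * \<gamma> (snd z) (fst z) a * wgt z \<partial>Q)
    - (\<integral>z. dens a (fst z) (snd z) * 1 * (wgt z * ga (snd z) (fst z) a) \<partial>Q)
    + (\<integral>z. dens a' (fst z) (snd z) * 1 * (la a' (snd z) * (ga (snd z) (fst z) a - eta_hat (snd z))) \<partial>Q)
    + (\<integral>x. fX x * eta_hat x \<partial>\<nu>X) - (\<integral>z. \<gamma> (snd z) (fst z) a * \<alpha> a' (fst z) (snd z) \<partial>Q)
    = (\<integral>z. drift z \<partial>Q)"
proof -
  let ?A = "\<lambda>z. dens a (fst z) (snd z) * \<gamma> (snd z) (fst z) a * wgt z"
    and ?B = "\<lambda>z. dens a (fst z) (snd z) * 1 * (wgt z * ga (snd z) (fst z) a)"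
    and ?C = "\<lambda>z. dens a' (fst z) (snd z) * 1 * (la a' (snd z) * (ga (snd z) (fst z) a - eta_hat (snd z)))"
    and ?D = "\<lambda>z. dens a' (fst z) (snd z) * (la a' (snd z) * ga (snd z) (fst z) a)"
    and ?G = "\<lambda>z. \<gamma> (snd z) (fst z) a * \<alpha> a' (fst z) (snd z)"
    and ?H = "\<lambda>z. \<alpha> a' (fst z) (snd z) * eta_hat (snd z)"
  let ?f = "\<lambda>z. ga (snd z) (fst z) a * al a' (fst z) (snd z)"
  let ?c = "\<lambda>x. la a' x / lambda a' x"
  note I = bddQ_integrable
  have f: "bddQ ?f" and c: "bddQ (\<lambda>z. ?c (snd z))"
    by (auto simp: divide_inverse intro!: bddQ_all)
  note marg = integral_Q_marginalize[OF f c admissible_bddQ(7) _ target_in(2)]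
  have eta: "(\<integral>x. fX x * eta_hat x \<partial>\<nu>X) = (\<integral>z. ?f z \<partial>Q)"
    by (rule marg(2)) (simp add: eta_of_def)
  have "(\<integral>z. ?C z \<partial>Q)
      = (\<integral>z. ?D z
          - ?c (snd z) * (?H z) \<partial>Q)"
    by (intro Bochner_Integration.integral_cong refl) (simp add: dens_def divide_inverse algebra_simps)
  also have "\<dots> = (\<integral>z. ?D z \<partial>Q)
      - (\<integral>z. ?c (snd z) * (?H z) \<partial>Q)"
    by (intro Bochner_Integration.integral_diff I bddQ_all c)
  also have "(\<integral>z. ?c (snd z) * (?H z) \<partial>Q) = (\<integral>z. ?c (snd z) * ?f z \<partial>Q)"
    by (rule marg(1)) (simp add: eta_of_def)
  finally have second: "(\<integral>z. ?C z \<partial>Q)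
      = (\<integral>z. ?D z \<partial>Q) - (\<integral>z. ?c (snd z) * ?f z \<partial>Q)" .
  have "(\<integral>z. drift z \<partial>Q) = (\<integral>z. ?A z
      - ?B z
      + ?D z - ?c (snd z) * ?f z + ?f z
      - ?G z \<partial>Q)"
  proof (intro Bochner_Integration.integral_cong refl)
    fix z assume "z \<in> space Q"
    then have z: "fst z \<in> space \<nu>M" "snd z \<in> space \<nu>X" by auto
    have "lambda a (snd z) \<noteq> 0" "lambda a' (snd z) \<noteq> 0"
      using nuisance_pos(2)[OF target_in(1) z] nuisance_pos(2)[OF target_in(2) z] by auto
    moreover have "al a (fst z) (snd z) \<noteq> 0"
      using admissible_bounds(4)[OF z, of a] bounds(1) by (auto simp: field_simps)
    ultimately show "drift z = ?A z
      - ?B z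
      + ?D z - ?c (snd z) * ?f z + ?f z
      - ?G z"
      unfolding dens_def by (subst drift_decomposition[symmetric]) simp_all
  qed
  also have "\<dots> = (\<integral>z. ?A z \<partial>Q)
    - (\<integral>z. ?B z \<partial>Q)
    + (\<integral>z. ?D z \<partial>Q)
    - (\<integral>z. ?c (snd z) * ?f z \<partial>Q) + (\<integral>z. ?f z \<partial>Q) - (\<integral>z. ?G z \<partial>Q)"
    by (simp only: Bochner_Integration.integral_diff Bochner_Integration.integral_add
        Bochner_Integration.integrable_diff Bochner_Integration.integrable_add I bddQ_all c bddQ_wgt)
  finally show ?thesis using second eta by simp
qed

text \<open>
  The truncation \<open>\<bar>u\<bar> \<le> \<delta> + u\<^sup>2 / \<delta>\<close> turns mean square errors into \<open>L\<^sup>1\<close> errors; it takes the place of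
  the Cauchy--Schwarz inequality and keeps the bound linear in the mean square errors.
\<close>

lemma drift_integral_le:
  assumes \<delta>: "0 < \<delta>"
  defines "K \<equiv> 2 * C ^ 5 * (4 * C + C + C\<^sup>2 / measure T \<A>)"
  shows "\<bar>\<integral>z. drift z \<partial>Q\<bar> \<le> K * \<delta> + K / \<delta> * (err_lambda la + err_alpha al)" (is ?LA)
    "\<bar>\<integral>z. drift z \<partial>Q\<bar> \<le> K * \<delta> + K / \<delta> * (err_lambda la + err_gamma ga)" (is ?LG)
    "\<bar>\<integral>z. drift z \<partial>Q\<bar> \<le> K * \<delta> + K / \<delta> * (err_alpha al + err_gamma ga)" (is ?AG)
proof -
  define c where "c = C + C\<^sup>2 / measure T \<A>"
  have C: "1 \<le> C" by (rule bounds)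
  have c: "C \<le> c" "C\<^sup>2 / measure T \<A> \<le> c" using C by (auto simp: c_def)
  have abs_le: "(\<integral>z. \<bar>f z\<bar> \<partial>Q) \<le> C * \<delta> + 1 / \<delta> * (\<integral>z. (f z)\<^sup>2 \<partial>Q)" if f: "bddQ f" for f
  proof -
    have "(\<integral>z. \<bar>f z\<bar> \<partial>Q) \<le> (\<integral>z. \<delta> + (f z)\<^sup>2 / \<delta> \<partial>Q)"
      using f abs_le_add_square_div[OF \<delta>] unfolding divide_inverse
      by (intro integral_mono bddQ_integrable bddQ_intros) (auto simp: divide_inverse)
    also have "\<dots> = (\<integral>z. \<delta> \<partial>Q) + (\<integral>z. (f z)\<^sup>2 / \<delta> \<partial>Q)"
      using f unfolding divide_inverse
      by (intro Bochner_Integration.integral_add bddQ_integrable bddQ_intros)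
    also have "(\<integral>z. \<delta> \<partial>Q) \<le> C * \<delta>"
      using measure_Q \<delta> by (simp del: space_Q)
    finally show ?thesis by simp
  qed
  have L: "(\<integral>z. \<bar>la t (snd z) - lambda t (snd z)\<bar> \<partial>Q) \<le> C * \<delta> + c / \<delta> * (\<integral>x. (la t x - lambda t x)\<^sup>2 * fX x \<partial>\<nu>X)"
    (is "?l \<le> _ + _ * ?r") if t: "t = a \<or> t = a'" for t
  proof -
    let ?q = "\<integral>z. (la t (snd z) - lambda t (snd z))\<^sup>2 \<partial>Q"
    have b: "bddQ (\<lambda>z. la t (snd z) - lambda t (snd z))" and [measurable]: "la t \<in> borel_measurable \<nu>X" and tA: "t \<in> \<A>"
      using t by (auto intro!: bddQ_all)
    have "?q \<le> C * ?r"
      using tA by (intro integral_Q_covariate bddQ_square b) auto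
    also have "\<dots> \<le> c * ?r"
      by (intro mult_right_mono c integral_nonneg_AE AE_I2 mult_nonneg_nonneg less_imp_le[OF fX_pos]) auto
    finally have "1 / \<delta> * ?q
        \<le> 1 / \<delta> * (c * ?r)"
      using \<delta> by (intro mult_left_mono) auto
    with abs_le[OF b] show ?thesis by simp
  qed
  have MX: "(\<integral>z. \<bar>f z\<bar> \<partial>Q) \<le> C * \<delta> + c / \<delta> * (\<integral>(m, x). (f (m, x))\<^sup>2 * fMX m x \<partial>Z)"
    (is "_ \<le> _ + _ * ?r") if f: "bddQ f" for f
  proof -
    have "(\<integral>z. (f z)\<^sup>2 \<partial>Q) \<le> C\<^sup>2 / measure T \<A> * ?r"
      using f by (intro integral_Q_le_fMX bddQ_square) auto
    also have "\<dots> \<le> c * ?r"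
      by (intro mult_right_mono c integral_nonneg_AE AE_I2) (auto simp: space_pair_measure fMX_nonneg)
    finally have "1 / \<delta> * (\<integral>z. (f z)\<^sup>2 \<partial>Q) \<le> 1 / \<delta> * (c * ?r)"
      using \<delta> by (intro mult_left_mono) auto
    with abs_le[OF f] show ?thesis by simp
  qed
  define eL eA eG where "eL z = \<bar>la a (snd z) - lambda a (snd z)\<bar> + \<bar>la a' (snd z) - lambda a' (snd z)\<bar>"
    and "eA z = \<bar>al a (fst z) (snd z) - \<alpha> a (fst z) (snd z)\<bar> + \<bar>al a' (fst z) (snd z) - \<alpha> a' (fst z) (snd z)\<bar>"
    and "eG z = \<bar>ga (snd z) (fst z) a - \<gamma> (snd z) (fst z) a\<bar>" for z :: "'m \<times> 'x"
  have e_bdd: "bddQ eL" "bddQ eA" "bddQ eG"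
    unfolding eL_def eA_def eG_def by (intro bddQ_all)+
  have sum2: "(\<integral>z. \<bar>f z\<bar> + \<bar>g z\<bar> \<partial>Q) = (\<integral>z. \<bar>f z\<bar> \<partial>Q) + (\<integral>z. \<bar>g z\<bar> \<partial>Q)" if "bddQ f" "bddQ g" for f g
    using that by (intro Bochner_Integration.integral_add bddQ_integrable bddQ_abs)
  have eL: "(\<integral>z. eL z \<partial>Q) \<le> 2 * C * \<delta> + c / \<delta> * err_lambda la"
    unfolding eL_def using L[of a] L[of a'] by (subst sum2) (auto intro!: bddQ_all simp: err_lambda_def distrib_left)
  have eA: "(\<integral>z. eA z \<partial>Q) \<le> 2 * C * \<delta> + c / \<delta> * err_alpha al"
    unfolding eA_def
    using MX[of "\<lambda>z. al a (fst z) (snd z) - \<alpha> a (fst z) (snd z)"] MX[of "\<lambda>z. al a' (fst z) (snd z) - \<alpha> a' (fst z) (snd z)"]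
    by (subst sum2) (auto intro!: bddQ_all simp: err_alpha_def distrib_left bddQ_all)
  have eG: "(\<integral>z. eG z \<partial>Q) \<le> 2 * C * \<delta> + c / \<delta> * err_gamma ga"
  proof -
    have "(\<integral>z. eG z \<partial>Q) \<le> C * \<delta> + c / \<delta> * err_gamma ga"
      unfolding eG_def using MX[of "\<lambda>z. ga (snd z) (fst z) a - \<gamma> (snd z) (fst z) a"]
      by (auto simp: err_gamma_def bddQ_all)
    moreover have "0 \<le> C * \<delta>" using C \<delta> by simp
    ultimately show ?thesis by simp
  qed
  have final: "\<bar>\<integral>z. drift z \<partial>Q\<bar> \<le> K * \<delta> + K / \<delta> * (v + w)"
    if pw: "\<And>z. z \<in> space Q \<Longrightarrow> \<bar>drift z\<bar> \<le> 2 * C ^ 5 * (f z + g z)" and fg: "bddQ f" "bddQ g"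
      and f: "(\<integral>z. f z \<partial>Q) \<le> 2 * C * \<delta> + c / \<delta> * v" and g: "(\<integral>z. g z \<partial>Q) \<le> 2 * C * \<delta> + c / \<delta> * w"
      and vw: "0 \<le> v" "0 \<le> w" for f g v w
  proof -
    have "\<bar>\<integral>z. drift z \<partial>Q\<bar> \<le> (\<integral>z. \<bar>drift z\<bar> \<partial>Q)" by (rule integral_abs_bound)
    also have "\<dots> \<le> (\<integral>z. 2 * C ^ 5 * (f z + g z) \<partial>Q)"
      using pw by (intro integral_mono bddQ_integrable bddQ_intros bddQ_drift fg) simp
    also have "\<dots> = 2 * C ^ 5 * ((\<integral>z. f z \<partial>Q) + (\<integral>z. g z \<partial>Q))"
      using fg by (simp add: bddQ_integrable)
    also have "\<dots> \<le> 2 * C ^ 5 * ((2 * C * \<delta> + c / \<delta> * v) + (2 * C * \<delta> + c / \<delta> * w))"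
      using C f g by (intro mult_left_mono add_mono) auto
    also have "\<dots> = 2 * C ^ 5 * (4 * C * \<delta> + c / \<delta> * (v + w))"
      by (simp add: algebra_simps add_divide_distrib)
    also have "\<dots> \<le> 2 * C ^ 5 * ((4 * C + c) * \<delta> + (4 * C + c) / \<delta> * (v + w))"
    proof (intro mult_left_mono add_mono mult_right_mono divide_right_mono)
    qed (use C c \<delta> vw in auto)
    also have "\<dots> = K * \<delta> + K / \<delta> * (v + w)"
      by (simp add: K_def c_def algebra_simps)
    finally show ?thesis .
  qed
  have pw: "\<bar>drift z\<bar> \<le> 2 * C ^ 5 * (eL z + eA z)" (is ?A) "\<bar>drift z\<bar> \<le> 2 * C ^ 5 * (eL z + eG z)" (is ?B)
    "\<bar>drift z\<bar> \<le> 2 * C ^ 5 * (eA z + eG z)" (is ?D) if "z \<in> space Q" for z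
  proof -
    have z: "fst z \<in> space \<nu>M" "snd z \<in> space \<nu>X" using that by auto
    note t = disjI1[OF refl] and t' = disjI2[OF refl] and b = bounds(2)[OF target_in(1) z] and b' = bounds(2)[OF target_in(2) z]
    note drift_bounds[OF C nuisance_pos(6)[OF target_in(1) z] nuisance_pos(6)[OF target_in(2) z]
      admissible_bounds(2)[OF z t] admissible_bounds(2)[OF z t'] b[THEN conjunct1] b'[THEN conjunct1]
      admissible_bounds(4)[OF z t] admissible_bounds(1)[OF z t']
      b[THEN conjunct2, THEN conjunct2, THEN conjunct1] admissible_bounds(3)[OF z t]]
    then show ?A ?B ?D
      unfolding eL_def eA_def eG_def by -
  qed
  show ?LA ?LG ?AG
    by (rule final[OF pw(1) e_bdd(1,2) eL eA err_nonneg(1,2)], assumption)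
      (rule final[OF pw(2) e_bdd(1,3) eL eG err_nonneg(1,3)], assumption,
       rule final[OF pw(3) e_bdd(2,3) eA eG err_nonneg(2,3)], assumption)
qed

end

declare admissible_measurable[measurable del] measurable_eta_hat[measurable del]

end

section \<open>Mean and second moment of the moment function\<close>

lemma square_sum4_le:
  fixes p q r s :: real
  shows "(p + q + r + s)\<^sup>2 \<le> 4 * (p\<^sup>2 + q\<^sup>2 + r\<^sup>2 + s\<^sup>2)"
proof -
  have "0 \<le> (p - q)\<^sup>2 + (p - r)\<^sup>2 + (p - s)\<^sup>2 + (q - r)\<^sup>2 + (q - s)\<^sup>2 + (r - s)\<^sup>2" by simp
  then show ?thesis by (simp add: power2_eq_square algebra_simps)
qed

context mediation_model
begin

context
  fixes k :: "real \<Rightarrow> real" and h :: "nat \<Rightarrow> real"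
  assumes kernel: "integrable lborel k" "(\<integral>u. k u \<partial>lborel) = 1" "integrable lborel (\<lambda>u. (k u)\<^sup>2)"
    and bandwidth: "\<And>n. 0 < h n" "h \<longlonglongrightarrow> 0"
begin

lemma measurable_k[measurable]: "k \<in> borel_measurable borel"
  using borel_measurable_integrable[OF kernel(1)] by simp

definition "bias n = C ^ 3 * smooth_err k h a (\<lambda>t m x. \<gamma> x m t) n
  + 2 * C ^ 4 * smooth_err k h a (\<lambda>_ _ _. 1) n + 2 * C ^ 4 * smooth_err k h a' (\<lambda>_ _ _. 1) n"

lemma smoothing_instances:
  "smooth_err k h a (\<lambda>t m x. \<gamma> x m t) \<longlonglongrightarrow> 0"
  "s \<in> interior \<A> \<Longrightarrow> smooth_err k h s (\<lambda>_ _ _. 1) \<longlonglongrightarrow> 0"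
  using bounds continuous(2) target
  by (auto intro!: smoothed_expectation(1)[OF kernel bandwidth])

lemma bias_tendsto_0: "bias \<longlonglongrightarrow> 0"
proof -
  have "bias \<longlonglongrightarrow> C ^ 3 * 0 + 2 * C ^ 4 * 0 + 2 * C ^ 4 * 0"
    unfolding bias_def[abs_def] using target by (intro tendsto_intros smoothing_instances)
  then show ?thesis by simp
qed

context
  fixes al :: "real^'d \<Rightarrow> 'm \<Rightarrow> 'x \<Rightarrow> real" and la :: "real^'d \<Rightarrow> 'x \<Rightarrow> real" and ga :: "'x \<Rightarrow> 'm \<Rightarrow> real^'d \<Rightarrow> real"
  assumes adm: "admissible al la ga"
begin

private abbreviation "eta \<equiv> eta_of \<nu>M al ga a a'"
private abbreviation "W \<omega> \<equiv> (M \<omega>, X \<omega>)"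
private abbreviation "cond_mean \<omega> \<equiv> \<gamma> (X \<omega>) (M \<omega>) (A \<omega>)"
private abbreviation "K s n \<omega> \<equiv> prod_kernel k (h n) (A \<omega> - s)"
private definition "b1 z = la a (snd z) * (al a' (fst z) (snd z) / al a (fst z) (snd z))"
private definition "b2 z = b1 z * ga (snd z) (fst z) a"
private definition "b3 z = la a' (snd z) * (ga (snd z) (fst z) a - eta (snd z))"
private abbreviation "obs_moment n \<omega> \<equiv> moment \<nu>M k (h n) a a' (A \<omega>, X \<omega>, M \<omega>, Y \<omega>) al la ga 0"

lemma obs_moment_eq:
  "obs_moment n \<omega> = K a n \<omega> * b1 (W \<omega>) * Y \<omega> + - (K a n \<omega> * 1 * b2 (W \<omega>))
    + K a' n \<omega> * 1 * b3 (W \<omega>) + eta (X \<omega>)"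
  by (simp add: b1_def b2_def b3_def algebra_simps add_divide_distrib diff_divide_distrib)

lemma weights_measurable[measurable]:
  "b1 \<in> borel_measurable Z" "b2 \<in> borel_measurable Z" "b3 \<in> borel_measurable Z"
  "eta \<in> borel_measurable \<nu>X"
proof -
  note [measurable] = admissible_measurable[OF adm] measurable_eta_hat[OF adm]
  show b1: "b1 \<in> borel_measurable Z" unfolding b1_def[abs_def] by measurable
  then show "b2 \<in> borel_measurable Z" unfolding b2_def[abs_def] by measurable
  show "b3 \<in> borel_measurable Z" unfolding b3_def[abs_def] by measurable
  show "eta \<in> borel_measurable \<nu>X" by measurable
qed

lemma weights_le:
  assumes "z \<in> space Q"
  shows "\<bar>b1 z\<bar> \<le> C ^ 3" "\<bar>b2 z\<bar> \<le> 2 * C ^ 4" "\<bar>b3 z\<bar> \<le> 2 * C ^ 4"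
proof -
  have z: "fst z \<in> space \<nu>M" "snd z \<in> space \<nu>X" using assms by auto
  have C: "1 \<le> C" by (rule bounds)
  note t = disjI1[OF refl] and t' = disjI2[OF refl]
  note le = admissible_bounds[OF adm z t] admissible_bounds[OF adm z t']
  have "\<bar>al a' (fst z) (snd z)\<bar> / \<bar>al a (fst z) (snd z)\<bar> \<le> C / (1 / C)"
    using le C by (intro frac_le) auto
  then have "\<bar>b1 z\<bar> \<le> C * (C / (1 / C))"
    unfolding b1_def abs_mult abs_divide using le C by (intro mult_mono) auto
  then show b1: "\<bar>b1 z\<bar> \<le> C ^ 3" by (simp add: power3_eq_cube)
  have "\<bar>b2 z\<bar> \<le> C ^ 3 * C"
    unfolding b2_def abs_mult using b1 le C by (intro mult_mono) auto
  also have "\<dots> \<le> 2 * C ^ 4" using C by (simp add: power4_eq_xxxx power3_eq_cube)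
  finally show "\<bar>b2 z\<bar> \<le> 2 * C ^ 4" .
  have "C \<le> C ^ 3" using power_increasing[of 1 3 C] C by simp
  then have "\<bar>ga (snd z) (fst z) a - eta (snd z)\<bar> \<le> 2 * C ^ 3"
    using le(3) eta_hat_le[OF adm z(2)] by linarith
  then have "\<bar>b3 z\<bar> \<le> C * (2 * C ^ 3)"
    unfolding b3_def abs_mult using le C by (intro mult_mono) auto
  then show "\<bar>b3 z\<bar> \<le> 2 * C ^ 4" by (simp add: power4_eq_xxxx power3_eq_cube)
qed

lemma weights_obs_le:
  assumes "\<omega> \<in> space P"
  shows "\<bar>b1 (W \<omega>)\<bar> \<le> C ^ 3" "\<bar>b2 (W \<omega>)\<bar> \<le> 2 * C ^ 4" "\<bar>b3 (W \<omega>)\<bar> \<le> 2 * C ^ 4"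
    "\<bar>eta (X \<omega>)\<bar> \<le> C ^ 3" "\<bar>cond_mean \<omega>\<bar> \<le> C"
  using assms weights_le[of "W \<omega>"] eta_hat_le[OF adm, of "X \<omega>"] bounds(2)[of "A \<omega>" "M \<omega>" "X \<omega>"] by auto

lemma integrable_kernel:
  "integrable P (\<lambda>\<omega>. (K s n \<omega>)\<^sup>2)" "integrable P (K s n)" "integrable P (\<lambda>\<omega>. K s n \<omega> * Y \<omega>)"
proof -
  show 2: "integrable P (\<lambda>\<omega>. (K s n \<omega>)\<^sup>2)"
  proof (rule integrableI_bounded)
    show "(\<integral>\<^sup>+\<omega>. ennreal (norm ((K s n \<omega>)\<^sup>2)) \<partial>P) < \<infinity>"
      using kernel_second_moment(1)[OF kernel(1,3) bandwidth(1)[of n], of s]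
      by (auto simp: less_top[symmetric] top_unique)
  qed measurable
  then show "integrable P (K s n)"
    by (rule square_integrable_imp_integrable[rotated]) simp
  show "integrable P (\<lambda>\<omega>. K s n \<omega> * Y \<omega>)"
  proof (rule Bochner_Integration.integrable_bound)
    show "integrable P (\<lambda>\<omega>. (K s n \<omega>)\<^sup>2 + (Y \<omega>)\<^sup>2)"
      by (intro Bochner_Integration.integrable_add 2 integrable_outcome_square)
    show "AE \<omega> in P. norm (K s n \<omega> * Y \<omega>) \<le> norm ((K s n \<omega>)\<^sup>2 + (Y \<omega>)\<^sup>2)"
    proof (intro AE_I2)
      fix \<omega>
      have "2 * (\<bar>K s n \<omega>\<bar> * \<bar>Y \<omega>\<bar>) \<le> (K s n \<omega>)\<^sup>2 + (Y \<omega>)\<^sup>2"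
        using zero_le_power2[of "\<bar>K s n \<omega>\<bar> - \<bar>Y \<omega>\<bar>"] by (simp add: power2_diff)
      moreover have "0 \<le> \<bar>K s n \<omega>\<bar> * \<bar>Y \<omega>\<bar>" by simp
      ultimately show "norm (K s n \<omega> * Y \<omega>) \<le> norm ((K s n \<omega>)\<^sup>2 + (Y \<omega>)\<^sup>2)"
        unfolding real_norm_def abs_mult by linarith
    qed
  qed measurable
qed

lemma integrable_terms:
  "integrable P (\<lambda>\<omega>. K a n \<omega> * b1 (W \<omega>) * Y \<omega>)"
  "integrable P (\<lambda>\<omega>. K a n \<omega> * cond_mean \<omega> * b1 (W \<omega>))"
  "integrable P (\<lambda>\<omega>. K a n \<omega> * 1 * b2 (W \<omega>))"
  "integrable P (\<lambda>\<omega>. K a' n \<omega> * 1 * b3 (W \<omega>))"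
  "integrable P (\<lambda>\<omega>. eta (X \<omega>))"
proof -
  have "integrable P (\<lambda>\<omega>. K a n \<omega> * Y \<omega> * b1 (W \<omega>))"
    by (rule integrable_mult_bounded[OF integrable_kernel(3) _ weights_obs_le(1)]) measurable
  then show "integrable P (\<lambda>\<omega>. K a n \<omega> * b1 (W \<omega>) * Y \<omega>)" by (simp add: ac_simps)
  have "integrable P (\<lambda>\<omega>. K a n \<omega> * cond_mean \<omega>)"
    by (rule integrable_mult_bounded[OF integrable_kernel(2) _ weights_obs_le(5)]) measurable
  then show "integrable P (\<lambda>\<omega>. K a n \<omega> * cond_mean \<omega> * b1 (W \<omega>))"
    by (rule integrable_mult_bounded[OF _ _ weights_obs_le(1)]) measurable
  show "integrable P (\<lambda>\<omega>. K a n \<omega> * 1 * b2 (W \<omega>))"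
    unfolding mult_1_right by (rule integrable_mult_bounded[OF integrable_kernel(2) _ weights_obs_le(2)]) measurable
  show "integrable P (\<lambda>\<omega>. K a' n \<omega> * 1 * b3 (W \<omega>))"
    unfolding mult_1_right by (rule integrable_mult_bounded[OF integrable_kernel(2) _ weights_obs_le(3)]) measurable
  show "integrable P (\<lambda>\<omega>. eta (X \<omega>))"
    using weights_obs_le(4) by (intro integrable_const_bound[where B="C ^ 3"] AE_I2) auto
qed

lemma expectation_moment_drift:
  "\<bar>(\<integral>\<omega>. obs_moment n \<omega> \<partial>P) - (\<integral>\<omega>. Ypot a (Mpot a' \<omega>) \<omega> \<partial>P) - (\<integral>z. drift al la ga z \<partial>Q)\<bar> \<le> bias n"
proof -
  let ?Y = "\<integral>\<omega>. K a n \<omega> * b1 (W \<omega>) * Y \<omega> \<partial>P" and ?B1 = "\<integral>\<omega>. K a n \<omega> * cond_mean \<omega> * b1 (W \<omega>) \<partial>P"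
    and ?B2 = "\<integral>\<omega>. K a n \<omega> * 1 * b2 (W \<omega>) \<partial>P" and ?B3 = "\<integral>\<omega>. K a' n \<omega> * 1 * b3 (W \<omega>) \<partial>P"
  have "?Y = (\<integral>\<omega>. K a n \<omega> * b1 (W \<omega>) * (\<integral>\<omega>'. Y \<omega>' \<partial>\<kappa>AMX ((A \<omega>, M \<omega>), X \<omega>)) \<partial>P)"
    using integral_regular_cond_prob_mult[OF prob_space_axioms kernels(3), of Y
        "\<lambda>w. prod_kernel k (h n) (fst (fst w) - a) * b1 (snd (fst w), snd w)"] integrable_terms(1)[of n]
    by simp
  also have "\<dots> = ?B1"
    by (simp add: nuisance(3) ac_simps)
  finally have Y: "?Y = ?B1" .
  have mean: "(\<integral>\<omega>. obs_moment n \<omega> \<partial>P) = ?B1 - ?B2 + ?B3 + (\<integral>x. fX x * eta x \<partial>\<nu>X)"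
    unfolding obs_moment_eq
    by (simp only: Bochner_Integration.integral_add Bochner_Integration.integrable_add integrable_minus
        Bochner_Integration.integral_minus integrable_terms Y integral_law_X weights_measurable)
  have C: "1 \<le> C" by (rule bounds)
  note sm = smoothed_expectation(2)[OF kernel bandwidth]
  have 1: "\<bar>?B1 - (\<integral>z. dens a (fst z) (snd z) * \<gamma> (snd z) (fst z) a * b1 z \<partial>Q)\<bar> \<le> C ^ 3 * smooth_err k h a (\<lambda>t m x. \<gamma> x m t) n"
    using bounds(2) continuous(2)
    by (intro sm[of a "\<lambda>t m x. \<gamma> x m t"] target weights_le integrable_terms) auto
  have 2: "\<bar>?B2 - (\<integral>z. dens a (fst z) (snd z) * 1 * b2 z \<partial>Q)\<bar> \<le> 2 * C ^ 4 * smooth_err k h a (\<lambda>_ _ _. 1) n"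
    using C by (intro sm[of a "\<lambda>_ _ _. 1"] target weights_le integrable_terms) auto
  have 3: "\<bar>?B3 - (\<integral>z. dens a' (fst z) (snd z) * 1 * b3 z \<partial>Q)\<bar> \<le> 2 * C ^ 4 * smooth_err k h a' (\<lambda>_ _ _. 1) n"
    using C by (intro sm[of a' "\<lambda>_ _ _. 1"] target weights_le integrable_terms) auto
  show ?thesis
    using 1 2 3 limit_mean[OF adm] unfolding mean identification bias_def b1_def b2_def b3_def by linarith
qed

lemma expectation_moment_le:
  fixes n :: nat
  assumes \<delta>: "0 < \<delta>"
  defines "D \<equiv> 2 * C ^ 5 * (4 * C + C + C\<^sup>2 / measure T \<A>)"
    and "dev \<equiv> \<bar>(\<integral>\<omega>. obs_moment n \<omega> \<partial>P) - (\<integral>\<omega>. Ypot a (Mpot a' \<omega>) \<omega> \<partial>P)\<bar>"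
  shows "dev \<le> bias n + (D * \<delta> + D / \<delta> * (err_lambda la + err_alpha al))"
    "dev \<le> bias n + (D * \<delta> + D / \<delta> * (err_lambda la + err_gamma ga))"
    "dev \<le> bias n + (D * \<delta> + D / \<delta> * (err_alpha al + err_gamma ga))"
  using expectation_moment_drift[of n] drift_integral_le[OF adm \<delta>] unfolding D_def dev_def by linarith+

lemma second_moment_le:
  defines "V \<equiv> 4 * (C ^ 6 * ((2 + 2 * C + 2 * C\<^sup>2) * (C ^ 3 * (\<integral>u. (k u)\<^sup>2 \<partial>lborel) ^ CARD('d)))
    + 8 * C ^ 8 * (C ^ 3 * (\<integral>u. (k u)\<^sup>2 \<partial>lborel) ^ CARD('d)) + C ^ 6)"
  shows "(\<integral>\<^sup>+\<omega>. ennreal ((obs_moment n \<omega>)\<^sup>2) \<partial>P) \<le> ennreal (V * (1 + 1 / h n ^ CARD('d)))"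
proof -
  define I where "I = C ^ 3 * (\<integral>u. (k u)\<^sup>2 \<partial>lborel) ^ CARD('d)"
  define H where "H = h n ^ CARD('d)"
  have C: "1 \<le> C" by (rule bounds)
  have H: "0 < H" using bandwidth(1)[of n] by (simp add: H_def)
  have I: "0 \<le> I" using C by (simp add: I_def)
  have W: "0 \<le> 2 + 2 * C + 2 * C\<^sup>2" using C by simp
  have sq: "x\<^sup>2 \<le> B\<^sup>2" if "\<bar>x\<bar> \<le> B" for x B :: real
    using that abs_le_square_iff[of x B] by simp
  let ?g = "\<lambda>\<omega>. 4 * (C ^ 6 * ((K a n \<omega>)\<^sup>2 * (Y \<omega>)\<^sup>2) + 4 * C ^ 8 * (K a n \<omega>)\<^sup>2 + 4 * C ^ 8 * (K a' n \<omega>)\<^sup>2 + C ^ 6)"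
  have "(obs_moment n \<omega>)\<^sup>2 \<le> ?g \<omega>" if \<omega>: "\<omega> \<in> space P" for \<omega>
  proof -
    have "(obs_moment n \<omega>)\<^sup>2 \<le> 4 * ((K a n \<omega> * b1 (W \<omega>) * Y \<omega>)\<^sup>2 + (- (K a n \<omega> * 1 * b2 (W \<omega>)))\<^sup>2
        + (K a' n \<omega> * 1 * b3 (W \<omega>))\<^sup>2 + (eta (X \<omega>))\<^sup>2)"
      unfolding obs_moment_eq by (rule square_sum4_le)
    also have "(K a n \<omega> * b1 (W \<omega>) * Y \<omega>)\<^sup>2 = (b1 (W \<omega>))\<^sup>2 * ((K a n \<omega>)\<^sup>2 * (Y \<omega>)\<^sup>2)"
      by (simp add: power_mult_distrib)
    also have "\<dots> \<le> (C ^ 3)\<^sup>2 * ((K a n \<omega>)\<^sup>2 * (Y \<omega>)\<^sup>2)"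
      by (intro mult_right_mono sq weights_obs_le \<omega>) simp
    also have "(- (K a n \<omega> * 1 * b2 (W \<omega>)))\<^sup>2 = (b2 (W \<omega>))\<^sup>2 * (K a n \<omega>)\<^sup>2"
      by (simp add: power_mult_distrib)
    also have "\<dots> \<le> (2 * C ^ 4)\<^sup>2 * (K a n \<omega>)\<^sup>2"
      by (intro mult_right_mono sq weights_obs_le \<omega>) simp
    also have "(K a' n \<omega> * 1 * b3 (W \<omega>))\<^sup>2 = (b3 (W \<omega>))\<^sup>2 * (K a' n \<omega>)\<^sup>2"
      by (simp add: power_mult_distrib)
    also have "\<dots> \<le> (2 * C ^ 4)\<^sup>2 * (K a' n \<omega>)\<^sup>2"
      by (intro mult_right_mono sq weights_obs_le \<omega>) simp
    also have "(eta (X \<omega>))\<^sup>2 \<le> (C ^ 3)\<^sup>2"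
      by (intro sq weights_obs_le \<omega>)
    finally show ?thesis by (simp add: power_mult_distrib flip: power_mult)
  qed
  then have "(\<integral>\<^sup>+\<omega>. ennreal ((obs_moment n \<omega>)\<^sup>2) \<partial>P) \<le> (\<integral>\<^sup>+\<omega>. ennreal (?g \<omega>) \<partial>P)"
    by (intro nn_integral_mono ennreal_leI)
  also have iKY: "integrable P (\<lambda>\<omega>. (K a n \<omega>)\<^sup>2 * (Y \<omega>)\<^sup>2)"
  proof (rule integrableI_bounded)
    show "(\<integral>\<^sup>+\<omega>. ennreal (norm ((K a n \<omega>)\<^sup>2 * (Y \<omega>)\<^sup>2)) \<partial>P) < \<infinity>"
      using kernel_second_moment(2)[OF kernel(1,3) bandwidth(1)[of n], of a]
      by (auto simp: less_top[symmetric] top_unique)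
  qed measurable
  then have "(\<integral>\<^sup>+\<omega>. ennreal (?g \<omega>) \<partial>P) = ennreal (\<integral>\<omega>. ?g \<omega> \<partial>P)"
    using C by (intro nn_integral_eq_integral AE_I2)
      (auto intro!: integrable_mult_right Bochner_Integration.integrable_add integrable_kernel add_nonneg_nonneg)
  also have "(\<integral>\<omega>. ?g \<omega> \<partial>P) = 4 * (C ^ 6 * (\<integral>\<omega>. (K a n \<omega>)\<^sup>2 * (Y \<omega>)\<^sup>2 \<partial>P) + 4 * C ^ 8 * (\<integral>\<omega>. (K a n \<omega>)\<^sup>2 \<partial>P)
      + 4 * C ^ 8 * (\<integral>\<omega>. (K a' n \<omega>)\<^sup>2 \<partial>P) + C ^ 6)"
    using iKY integrable_kernel(1) by (simp add: prob_space)
  also have "\<dots> \<le> 4 * (C ^ 6 * ((2 + 2 * C + 2 * C\<^sup>2) * I / H) + 4 * C ^ 8 * (I / H) + 4 * C ^ 8 * (I / H) + C ^ 6)"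
  proof -
    have le: "(\<integral>\<omega>. f \<omega> \<partial>P) \<le> v" if "(\<integral>\<^sup>+\<omega>. ennreal (f \<omega>) \<partial>P) \<le> ennreal v" "\<And>\<omega>. 0 \<le> f \<omega>" "integrable P f" "0 \<le> v" for f v
      using that by (subst (asm) nn_integral_eq_integral) auto
    have "(\<integral>\<omega>. (K s n \<omega>)\<^sup>2 \<partial>P) \<le> I / H" for s
      using kernel_second_moment(1)[OF kernel(1,3) bandwidth(1)[of n], of s] I H
      by (intro le integrable_kernel) (auto simp: I_def H_def)
    moreover have "(\<integral>\<omega>. (K a n \<omega>)\<^sup>2 * (Y \<omega>)\<^sup>2 \<partial>P) \<le> (2 + 2 * C + 2 * C\<^sup>2) * I / H"
      using kernel_second_moment(2)[OF kernel(1,3) bandwidth(1)[of n], of a] I H W iKY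
      by (intro le) (auto simp: I_def H_def simp del: distrib_left_numeral)
    ultimately show ?thesis using C by (intro mult_left_mono add_mono) auto
  qed
  also have "\<dots> \<le> V * (1 + 1 / H)"
  proof -
    have "V * (1 + 1 / H) - 4 * (C ^ 6 * ((2 + 2 * C + 2 * C\<^sup>2) * I / H) + 4 * C ^ 8 * (I / H) + 4 * C ^ 8 * (I / H) + C ^ 6)
      = 4 * (C ^ 6 * ((2 + 2 * C + 2 * C\<^sup>2) * I) + 8 * C ^ 8 * I) + 4 * C ^ 6 / H"
      using H by (simp add: V_def I_def[symmetric] field_simps)
    moreover have "0 \<le> \<dots>" using C I H W by (intro add_nonneg_nonneg mult_nonneg_nonneg divide_nonneg_nonneg) auto
    ultimately show ?thesis by linarith
  qed
  finally show ?thesis by (simp add: H_def ennreal_leI)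
qed

end

end

declare measurable_k[measurable del] weights_measurable[measurable del]

end

section \<open>Consistency\<close>

lemma measurable_app3:
  assumes f: "(\<lambda>(D, m, x). f D m x) \<in> borel_measurable (N \<Otimes>\<^sub>M (N1 \<Otimes>\<^sub>M N2))"
    and "p \<in> measurable L N" "q \<in> measurable L N1" "r \<in> measurable L N2"
  shows "(\<lambda>y. f (p y) (q y) (r y)) \<in> borel_measurable L"
  using measurable_compose[OF measurable_Pair[OF assms(2) measurable_Pair[OF assms(3,4)]] f] by simp

lemma measurable_app2:
  assumes f: "(\<lambda>(D, x). f D x) \<in> borel_measurable (N \<Otimes>\<^sub>M N1)"
    and "p \<in> measurable L N" "q \<in> measurable L N1"
  shows "(\<lambda>y. f (p y) (q y)) \<in> borel_measurable L"
  using measurable_compose[OF measurable_Pair[OF assms(2,3)] f] by simp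

lemma measurable_moment:
  fixes al :: "'D \<Rightarrow> real^'d::finite \<Rightarrow> 'm \<Rightarrow> 'x \<Rightarrow> real"
  assumes "sigma_finite_measure \<nu>M" and [measurable]: "k \<in> borel_measurable borel"
    and al: "\<And>t. t \<in> {a, a'} \<Longrightarrow> (\<lambda>(D, m, x). al D t m x) \<in> borel_measurable (N \<Otimes>\<^sub>M (\<nu>M \<Otimes>\<^sub>M \<nu>X))"
    and la: "\<And>t. t \<in> {a, a'} \<Longrightarrow> (\<lambda>(D, x). la D t x) \<in> borel_measurable (N \<Otimes>\<^sub>M \<nu>X)"
    and ga: "(\<lambda>(D, m, x). ga D x m a) \<in> borel_measurable (N \<Otimes>\<^sub>M (\<nu>M \<Otimes>\<^sub>M \<nu>X))"
  shows "(\<lambda>(D, z). moment \<nu>M k h a a' z (al D) (la D) (ga D) 0) \<in> borel_measurable (N \<Otimes>\<^sub>M obs_space \<A> \<nu>X \<nu>M \<Y>)"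
proof -
  interpret sigma_finite_measure \<nu>M by fact
  have "a \<in> {a, a'}" "a' \<in> {a, a'}" by auto
  note [measurable (raw)] = this[THEN al, THEN measurable_app3] this[THEN la, THEN measurable_app2] measurable_app3[OF ga]
  have id: "(\<lambda>t. t) \<in> borel_measurable (leb_on \<A>)" "(\<lambda>y. y) \<in> borel_measurable (restrict_space borel \<Y>)"
    by (rule measurable_restrict_space1, simp)+
  let ?O = "N \<Otimes>\<^sub>M (leb_on \<A> \<Otimes>\<^sub>M (\<nu>X \<Otimes>\<^sub>M (\<nu>M \<Otimes>\<^sub>M restrict_space borel \<Y>)))"
  have [measurable]: "(\<lambda>z. fst (snd z)) \<in> borel_measurable ?O"
    by (rule measurable_compose[OF _ id(1)]) measurable
  have [measurable]: "(\<lambda>z. snd (snd (snd (snd z)))) \<in> borel_measurable ?O"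
    by (rule measurable_compose[OF _ id(2)]) measurable
  have [measurable]: "(\<lambda>z. eta_of \<nu>M (al (fst z)) (ga (fst z)) a a' (fst (snd (snd z)))) \<in> borel_measurable ?O"
    unfolding eta_of_def by measurable
  have eq: "(\<lambda>(D, z). moment \<nu>M k h a a' z (al D) (la D) (ga D) 0) = (\<lambda>z. case snd z of (t, x, m, y) \<Rightarrow>
      prod_kernel k h (t - a) * la (fst z) a x * (al (fst z) a' m x / al (fst z) a m x) * (y - ga (fst z) x m a)
      + prod_kernel k h (t - a') * la (fst z) a' x * (ga (fst z) x m a - eta_of \<nu>M (al (fst z)) (ga (fst z)) a a' x)
      + eta_of \<nu>M (al (fst z)) (ga (fst z)) a a' x)"
    by (rule ext) (auto simp: split_beta)
  show ?thesis unfolding obs_space_def eq split_beta by measurable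
qed

lemma cross_fit_consistent:
  fixes Ob :: "nat \<Rightarrow> 's \<Rightarrow> 'o" and g :: "nat \<Rightarrow> nat \<Rightarrow> (nat \<Rightarrow> 'o) \<Rightarrow> 'o \<Rightarrow> real"
  assumes S: "prob_space S" and ind: "prob_space.indep_vars S (\<lambda>_. N) Ob {1..}"
    and law: "\<And>i. 1 \<le> i \<Longrightarrow> distr S N (Ob i) = R" and R: "prob_space R" "sets R = sets N"
    and L: "1 \<le> L" and folds: "\<And>n. (\<Union>l\<in>{1..L}. I n l) = {1..n}"
      "\<And>l. l \<in> {1..L} \<Longrightarrow> (\<lambda>n. real (card (I n l)) / real n) \<longlonglongrightarrow> 1 / real L"
    and g: "\<And>n l. l \<in> {1..L} \<Longrightarrow> (\<lambda>(D, z). g n l D z) \<in> borel_measurable (Pi\<^sub>M (outside_fold I n l) (\<lambda>_. N) \<Otimes>\<^sub>M N)"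
    and V: "\<And>n l D. l \<in> {1..L} \<Longrightarrow> D \<in> space (Pi\<^sub>M (outside_fold I n l) (\<lambda>_. N)) \<Longrightarrow>
        (\<integral>\<^sup>+z. ennreal ((g n l D z)\<^sup>2) \<partial>R) \<le> ennreal (V n)" "\<And>n. 0 \<le> V n" "(\<lambda>n. V n / real n) \<longlonglongrightarrow> 0"
    and mean: "\<And>n l D \<delta>. l \<in> {1..L} \<Longrightarrow> D \<in> space (Pi\<^sub>M (outside_fold I n l) (\<lambda>_. N)) \<Longrightarrow> 0 < \<delta> \<Longrightarrow>
        \<bar>(\<integral>z. g n l D z \<partial>R) - \<psi>\<bar> \<le> \<rho> n + (K * \<delta> + K / \<delta> * err n l D)" "0 < K" "\<rho> \<longlonglongrightarrow> 0"
    and err: "\<And>n l. l \<in> {1..L} \<Longrightarrow> err n l \<in> borel_measurable (Pi\<^sub>M (outside_fold I n l) (\<lambda>_. N))"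
      "\<And>l. l \<in> {1..L} \<Longrightarrow> conv_in_prob S (\<lambda>n s. err n l (training_data I Ob n l s)) 0"
      "\<And>n l D. l \<in> {1..L} \<Longrightarrow> 0 \<le> err n l D"
    and est: "\<And>n l s. l \<in> {1..L} \<Longrightarrow> s \<in> space S \<Longrightarrow>
        (1 / real (card (I n l))) * (\<Sum>i\<in>I n l. g n l (training_data I Ob n l s) (Ob i s) - psi n l s) = 0"
  shows "conv_in_prob S (\<lambda>n s. (1 / real L) * (\<Sum>l=1..L. psi n l s)) \<psi>"
proof -
  interpret prob_space S by (rule S)
  interpret R: prob_space R by (rule R)
  note R(2)[measurable_cong]
  let ?tr = "training_data I Ob"
  define m where "m n l s = (\<integral>z. g n l (?tr n l s) z \<partial>R)" for n l s
  define avg where "avg n l s = (\<Sum>i\<in>I n l. g n l (?tr n l s) (Ob i s)) / card (I n l)" for n l s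
  have Ob: "Ob i \<in> measurable S N" if "1 \<le> i" for i
    using ind that by (simp add: indep_vars_def2)
  have I: "I n l \<subseteq> {1..n}" "finite (I n l)" if "l \<in> {1..L}" for n l
  proof -
    show "I n l \<subseteq> {1..n}" unfolding folds(1)[of n, symmetric] using that by blast
    then show "finite (I n l)" by (rule finite_subset) simp
  qed
  have tr[measurable]: "?tr n l \<in> measurable S (Pi\<^sub>M (outside_fold I n l) (\<lambda>_. N))" for n l
    unfolding training_data_def by (intro measurable_restrict Ob) (auto simp: outside_fold_def)
  have tr_in: "?tr n l s \<in> space (Pi\<^sub>M (outside_fold I n l) (\<lambda>_. N))" if "s \<in> space S" for n l s
    using measurable_space[OF tr that] .
  have m_meas: "m n l \<in> borel_measurable S" if "l \<in> {1..L}" for n l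
  proof -
    have "(\<lambda>(D, z). g n l D z) \<in> borel_measurable (Pi\<^sub>M (outside_fold I n l) (\<lambda>_. N) \<Otimes>\<^sub>M R)"
      unfolding measurable_cong_sets[OF sets_pair_measure_cong[OF refl R(2)] refl] by (rule g[OF that])
    then have "(\<lambda>D. \<integral>z. g n l D z \<partial>R) \<in> borel_measurable (Pi\<^sub>M (outside_fold I n l) (\<lambda>_. N))"
      by (rule R.borel_measurable_lebesgue_integral)
    from measurable_compose[OF tr this] show ?thesis by (simp add: m_def[abs_def])
  qed
  have avg_meas: "avg n l \<in> borel_measurable S" if l: "l \<in> {1..L}" for n l
  proof -
    have "(\<lambda>s. g n l (?tr n l s) (Ob i s)) \<in> borel_measurable S" if "i \<in> I n l" for i
    proof -
      have "1 \<le> i" using that I(1)[OF l, of n] by auto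
      then have "(\<lambda>s. (?tr n l s, Ob i s)) \<in> measurable S (Pi\<^sub>M (outside_fold I n l) (\<lambda>_. N) \<Otimes>\<^sub>M N)"
        using tr Ob by (intro measurable_Pair)
      from measurable_compose[OF this g[OF l]] show ?thesis by simp
    qed
    then show ?thesis unfolding avg_def[abs_def] by measurable
  qed
  have card_pos: "\<forall>\<^sub>F n in sequentially. 0 < card (I n l) \<and> 0 < n" if "l \<in> {1..L}" for l
  proof -
    have "\<forall>\<^sub>F n in sequentially. 0 < real (card (I n l)) / real n"
      using order_tendstoD(1)[OF folds(2)[OF that], of 0] L by simp
    then show ?thesis by eventually_elim (auto simp: zero_less_divide_iff)
  qed
  have conv1: "conv_in_prob S (\<lambda>n s. avg n l s - m n l s) 0" if l: "l \<in> {1..L}" for l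
  proof (rule conv_in_prob_second_moment[OF S])
    show "(\<lambda>s. avg n l s - m n l s) \<in> borel_measurable S" for n
      using avg_meas[OF l] m_meas[OF l] by (rule borel_measurable_diff)
    show "\<forall>\<^sub>F n in sequentially. (\<integral>\<^sup>+s. ennreal ((avg n l s - m n l s)\<^sup>2) \<partial>S) \<le> ennreal (V n / card (I n l))"
      using card_pos[OF l]
    proof eventually_elim
      case (elim n)
      show ?case
        unfolding avg_def m_def training_data_def
      proof (rule second_moment_cross_fit[OF S ind law R])
        show "I n l \<inter> outside_fold I n l = {}" "outside_fold I n l \<subseteq> {1..}"
          by (auto simp: outside_fold_def)
      qed (use elim I(1)[OF l, of n] I(2)[OF l] g[OF l] V(1)[OF l] V(2) in auto)
    qed
    have "(\<lambda>n. (V n / real n) / (real (card (I n l)) / real n)) \<longlonglongrightarrow> 0 / (1 / real L)"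
      using L by (intro tendsto_divide V(3) folds(2) l) auto
    moreover have "\<forall>\<^sub>F n in sequentially. (V n / real n) / (real (card (I n l)) / real n) = V n / real (card (I n l))"
      using card_pos[OF l] by eventually_elim auto
    ultimately show "(\<lambda>n. V n / real (card (I n l))) \<longlonglongrightarrow> 0"
      using Lim_transform_eventually by fastforce
  qed
  define Z where "Z n l s = max 0 (\<bar>m n l s - \<psi>\<bar> - \<rho> n)" for n l s
  have Z_meas: "Z n l \<in> borel_measurable S" if "l \<in> {1..L}" for n l
    using m_meas[OF that, of n] unfolding Z_def[abs_def] by measurable
  have conv2: "conv_in_prob S (\<lambda>n. Z n l) 0" if l: "l \<in> {1..L}" for l
  proof (rule conv_in_prob_absorb[OF S err(2)[OF l] _ _ mean(2)])
    show "(\<lambda>s. err n l (?tr n l s)) \<in> borel_measurable S" for n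
      using measurable_compose[OF tr err(1)[OF l]] by simp
    fix n s and \<delta> :: real assume s: "s \<in> space S" and \<delta>: "0 < \<delta>"
    have "0 \<le> K * \<delta> + K / \<delta> * err n l (?tr n l s)"
      using mean(2) \<delta> err(3)[OF l] by (intro add_nonneg_nonneg mult_nonneg_nonneg) auto
    then show "\<bar>Z n l s\<bar> \<le> K * \<delta> + K / \<delta> * err n l (?tr n l s)"
      using mean(1)[OF l tr_in[OF s] \<delta>, of n] unfolding Z_def m_def by linarith
  qed
  let ?U = "\<lambda>l n s. \<bar>avg n l s - m n l s\<bar> + (Z n l s + \<rho> n)"
  have U: "?U l n \<in> borel_measurable S" if "l \<in> {1..L}" for l n
    using avg_meas[OF that, of n] m_meas[OF that, of n] Z_meas[OF that, of n] by measurable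
  show ?thesis
  proof (rule conv_in_prob_dominated[OF S])
    show "conv_in_prob S (\<lambda>n s. (1 / real L) * (\<Sum>l=1..L. ?U l n s)) 0"
    proof (intro conv_in_prob_cmult conv_in_prob_sum[OF S] U)
      fix l assume l: "l \<in> {1..L}"
      note [measurable] = avg_meas[OF l] m_meas[OF l] Z_meas[OF l]
      show "conv_in_prob S (?U l) 0"
        by (intro conv_in_prob_add[OF S] conv_in_prob_abs conv1 conv2 l conv_in_prob_const mean(3)) measurable
    qed
    show "(\<lambda>s. (1 / real L) * (\<Sum>l=1..L. ?U l n s)) \<in> borel_measurable S" for n
      by (intro borel_measurable_times borel_measurable_const borel_measurable_sum U)
    have "\<forall>\<^sub>F n in sequentially. \<forall>l\<in>{1..L}. 0 < card (I n l) \<and> 0 < n"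
      using card_pos by (intro eventually_ball_finite) auto
    then show "\<forall>\<^sub>F n in sequentially. \<forall>s\<in>space S. \<bar>(1 / real L) * (\<Sum>l=1..L. psi n l s) - \<psi>\<bar> \<le> (1 / real L) * (\<Sum>l=1..L. ?U l n s)"
    proof eventually_elim
      case (elim n)
      show ?case
      proof
        fix s assume s: "s \<in> space S"
        have le: "\<bar>psi n l s - \<psi>\<bar> \<le> ?U l n s" if l: "l \<in> {1..L}" for l
        proof -
          have "psi n l s = avg n l s"
            using est[OF l s, of n] bspec[OF elim l] by (simp add: avg_def sum_subtractf field_simps)
          then show ?thesis unfolding Z_def by simp
        qed
        have "(1 / real L) * (\<Sum>l=1..L. psi n l s) - \<psi> = (1 / real L) * (\<Sum>l=1..L. psi n l s - \<psi>)"
          using L by (simp add: sum_subtractf field_simps)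
        also have "\<bar>\<dots>\<bar> = (1 / real L) * \<bar>\<Sum>l=1..L. psi n l s - \<psi>\<bar>"
          by (simp add: abs_mult)
        also have "\<dots> \<le> (1 / real L) * (\<Sum>l=1..L. \<bar>psi n l s - \<psi>\<bar>)"
          by (intro mult_left_mono sum_abs) simp
        also have "\<dots> \<le> (1 / real L) * (\<Sum>l=1..L. ?U l n s)"
          by (intro mult_left_mono sum_mono le) auto
        finally show "\<bar>(1 / real L) * (\<Sum>l=1..L. psi n l s) - \<psi>\<bar> \<le> (1 / real L) * (\<Sum>l=1..L. ?U l n s)" .
      qed
    qed
  qed
qed

theorem proposition1:
  fixes P :: "'w measure" and S :: "'s measure"
    and \<A> :: "(real^'d::finite) set" and \<nu>M :: "'m measure" and \<nu>X :: "'x measure" and \<Y> :: "real set"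
    and A :: "'w \<Rightarrow> real^'d" and M :: "'w \<Rightarrow> 'm" and X :: "'w \<Rightarrow> 'x" and Y :: "'w \<Rightarrow> real"
    and Ypot :: "real^'d \<Rightarrow> 'm \<Rightarrow> 'w \<Rightarrow> real" and Mpot :: "real^'d \<Rightarrow> 'w \<Rightarrow> 'm"
    and \<kappa>X :: "'x \<Rightarrow> 'w measure" and \<kappa>AX :: "(real^'d) \<times> 'x \<Rightarrow> 'w measure"
    and \<kappa>AMX :: "((real^'d) \<times> 'm) \<times> 'x \<Rightarrow> 'w measure"
    and \<kappa>pot :: "real^'d \<Rightarrow> 'm \<times> 'x \<Rightarrow> 'w measure"
    and fAMX :: "real^'d \<Rightarrow> 'm \<Rightarrow> 'x \<Rightarrow> real" and fX :: "'x \<Rightarrow> real"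
    and fMX :: "'m \<Rightarrow> 'x \<Rightarrow> real" and fAX :: "real^'d \<Rightarrow> 'x \<Rightarrow> real"
    and fA_X :: "real^'d \<Rightarrow> 'x \<Rightarrow> real" and fA_MX :: "real^'d \<Rightarrow> 'm \<Rightarrow> 'x \<Rightarrow> real"
    and fM_AX :: "'m \<Rightarrow> real^'d \<Rightarrow> 'x \<Rightarrow> real" and fA_YMX :: "real^'d \<Rightarrow> real \<Rightarrow> 'm \<Rightarrow> 'x \<Rightarrow> real"
    and \<alpha> :: "real^'d \<Rightarrow> 'm \<Rightarrow> 'x \<Rightarrow> real" and lambda :: "real^'d \<Rightarrow> 'x \<Rightarrow> real"
    and \<gamma> :: "'x \<Rightarrow> 'm \<Rightarrow> real^'d \<Rightarrow> real" and varY :: "real^'d \<Rightarrow> 'm \<Rightarrow> 'x \<Rightarrow> real"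
    and k :: "real \<Rightarrow> real" and h :: "nat \<Rightarrow> real" and C\<^sub>h :: real
    and Ob :: "nat \<Rightarrow> 's \<Rightarrow> (real^'d) \<times> 'x \<times> 'm \<times> real"
    and L :: nat and I :: "nat \<Rightarrow> nat \<Rightarrow> nat set"
    and alpha_hat :: "nat \<Rightarrow> nat \<Rightarrow> (nat \<Rightarrow> (real^'d) \<times> 'x \<times> 'm \<times> real) \<Rightarrow> real^'d \<Rightarrow> 'm \<Rightarrow> 'x \<Rightarrow> real"
    and lambda_hat :: "nat \<Rightarrow> nat \<Rightarrow> (nat \<Rightarrow> (real^'d) \<times> 'x \<times> 'm \<times> real) \<Rightarrow> real^'d \<Rightarrow> 'x \<Rightarrow> real"
    and gamma_hat :: "nat \<Rightarrow> nat \<Rightarrow> (nat \<Rightarrow> (real^'d) \<times> 'x \<times> 'm \<times> real) \<Rightarrow> 'x \<Rightarrow> 'm \<Rightarrow> real^'d \<Rightarrow> real"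
    and psi_hat :: "nat \<Rightarrow> nat \<Rightarrow> 's \<Rightarrow> real" and psi_MR :: "nat \<Rightarrow> 's \<Rightarrow> real"
    and a a' :: "real^'d"
  assumes prob_P: "prob_space P"
    and spaces: "\<A> \<in> sets borel" "\<Y> \<in> sets borel" "sigma_finite_measure \<nu>M" "sigma_finite_measure \<nu>X"
    and observed: "A \<in> measurable P (leb_on \<A>)" "M \<in> measurable P \<nu>M" "X \<in> measurable P \<nu>X"
      "Y \<in> measurable P (restrict_space borel \<Y>)"
    and potential:
      "\<And>t. t \<in> \<A> \<Longrightarrow> Mpot t \<in> measurable P \<nu>M"
      "\<And>t m. t \<in> \<A> \<Longrightarrow> m \<in> space \<nu>M \<Longrightarrow> Ypot t m \<in> measurable P (restrict_space borel \<Y>)"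
      "\<And>t t'. t \<in> \<A> \<Longrightarrow> t' \<in> \<A> \<Longrightarrow>
         (\<lambda>\<omega>. Ypot t (Mpot t' \<omega>) \<omega>) \<in> measurable P (restrict_space borel \<Y>)"
    and target: "a \<in> interior \<A>" "a' \<in> interior \<A>"
  \<comment> \<open>conditional probabilities given values of X, (A,X), (A,M,X) and of a potential mediator with X\<close>
    and kernels: "regular_cond_prob P \<nu>X X \<kappa>X"
      "regular_cond_prob P (leb_on \<A> \<Otimes>\<^sub>M \<nu>X) (\<lambda>\<omega>. (A \<omega>, X \<omega>)) \<kappa>AX"
      "regular_cond_prob P ((leb_on \<A> \<Otimes>\<^sub>M \<nu>M) \<Otimes>\<^sub>M \<nu>X) (\<lambda>\<omega>. ((A \<omega>, M \<omega>), X \<omega>)) \<kappa>AMX"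
      "\<And>t. t \<in> \<A> \<Longrightarrow> regular_cond_prob P (\<nu>M \<Otimes>\<^sub>M \<nu>X) (\<lambda>\<omega>. (Mpot t \<omega>, X \<omega>)) (\<kappa>pot t)"
    and joint_density: "\<And>t m x. t \<in> \<A> \<Longrightarrow> m \<in> space \<nu>M \<Longrightarrow> x \<in> space \<nu>X \<Longrightarrow> 0 \<le> fAMX t m x"
      "distributed P (leb_on \<A> \<Otimes>\<^sub>M (\<nu>M \<Otimes>\<^sub>M \<nu>X)) (\<lambda>\<omega>. (A \<omega>, M \<omega>, X \<omega>))
         (\<lambda>(t, m, x). ennreal (fAMX t m x))"
    and marginals: "\<And>x. fX x = (\<integral>(t, m). fAMX t m x \<partial>(leb_on \<A> \<Otimes>\<^sub>M \<nu>M))"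
      "\<And>m x. fMX m x = (\<integral>t. fAMX t m x \<partial>leb_on \<A>)"
      "\<And>t x. fAX t x = (\<integral>m. fAMX t m x \<partial>\<nu>M)"
    and conditionals: "\<And>t x. fA_X t x = fAX t x / fX x"
      "\<And>t m x. fA_MX t m x = fAMX t m x / fMX m x"
      "\<And>m t x. fM_AX m t x = fAMX t m x / fAX t x"
    and mediator_law: "\<And>t x. t \<in> \<A> \<Longrightarrow> x \<in> space \<nu>X \<Longrightarrow>
         distributed (\<kappa>AX (t, x)) \<nu>M M (\<lambda>m. ennreal (fM_AX m t x))"
    and density_A_YMX: "cond_density P (leb_on \<A>) A
         (restrict_space borel \<Y> \<Otimes>\<^sub>M (\<nu>M \<Otimes>\<^sub>M \<nu>X)) (\<lambda>\<omega>. (Y \<omega>, M \<omega>, X \<omega>))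
         (\<lambda>t (y, m, x). fA_YMX t y m x)"
    and nuisance: "\<And>t x. lambda t x = 1 / fA_X t x"
      "\<And>t m x. \<alpha> t m x = fM_AX m t x"
      "\<And>x m t. \<gamma> x m t = (\<integral>\<omega>. Y \<omega> \<partial>\<kappa>AMX ((t, m), x))"
      "\<And>t m x. varY t m x = (\<integral>\<omega>. (Y \<omega> - \<gamma> x m t)\<^sup>2 \<partial>\<kappa>AMX ((t, m), x))"
    and consistency:
      "\<And>t m \<omega>. t \<in> \<A> \<Longrightarrow> m \<in> space \<nu>M \<Longrightarrow> \<omega> \<in> space P \<Longrightarrow> A \<omega> = t \<Longrightarrow> M \<omega> = m \<Longrightarrow> Ypot t m \<omega> = Y \<omega>"
      "\<And>t \<omega>. t \<in> \<A> \<Longrightarrow> \<omega> \<in> space P \<Longrightarrow> A \<omega> = t \<Longrightarrow> Mpot t \<omega> = M \<omega>"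
    and exchangeability:
      "\<And>t m. t \<in> \<A> \<Longrightarrow> m \<in> space \<nu>M \<Longrightarrow>
         cond_indep_values (restrict_space borel \<Y>) (Ypot t m) (leb_on \<A> \<Otimes>\<^sub>M \<nu>M) \<kappa>AMX \<nu>X \<kappa>X"
      "\<And>t. t \<in> \<A> \<Longrightarrow> cond_indep_values \<nu>M (Mpot t) (leb_on \<A>) \<kappa>AX \<nu>X \<kappa>X"
      "\<And>t t' m. t \<in> \<A> \<Longrightarrow> t' \<in> \<A> \<Longrightarrow> m \<in> space \<nu>M \<Longrightarrow>
         cond_indep_values (restrict_space borel \<Y>) (Ypot t m) \<nu>M (\<kappa>pot t') \<nu>X \<kappa>X"
    and positivity: "\<And>t m x. t \<in> \<A> \<Longrightarrow> m \<in> space \<nu>M \<Longrightarrow> x \<in> space \<nu>X \<Longrightarrow>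
         0 < fM_AX m t x \<and> 0 < fA_X t x"
    and kernel:
      "integrable lborel k" "(\<integral>u. k u \<partial>lborel) = 1"
      "integrable lborel (\<lambda>u. u * k u)" "(\<integral>u. u * k u \<partial>lborel) = 0"
      "integrable lborel (\<lambda>u. u ^ 6 * k u)" "0 < (\<integral>u. u ^ 6 * k u \<partial>lborel)"
      "integrable lborel (\<lambda>u. (k u)\<^sup>2)"
      "integrable lborel (\<lambda>u. u\<^sup>2 * (k u)\<^sup>2)" "0 < (\<integral>u. u\<^sup>2 * (k u)\<^sup>2 \<partial>lborel)"
    and bandwidth: "\<And>n. 0 < h n" "h \<longlonglongrightarrow> 0"
      "filterlim (\<lambda>n. real n * h n ^ CARD('d)) at_top sequentially"
      "(\<lambda>n. real n * h n ^ (CARD('d) + 4)) \<longlonglongrightarrow> C\<^sub>h"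
    and smooth:
      "\<And>y m x. y \<in> \<Y> \<Longrightarrow> m \<in> space \<nu>M \<Longrightarrow> x \<in> space \<nu>X \<Longrightarrow>
         coord_C 3 (interior \<A>) (\<lambda>t. fA_YMX t y m x) \<and> (\<exists>B. coord_derivs_le B 3 \<A> (\<lambda>t. fA_YMX t y m x))"
      "\<And>m x. m \<in> space \<nu>M \<Longrightarrow> x \<in> space \<nu>X \<Longrightarrow>
         coord_C 3 (interior \<A>) (\<lambda>t. fA_MX t m x) \<and> (\<exists>B. coord_derivs_le B 3 \<A> (\<lambda>t. fA_MX t m x))"
      "\<And>x. x \<in> space \<nu>X \<Longrightarrow>
         coord_C 3 (interior \<A>) (\<lambda>t. fA_X t x) \<and> (\<exists>B. coord_derivs_le B 3 \<A> (\<lambda>t. fA_X t x))"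
      "\<And>m x. m \<in> space \<nu>M \<Longrightarrow> x \<in> space \<nu>X \<Longrightarrow>
         coord_C 3 (interior \<A>) (\<lambda>t. \<gamma> x m t) \<and> (\<exists>B. coord_derivs_le B 3 \<A> (\<lambda>t. \<gamma> x m t))"
    and bounded_nuisance:
      "\<exists>B. \<forall>t\<in>\<A>. \<forall>m\<in>space \<nu>M. \<forall>x\<in>space \<nu>X.
         \<bar>\<alpha> t m x\<bar> \<le> B \<and> \<bar>lambda t x\<bar> \<le> B \<and> \<bar>\<gamma> x m t\<bar> \<le> B"
      "\<exists>c>0. \<forall>t\<in>\<A>. \<forall>m\<in>space \<nu>M. \<forall>x\<in>space \<nu>X. c \<le> \<bar>\<alpha> t m x\<bar> \<and> c \<le> \<bar>lambda t x\<bar>"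
    and bounded_estimators:
      "\<exists>B. \<forall>n. \<forall>l\<in>{1..L}. \<forall>D\<in>space (Pi\<^sub>M (outside_fold I n l) (\<lambda>_. obs_space \<A> \<nu>X \<nu>M \<Y>)).
         \<forall>t\<in>\<A>. \<forall>m\<in>space \<nu>M. \<forall>x\<in>space \<nu>X.
         \<bar>alpha_hat n l D t m x\<bar> \<le> B \<and> \<bar>lambda_hat n l D t x\<bar> \<le> B \<and> \<bar>gamma_hat n l D x m t\<bar> \<le> B"
      "\<exists>c>0. \<forall>n. \<forall>l\<in>{1..L}. \<forall>D\<in>space (Pi\<^sub>M (outside_fold I n l) (\<lambda>_. obs_space \<A> \<nu>X \<nu>M \<Y>)).
         \<forall>t\<in>\<A>. \<forall>m\<in>space \<nu>M. \<forall>x\<in>space \<nu>X.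
         c \<le> \<bar>alpha_hat n l D t m x\<bar> \<and> c \<le> \<bar>lambda_hat n l D t x\<bar>"
    and variance:
      "\<And>m x. m \<in> space \<nu>M \<Longrightarrow> x \<in> space \<nu>X \<Longrightarrow> coord_differentiable 2 (interior \<A>) (\<lambda>t. varY t m x)"
      "\<exists>B. \<forall>m\<in>space \<nu>M. \<forall>x\<in>space \<nu>X. coord_derivs_le B 2 \<A> (\<lambda>t. varY t m x)"
    and third_moment: "\<exists>B::real. \<forall>t\<in>\<A>. \<forall>t'\<in>\<A>. \<forall>m\<in>space \<nu>M. \<forall>x\<in>space \<nu>X.
         (\<integral>\<^sup>+\<omega>. ennreal (\<bar>Y \<omega> - \<gamma> x m t\<bar> ^ 3) \<partial>\<kappa>AMX ((t', m), x)) \<le> ennreal B"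
    and kernel_products: "\<And>c c1 c2. c1 \<in> {0, 1, 2, 3::nat} \<Longrightarrow> c2 \<in> {0, 1, 2, 3::nat} \<Longrightarrow> c1 + c2 \<in> {2, 3} \<Longrightarrow>
         integrable lborel (\<lambda>u::real. k u ^ c1 * k (u + c) ^ c2) \<and>
         integrable lborel (\<lambda>u::real. u\<^sup>2 * k u ^ c1 * k (u + c) ^ c2)"
    and prob_S: "prob_space S"
    and iid: "prob_space.indep_vars S (\<lambda>_. obs_space \<A> \<nu>X \<nu>M \<Y>) Ob {1..}"
      "\<And>i. 1 \<le> i \<Longrightarrow> distr S (obs_space \<A> \<nu>X \<nu>M \<Y>) (Ob i) =
         distr P (obs_space \<A> \<nu>X \<nu>M \<Y>) (\<lambda>\<omega>. (A \<omega>, X \<omega>, M \<omega>, Y \<omega>))"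
    and folds: "1 \<le> L" "\<And>n. (\<Union>l\<in>{1..L}. I n l) = {1..n}" "\<And>n. disjoint_family_on (I n) {1..L}"
      "\<And>l. l \<in> {1..L} \<Longrightarrow> (\<lambda>n. real (card (I n l)) / real n) \<longlonglongrightarrow> 1 / real L"
    and measurable_estimators:
      "\<And>n l t. l \<in> {1..L} \<Longrightarrow> t \<in> \<A> \<Longrightarrow> (\<lambda>(D, m, x). alpha_hat n l D t m x) \<in> borel_measurable
         (Pi\<^sub>M (outside_fold I n l) (\<lambda>_. obs_space \<A> \<nu>X \<nu>M \<Y>) \<Otimes>\<^sub>M (\<nu>M \<Otimes>\<^sub>M \<nu>X))"
      "\<And>n l t. l \<in> {1..L} \<Longrightarrow> t \<in> \<A> \<Longrightarrow> (\<lambda>(D, x). lambda_hat n l D t x) \<in> borel_measurable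
         (Pi\<^sub>M (outside_fold I n l) (\<lambda>_. obs_space \<A> \<nu>X \<nu>M \<Y>) \<Otimes>\<^sub>M \<nu>X)"
      "\<And>n l t. l \<in> {1..L} \<Longrightarrow> t \<in> \<A> \<Longrightarrow> (\<lambda>(D, m, x). gamma_hat n l D x m t) \<in> borel_measurable
         (Pi\<^sub>M (outside_fold I n l) (\<lambda>_. obs_space \<A> \<nu>X \<nu>M \<Y>) \<Otimes>\<^sub>M (\<nu>M \<Otimes>\<^sub>M \<nu>X))"
    and fold_estimator: "\<And>n l s. l \<in> {1..L} \<Longrightarrow> s \<in> space S \<Longrightarrow>
         (1 / real (card (I n l))) * (\<Sum>i\<in>I n l. moment \<nu>M k (h n) a a' (Ob i s)
            (alpha_hat n l (training_data I Ob n l s)) (lambda_hat n l (training_data I Ob n l s))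
            (gamma_hat n l (training_data I Ob n l s)) (psi_hat n l s)) = 0"
    and MR_estimator: "\<And>n s. psi_MR n s = (1 / real L) * (\<Sum>l=1..L. psi_hat n l s)"
    and limit_lambda: "\<And>l. l \<in> {1..L} \<Longrightarrow> \<exists>lambda_lim. \<forall>t\<in>\<A>. lambda_lim t \<in> borel_measurable \<nu>X \<and>
         integrable \<nu>X (\<lambda>x. (lambda_lim t x)\<^sup>2 * fX x) \<and>
         conv_in_prob S (\<lambda>n s. \<integral>x. (lambda_hat n l (training_data I Ob n l s) t x - lambda_lim t x)\<^sup>2 * fX x \<partial>\<nu>X) 0"
    and limit_alpha: "\<And>l. l \<in> {1..L} \<Longrightarrow> \<exists>alpha_lim. \<forall>t\<in>\<A>. (\<lambda>(m, x). alpha_lim t m x) \<in> borel_measurable (\<nu>M \<Otimes>\<^sub>M \<nu>X) \<and>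
         integrable (\<nu>M \<Otimes>\<^sub>M \<nu>X) (\<lambda>(m, x). (alpha_lim t m x)\<^sup>2 * fMX m x) \<and>
         conv_in_prob S (\<lambda>n s. \<integral>(m, x). (alpha_hat n l (training_data I Ob n l s) t m x - alpha_lim t m x)\<^sup>2 * fMX m x
           \<partial>(\<nu>M \<Otimes>\<^sub>M \<nu>X)) 0"
    and limit_gamma: "\<And>l. l \<in> {1..L} \<Longrightarrow> \<exists>gamma_lim. \<forall>t\<in>\<A>. (\<lambda>(m, x). gamma_lim x m t) \<in> borel_measurable (\<nu>M \<Otimes>\<^sub>M \<nu>X) \<and>
         integrable (\<nu>M \<Otimes>\<^sub>M \<nu>X) (\<lambda>(m, x). (gamma_lim x m t)\<^sup>2 * fMX m x) \<and>
         conv_in_prob S (\<lambda>n s. \<integral>(m, x). (gamma_hat n l (training_data I Ob n l s) x m t - gamma_lim x m t)\<^sup>2 * fMX m x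
           \<partial>(\<nu>M \<Otimes>\<^sub>M \<nu>X)) 0"
    and two_of_three:
      "let
         conv_lambda = (\<forall>l\<in>{1..L}. \<forall>t\<in>\<A>. conv_in_prob S (\<lambda>n s.
            \<integral>x. (lambda_hat n l (training_data I Ob n l s) t x - lambda t x)\<^sup>2 * fX x \<partial>\<nu>X) 0);
         conv_alpha = (\<forall>l\<in>{1..L}. \<forall>t\<in>\<A>. conv_in_prob S (\<lambda>n s.
            \<integral>(m, x). (alpha_hat n l (training_data I Ob n l s) t m x - \<alpha> t m x)\<^sup>2 * fMX m x \<partial>(\<nu>M \<Otimes>\<^sub>M \<nu>X)) 0);
         conv_gamma = (\<forall>l\<in>{1..L}. \<forall>t\<in>\<A>. conv_in_prob S (\<lambda>n s.
            \<integral>(m, x). (gamma_hat n l (training_data I Ob n l s) x m t - \<gamma> x m t)\<^sup>2 * fMX m x \<partial>(\<nu>M \<Otimes>\<^sub>M \<nu>X)) 0)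
       in (conv_lambda \<and> conv_alpha) \<or> (conv_lambda \<and> conv_gamma) \<or> (conv_alpha \<and> conv_gamma)"
  shows "conv_in_prob S psi_MR (\<integral>\<omega>. Ypot a (Mpot a' \<omega>) \<omega> \<partial>P)"
proof -
  obtain B1 where B1: "\<And>t m x. t \<in> \<A> \<Longrightarrow> m \<in> space \<nu>M \<Longrightarrow> x \<in> space \<nu>X \<Longrightarrow>
        \<bar>\<alpha> t m x\<bar> \<le> B1 \<and> \<bar>lambda t x\<bar> \<le> B1 \<and> \<bar>\<gamma> x m t\<bar> \<le> B1"
    using bounded_nuisance(1) by blast
  obtain c1 where c1: "0 < c1" "\<And>t m x. t \<in> \<A> \<Longrightarrow> m \<in> space \<nu>M \<Longrightarrow> x \<in> space \<nu>X \<Longrightarrow> c1 \<le> \<bar>\<alpha> t m x\<bar> \<and> c1 \<le> \<bar>lambda t x\<bar>"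
    using bounded_nuisance(2) by blast
  obtain B2 where B2: "\<And>n l D t m x. l \<in> {1..L} \<Longrightarrow> D \<in> space (Pi\<^sub>M (outside_fold I n l) (\<lambda>_. obs_space \<A> \<nu>X \<nu>M \<Y>)) \<Longrightarrow>
        t \<in> \<A> \<Longrightarrow> m \<in> space \<nu>M \<Longrightarrow> x \<in> space \<nu>X \<Longrightarrow>
        \<bar>alpha_hat n l D t m x\<bar> \<le> B2 \<and> \<bar>lambda_hat n l D t x\<bar> \<le> B2 \<and> \<bar>gamma_hat n l D x m t\<bar> \<le> B2"
    using bounded_estimators(1) by blast
  obtain c2 where c2: "0 < c2" "\<And>n l D t m x. l \<in> {1..L} \<Longrightarrow> D \<in> space (Pi\<^sub>M (outside_fold I n l) (\<lambda>_. obs_space \<A> \<nu>X \<nu>M \<Y>)) \<Longrightarrow>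
        t \<in> \<A> \<Longrightarrow> m \<in> space \<nu>M \<Longrightarrow> x \<in> space \<nu>X \<Longrightarrow> c2 \<le> \<bar>alpha_hat n l D t m x\<bar> \<and> c2 \<le> \<bar>lambda_hat n l D t x\<bar>"
    using bounded_estimators(2) by blast
  obtain B3 where B3: "\<And>t t' m x. t \<in> \<A> \<Longrightarrow> t' \<in> \<A> \<Longrightarrow> m \<in> space \<nu>M \<Longrightarrow> x \<in> space \<nu>X \<Longrightarrow>
        (\<integral>\<^sup>+\<omega>. ennreal (\<bar>Y \<omega> - \<gamma> x m t\<bar> ^ 3) \<partial>\<kappa>AMX ((t', m), x)) \<le> ennreal B3"
    using third_moment by blast
  define C where "C = 1 + \<bar>B1\<bar> + \<bar>B2\<bar> + \<bar>B3\<bar> + 1 / c1 + 1 / c2"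
  have inv: "0 < 1 / c1" "0 < 1 / c2" using c1(1) c2(1) by auto
  then have C: "1 \<le> C" "B1 \<le> C" "B2 \<le> C" "B3 \<le> C" "1 / c1 \<le> C" "1 / c2 \<le> C"
    unfolding C_def by linarith+
  then have invC: "1 / C \<le> c1" "1 / C \<le> c2"
    using c1(1) c2(1) by (auto simp: field_simps)
  let ?Z = "\<nu>M \<Otimes>\<^sub>M \<nu>X" and ?N = "obs_space \<A> \<nu>X \<nu>M \<Y>"
  let ?psi = "\<integral>\<omega>. Ypot a (Mpot a' \<omega>) \<omega> \<partial>P"
  have continuous: "continuous_on (interior \<A>) (\<lambda>t. fAMX t m x / fMX m x)"
    "continuous_on (interior \<A>) (\<lambda>t. \<gamma> x m t)" if "m \<in> space \<nu>M" "x \<in> space \<nu>X" for m x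
  proof -
    have "coord_C 3 (interior \<A>) f \<Longrightarrow> continuous_on (interior \<A>) f" for f :: "real^'d \<Rightarrow> real"
      unfolding coord_C_def by (metis funpow_0 le0)
    then show "continuous_on (interior \<A>) (\<lambda>t. fAMX t m x / fMX m x)" "continuous_on (interior \<A>) (\<lambda>t. \<gamma> x m t)"
      using smooth(2,4)[OF that] by (auto simp: conditionals)
  qed
  interpret mediation_model P \<A> \<nu>M \<nu>X \<Y> A M X Y Ypot Mpot \<kappa>X \<kappa>AX \<kappa>AMX \<kappa>pot fAMX fX fMX fAX \<alpha> lambda \<gamma> a a' C
  proof (intro mediation_model.intro mediation_model_axioms.intro)
    show "\<bar>\<alpha> t m x\<bar> \<le> C \<and> \<bar>lambda t x\<bar> \<le> C \<and> \<bar>\<gamma> x m t\<bar> \<le> C \<and> 1 / C \<le> \<bar>\<alpha> t m x\<bar> \<and> 1 / C \<le> \<bar>lambda t x\<bar>"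
      if "t \<in> \<A>" "m \<in> space \<nu>M" "x \<in> space \<nu>X" for t m x
      using B1[OF that] c1(2)[OF that] C invC by auto
    show "(\<integral>\<^sup>+\<omega>. ennreal (\<bar>Y \<omega> - \<gamma> x m t\<bar> ^ 3) \<partial>\<kappa>AMX ((t, m), x)) \<le> ennreal C"
      if "t \<in> \<A>" "m \<in> space \<nu>M" "x \<in> space \<nu>X" for t m x
      using B3[OF that(1,1,2,3)] ennreal_leI[OF C(4)] by (rule order_trans)
    show "lambda t x = 1 / (fAX t x / fX x)" for t x by (simp add: nuisance conditionals)
    show "\<alpha> t m x = fAMX t m x / fAX t x" for t m x by (simp add: nuisance conditionals)
    show "distributed (\<kappa>AX (t, x)) \<nu>M M (\<lambda>m. ennreal (\<alpha> t m x))" if "t \<in> \<A>" "x \<in> space \<nu>X" for t x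
      using mediator_law[OF that] by (simp add: nuisance)
    show "0 < \<alpha> t m x \<and> 0 < fAX t x / fX x" if "t \<in> \<A>" "m \<in> space \<nu>M" "x \<in> space \<nu>X" for t m x
      using positivity[OF that] by (simp add: nuisance conditionals)
  qed (fact prob_P spaces observed potential target kernels joint_density marginals nuisance consistency
      exchangeability continuous C(1))+
  note k = kernel(1,2,7) and hn = bandwidth(1,2)
  define ob where "ob \<omega> = (A \<omega>, X \<omega>, M \<omega>, Y \<omega>)" for \<omega>
  define R where "R = distr P ?N ob"
  have ob[measurable]: "ob \<in> measurable P ?N"
    unfolding ob_def[abs_def] obs_space_def using observed by (intro measurable_Pair)
  have R: "prob_space R" "sets R = sets ?N"
    unfolding R_def by (rule prob_space_distr[OF ob]) simp
  define g where "g n l D z = moment \<nu>M k (h n) a a' z (alpha_hat n l D) (lambda_hat n l D) (gamma_hat n l D) 0" for n l D z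
  let ?T = "\<lambda>n l. Pi\<^sub>M (outside_fold I n l) (\<lambda>_. ?N)"
  have g_meas: "(\<lambda>(D, z). g n l D z) \<in> borel_measurable (?T n l \<Otimes>\<^sub>M ?N)" if "l \<in> {1..L}" for n l
    unfolding g_def using spaces(3) borel_measurable_integrable[OF k(1)] measurable_estimators[OF that]
    by (intro measurable_moment) auto
  have adm: "admissible (alpha_hat n l D) (lambda_hat n l D) (gamma_hat n l D)"
    if l: "l \<in> {1..L}" and D: "D \<in> space (?T n l)" for n l D
  proof -
    note sec = measurable_compose[OF measurable_Pair1'[OF D]]
    have "(\<lambda>z. alpha_hat n l D t (fst z) (snd z)) \<in> borel_measurable ?Z" if "t \<in> \<A>" for t
      using sec[OF measurable_estimators(1)[OF l that]] by (simp add: split_beta')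
    moreover have "lambda_hat n l D t \<in> borel_measurable \<nu>X" if "t \<in> \<A>" for t
      using sec[OF measurable_estimators(2)[OF l that]] by simp
    moreover have "(\<lambda>z. gamma_hat n l D (snd z) (fst z) a) \<in> borel_measurable ?Z"
      using sec[OF measurable_estimators(3)[OF l target_in(1)]] by (simp add: split_beta')
    moreover have "\<forall>t\<in>{a, a'}. \<forall>m\<in>space \<nu>M. \<forall>x\<in>space \<nu>X. \<bar>alpha_hat n l D t m x\<bar> \<le> C \<and> \<bar>lambda_hat n l D t x\<bar> \<le> C
        \<and> \<bar>gamma_hat n l D x m a\<bar> \<le> C \<and> 1 / C \<le> \<bar>alpha_hat n l D t m x\<bar>"
    proof (intro ballI)
      fix t m x assume "t \<in> {a, a'}" and mx: "m \<in> space \<nu>M" "x \<in> space \<nu>X"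
      then have "t \<in> \<A>" by auto
      then show "\<bar>alpha_hat n l D t m x\<bar> \<le> C \<and> \<bar>lambda_hat n l D t x\<bar> \<le> C
        \<and> \<bar>gamma_hat n l D x m a\<bar> \<le> C \<and> 1 / C \<le> \<bar>alpha_hat n l D t m x\<bar>"
        using B2[OF l D _ mx, of t] B2[OF l D target_in(1) mx] c2(2)[OF l D _ mx, of t] C invC by auto
    qed
    moreover have "\<forall>t\<in>{a, a'}. t \<in> \<A>" by simp
    ultimately show ?thesis unfolding admissible_def by (intro conjI ballI; blast)
  qed
  have g_sec: "g n l D \<in> borel_measurable ?N" if l: "l \<in> {1..L}" and D: "D \<in> space (?T n l)" for n l D
    using measurable_compose[OF measurable_Pair1'[OF D] g_meas[OF l]] by simp
  define V0 where "V0 = 4 * (C ^ 6 * ((2 + 2 * C + 2 * C\<^sup>2) * (C ^ 3 * (\<integral>u. (k u)\<^sup>2 \<partial>lborel) ^ CARD('d)))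
    + 8 * C ^ 8 * (C ^ 3 * (\<integral>u. (k u)\<^sup>2 \<partial>lborel) ^ CARD('d)) + C ^ 6)"
  define V where "V n = V0 * (1 + 1 / h n ^ CARD('d))" for n
  have V: "(\<integral>\<^sup>+z. ennreal ((g n l D z)\<^sup>2) \<partial>R) \<le> ennreal (V n)"
    if l: "l \<in> {1..L}" and D: "D \<in> space (?T n l)" for n l D
  proof -
    have "(\<integral>\<^sup>+z. ennreal ((g n l D z)\<^sup>2) \<partial>R) = (\<integral>\<^sup>+\<omega>. ennreal ((g n l D (ob \<omega>))\<^sup>2) \<partial>P)"
    proof -
      note [measurable] = g_sec[OF l D]
      show ?thesis unfolding R_def by (rule nn_integral_distr[OF ob]) measurable
    qed
    then show ?thesis
      using second_moment_le[OF k hn adm[OF l D], of n] by (simp add: g_def ob_def V_def V0_def)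
  qed
  have "C ^ 3 * (\<integral>u. (k u)\<^sup>2 \<partial>lborel) ^ CARD('d) \<ge> 0" using C(1) by simp
  then have V_nonneg: "0 \<le> V n" for n
    unfolding V_def V0_def using C(1) hn(1)[of n] by (intro mult_nonneg_nonneg add_nonneg_nonneg) auto
  have V_lim: "(\<lambda>n. V n / real n) \<longlonglongrightarrow> 0"
  proof -
    have "(\<lambda>n. inverse (real n * h n ^ CARD('d))) \<longlonglongrightarrow> 0"
      by (rule tendsto_inverse_0_at_top[OF bandwidth(3)])
    then have "(\<lambda>n. V0 * (inverse (real n) + inverse (real n * h n ^ CARD('d)))) \<longlonglongrightarrow> V0 * (0 + 0)"
      by (intro tendsto_intros lim_inverse_n)
    moreover have "V n / real n = V0 * (inverse (real n) + inverse (real n * h n ^ CARD('d)))" for n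
      by (simp add: V_def divide_inverse algebra_simps)
    ultimately show ?thesis by simp
  qed
  define K where "K = 2 * C ^ 5 * (4 * C + C + C\<^sup>2 / measure (leb_on \<A>) \<A>)"
  have K: "0 < K" unfolding K_def using C(1) measure_treatment(1) by (intro mult_pos_pos add_pos_pos) auto
  have mean_eq: "(\<integral>z. g n l D z \<partial>R) = (\<integral>\<omega>. moment \<nu>M k (h n) a a' (A \<omega>, X \<omega>, M \<omega>, Y \<omega>) (alpha_hat n l D) (lambda_hat n l D) (gamma_hat n l D) 0 \<partial>P)"
    if l: "l \<in> {1..L}" and D: "D \<in> space (?T n l)" for n l D
    unfolding R_def using g_sec[OF l D] by (subst integral_distr[OF ob]) (auto simp: g_def ob_def)
  have law: "distr S ?N (Ob i) = R" if "1 \<le> i" for i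
    using iid(2)[OF that] by (simp add: R_def ob_def[abs_def])
  have est: "(1 / real (card (I n l))) * (\<Sum>i\<in>I n l. g n l (training_data I Ob n l s) (Ob i s) - psi_hat n l s) = 0"
    if "l \<in> {1..L}" "s \<in> space S" for n l s
  proof -
    have "g n l D z - psi = moment \<nu>M k (h n) a a' z (alpha_hat n l D) (lambda_hat n l D) (gamma_hat n l D) psi" for D z psi
      by (cases z) (simp add: g_def)
    then show ?thesis using fold_estimator[OF that, of n] by simp
  qed
  have tr: "training_data I Ob n l \<in> measurable S (?T n l)" for n l
    unfolding training_data_def using iid(1)
    by (intro measurable_restrict) (auto simp: outside_fold_def prob_space.indep_vars_def2[OF prob_S])
  have L_meas: "(\<lambda>D. \<integral>x. (lambda_hat n l D t x - lambda t x)\<^sup>2 * fX x \<partial>\<nu>X) \<in> borel_measurable (?T n l)"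
    and A_meas: "(\<lambda>D. \<integral>(m, x). (alpha_hat n l D t m x - \<alpha> t m x)\<^sup>2 * fMX m x \<partial>?Z) \<in> borel_measurable (?T n l)"
    and G_meas: "(\<lambda>D. \<integral>(m, x). (gamma_hat n l D x m t - \<gamma> x m t)\<^sup>2 * fMX m x \<partial>?Z) \<in> borel_measurable (?T n l)"
    if l: "l \<in> {1..L}" and t: "t \<in> \<A>" for n l t
  proof -
    note [measurable (raw)] = measurable_app3[OF measurable_estimators(1)[OF l t, of n]]
      measurable_app2[OF measurable_estimators(2)[OF l t, of n]] measurable_app3[OF measurable_estimators(3)[OF l t, of n]]
    have [measurable]: "t \<in> space (leb_on \<A>)" using t by simp
    show "(\<lambda>D. \<integral>x. (lambda_hat n l D t x - lambda t x)\<^sup>2 * fX x \<partial>\<nu>X) \<in> borel_measurable (?T n l)"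
      by measurable
    show "(\<lambda>D. \<integral>(m, x). (alpha_hat n l D t m x - \<alpha> t m x)\<^sup>2 * fMX m x \<partial>?Z) \<in> borel_measurable (?T n l)"
      "(\<lambda>D. \<integral>(m, x). (gamma_hat n l D x m t - \<gamma> x m t)\<^sup>2 * fMX m x \<partial>?Z) \<in> borel_measurable (?T n l)"
      unfolding split_beta by measurable
  qed
  define EL EA EG where "EL n l D = err_lambda (lambda_hat n l D)"
    and "EA n l D = err_alpha (alpha_hat n l D)" and "EG n l D = err_gamma (gamma_hat n l D)" for n l D
  have E_meas: "EL n l \<in> borel_measurable (?T n l)" "EA n l \<in> borel_measurable (?T n l)" "EG n l \<in> borel_measurable (?T n l)"
    if l: "l \<in> {1..L}" for n l
    unfolding EL_def[abs_def] EA_def[abs_def] EG_def[abs_def]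
      err_lambda_def[abs_def] err_alpha_def[abs_def] err_gamma_def[abs_def]
    by (intro borel_measurable_add L_meas A_meas G_meas l target_in)+
  have E_nonneg: "0 \<le> EL n l D" "0 \<le> EA n l D" "0 \<le> EG n l D" for n l D
    unfolding EL_def EA_def EG_def by (rule err_nonneg)+
  have consistent: ?thesis
    if E1: "\<And>n l. l \<in> {1..L} \<Longrightarrow> E1 n l \<in> borel_measurable (?T n l)" "\<And>n l D. 0 \<le> E1 n l D"
        "\<And>l. l \<in> {1..L} \<Longrightarrow> conv_in_prob S (\<lambda>n s. E1 n l (training_data I Ob n l s)) 0"
      and E2: "\<And>n l. l \<in> {1..L} \<Longrightarrow> E2 n l \<in> borel_measurable (?T n l)" "\<And>n l D. 0 \<le> E2 n l D"
        "\<And>l. l \<in> {1..L} \<Longrightarrow> conv_in_prob S (\<lambda>n s. E2 n l (training_data I Ob n l s)) 0"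
      and dev: "\<And>n l D \<delta>. l \<in> {1..L} \<Longrightarrow> D \<in> space (?T n l) \<Longrightarrow> 0 < \<delta> \<Longrightarrow>
        \<bar>(\<integral>z. g n l D z \<partial>R) - ?psi\<bar> \<le> bias k h n + (K * \<delta> + K / \<delta> * (E1 n l D + E2 n l D))" for E1 E2
    unfolding MR_estimator[abs_def]
  proof (rule cross_fit_consistent[OF prob_S iid(1) law R folds(1,2,4) g_meas V V_nonneg V_lim dev K bias_tendsto_0[OF k hn] _ _ _ est])
    fix l assume l: "l \<in> {1..L}"
    show "conv_in_prob S (\<lambda>n s. E1 n l (training_data I Ob n l s) + E2 n l (training_data I Ob n l s)) 0"
      by (intro conv_in_prob_add[OF prob_S] E1(3) E2(3) l measurable_compose[OF tr E1(1)] measurable_compose[OF tr E2(1)])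
    show "(\<lambda>D. E1 n l D + E2 n l D) \<in> borel_measurable (?T n l)" for n
      by (intro borel_measurable_add E1(1) E2(1) l)
  qed (auto intro: add_nonneg_nonneg E1(2) E2(2))
  let ?conv = "\<lambda>E. \<forall>l\<in>{1..L}. \<forall>t\<in>\<A>. conv_in_prob S (\<lambda>n s. E n l (training_data I Ob n l s) t) 0"
  let ?L = "\<lambda>n l D t. \<integral>x. (lambda_hat n l D t x - lambda t x)\<^sup>2 * fX x \<partial>\<nu>X"
    and ?A = "\<lambda>n l D t. \<integral>(m, x). (alpha_hat n l D t m x - \<alpha> t m x)\<^sup>2 * fMX m x \<partial>?Z"
    and ?G = "\<lambda>n l D t. \<integral>(m, x). (gamma_hat n l D x m t - \<gamma> x m t)\<^sup>2 * fMX m x \<partial>?Z"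
  have conv: "?conv ?L \<Longrightarrow> conv_in_prob S (\<lambda>n s. EL n l (training_data I Ob n l s)) 0"
    "?conv ?A \<Longrightarrow> conv_in_prob S (\<lambda>n s. EA n l (training_data I Ob n l s)) 0"
    "?conv ?G \<Longrightarrow> conv_in_prob S (\<lambda>n s. EG n l (training_data I Ob n l s)) 0" if l: "l \<in> {1..L}" for l
    unfolding EL_def err_lambda_def EA_def err_alpha_def EG_def err_gamma_def using l
    by (auto intro!: conv_in_prob_add[OF prob_S] measurable_compose[OF tr L_meas] measurable_compose[OF tr A_meas])
  have dev: "\<bar>(\<integral>z. g n l D z \<partial>R) - ?psi\<bar> \<le> bias k h n + (K * \<delta> + K / \<delta> * (EL n l D + EA n l D))"
    "\<bar>(\<integral>z. g n l D z \<partial>R) - ?psi\<bar> \<le> bias k h n + (K * \<delta> + K / \<delta> * (EL n l D + EG n l D))"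
    "\<bar>(\<integral>z. g n l D z \<partial>R) - ?psi\<bar> \<le> bias k h n + (K * \<delta> + K / \<delta> * (EA n l D + EG n l D))"
    if "l \<in> {1..L}" "D \<in> space (?T n l)" "0 < \<delta>" for n l D \<delta>
    unfolding mean_eq[OF that(1,2)] K_def EL_def EA_def EG_def
    by (rule expectation_moment_le[OF k hn adm[OF that(1,2)] that(3)])+
  show ?thesis
    using two_of_three unfolding Let_def
  proof (elim disjE conjE)
    assume "?conv ?L" "?conv ?A"
    then show ?thesis
      by (intro consistent[OF E_meas(1) E_nonneg(1) _ E_meas(2) E_nonneg(2) _ dev(1)] conv)
  next
    assume "?conv ?L" "?conv ?G"
    then show ?thesis
      by (intro consistent[OF E_meas(1) E_nonneg(1) _ E_meas(3) E_nonneg(3) _ dev(2)] conv)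
  next
    assume "?conv ?A" "?conv ?G"
    then show ?thesis
      by (intro consistent[OF E_meas(2) E_nonneg(2) _ E_meas(3) E_nonneg(3) _ dev(3)] conv)
  qed
qed

end
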